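(* Let $\Sigma$ be a simply connected Riemannian surface and $\psi:\Sigma\to\mathbb{S}^3$ be an oriented isometric immersion having negative extrinsic curvature $K$, $K\neq-1$. Let $(u,v)$ be proper null coordinates for the second fundamental form of $\psi$ and $g:\Sigma\to\mathbb{C}\cup\{\infty\}$ a Gauss map of $\Sigma$ compatible with such coordinates. Assume $$\left(\frac{-4K_u}{\sqrt{-K}(1+K)}\right)_v=0 .$$ Then there exists an isometric immersion $\psi^*:\Sigma\to\mathbb{R}^3$ having the same Gauss map $g$. The parameters $(u,v)$ are proper null coordinates for the second fundamental form of $\psi^*$, and $g$ is compatible with such coordinates. Moreover, the immersion has negative extrinsic curvature $K^*$, where $K^*$ is a solution of $$\left\{\begin{array}{l}\left(\log\left(\dfrac{(1+\sqrt{-K})^4}{-K}\right)\right)_u=(\log K^* )_u\\[10pt]\left(\log\left(\dfrac{(-1+\sqrt{-K})^4}{-K}\right)\right)_v=(\log K^* )_v\end{array}\right.\qquad(\ast)$$ Conversely, let $\psi^*:\Sigma\to\mathbb{R}^3$ be an oriented isometric immersion from a simply connected Riemannian surface, having negative extrinsic curvature $K^*$. Let $(u,v)$ be proper null coordinates and $g$ a Gauss map compatible with such coordinates. If there exists a negative function $K:\Sigma\to\mathbb{R}\setminus\{-1\}$ such that $(\ast)$ is satisfied, then there is an isometric immersion $\psi:\Sigma\to\mathbb{S}^3$ having negative extrinsic curvature $K$ and the same Gauss map $g$. Moreover, the parameters $(u,v)$ are proper null coordinates for the second fundamental form of $\psi$ and the Gauss map $g$ is compatible with such coordinates.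
   Context: $\mathbb{S}^3$ is the unit 3-sphere with its Lie group structure and canonical metric, with a left invariant positively oriented orthonormal frame $E_i(q)$, $E_i=E_i(e)$, satisfying $[E_2,E_3]=2E_1$, $[E_3,E_1]=2E_2$, $[E_1,E_2]=2E_3$; $\mathbb R^3$ is regarded as the abelian Lie group with its standard frame. The metric on $\Sigma$ is in each case the one induced by the immersion under consideration. The extrinsic curvature is the determinant of the shape operator. When it is negative, the second fundamental form is Lorentzian. Proper null coordinates $(u,v)$ with compatible unit normal $N$: $\langle-dN,d\psi\rangle=2\mathbf f\,du\,dv$ with $\mathbf f>0$, ordered so that $\psi_u=\frac1{\sqrt{-K}}N\times\nabla_{\psi_u}N$ and $\psi_v=-\frac1{\sqrt{-K}}N\times\nabla_{\psi_v}N$. With $N_i$ the components of $N$ in the left invariant frame, the Gauss map compatible with $(u,v)$ is $g=\frac{N_1+iN_2}{1-N_3}$ for this $N$. For the negative function $K^*$, $(\log K^* )_u$ means $K^*_u/K^*$, i.e. $(\log(-K^* ))_u$, and similarly for $v$.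
   Formalization: The clause that g is compatible with (u,v) for the new immersion is false when -1<K<0 (the Gauss map's Jacobian signs in S^3 and R^3 differ); it is proved for K<-1, and for -1<K<0 with (-u,v) in place of (u,v). In the converse K is taken smooth. *)

theory Defs
  imports "HOL-Analysis.Analysis"
begin

section \<open>Surfaces with coordinates\<close>

text \<open>
  A surface \<open>S\<close> on which global coordinates \<open>(u, v)\<close> are given is a Hausdorff space with a local
  homeomorphism \<open>(u, v)\<close> to the plane: near every point \<open>(u, v)\<close> is a chart, and these charts
  define the smooth structure. The map \<open>(u, v)\<close> is not required to be injective on all of \<open>S\<close>.
\<close>

definition coord_map :: "('a \<Rightarrow> real) \<Rightarrow> ('a \<Rightarrow> real) \<Rightarrow> 'a \<Rightarrow> real^2" where
  "coord_map u v p = vector [u p, v p]"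

definition chart_domain ::
  "'a::t2_space set \<Rightarrow> ('a \<Rightarrow> real) \<Rightarrow> ('a \<Rightarrow> real) \<Rightarrow> 'a set \<Rightarrow> bool" where
  "chart_domain S u v U \<longleftrightarrow>
     openin (top_of_set S) U \<and> open (coord_map u v ` U) \<and>
     homeomorphism U (coord_map u v ` U) (coord_map u v) (inv_into U (coord_map u v))"

definition coordinates_on ::
  "'a::t2_space set \<Rightarrow> ('a \<Rightarrow> real) \<Rightarrow> ('a \<Rightarrow> real) \<Rightarrow> bool" where
  "coordinates_on S u v \<longleftrightarrow> (\<forall>p\<in>S. \<exists>U. p \<in> U \<and> chart_domain S u v U)"

definition local_expr ::
  "('a \<Rightarrow> real) \<Rightarrow> ('a \<Rightarrow> real) \<Rightarrow> 'a set \<Rightarrow> ('a \<Rightarrow> 'b) \<Rightarrow> real^2 \<Rightarrow> 'b" where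
  "local_expr u v U F = F \<circ> inv_into U (coord_map u v)"

primrec Ck_on ::
  "nat \<Rightarrow> 'a::euclidean_space set \<Rightarrow> ('a \<Rightarrow> 'b::real_normed_vector) \<Rightarrow> bool" where
  "Ck_on 0 W F \<longleftrightarrow> continuous_on W F"
| "Ck_on (Suc n) W F \<longleftrightarrow>
     F differentiable_on W \<and> (\<forall>w. Ck_on n W (\<lambda>x. frechet_derivative F (at x) w))"

definition smooth_map ::
  "'a::t2_space set \<Rightarrow> ('a \<Rightarrow> real) \<Rightarrow> ('a \<Rightarrow> real) \<Rightarrow> ('a \<Rightarrow> 'b::real_normed_vector) \<Rightarrow> bool" where
  "smooth_map S u v F \<longleftrightarrow>
     (\<forall>U n. chart_domain S u v U \<longrightarrow> Ck_on n (coord_map u v ` U) (local_expr u v U F))"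

text \<open>
  The differential of \<open>F\<close> at \<open>p\<close> applied to the tangent vector \<open>X $ 1 \<partial>\<^sub>u + X $ 2 \<partial>\<^sub>v\<close>. The value
  does not depend on \<open>U\<close>, since two local inverses of \<open>(u, v)\<close> through \<open>p\<close> agree near \<open>(u p, v p)\<close>.
\<close>

definition diff_at ::
  "'a::t2_space set \<Rightarrow> ('a \<Rightarrow> real) \<Rightarrow> ('a \<Rightarrow> real) \<Rightarrow> ('a \<Rightarrow> 'b::real_normed_vector) \<Rightarrow>
     'a \<Rightarrow> real^2 \<Rightarrow> 'b" where
  "diff_at S u v F p X =
     (THE d. \<exists>U. p \<in> U \<and> chart_domain S u v U \<and>
        d = frechet_derivative (local_expr u v U F) (at (coord_map u v p)) X)"

definition partial_u ::
  "'a::t2_space set \<Rightarrow> ('a \<Rightarrow> real) \<Rightarrow> ('a \<Rightarrow> real) \<Rightarrow> ('a \<Rightarrow> 'b::real_normed_vector) \<Rightarrow> 'a \<Rightarrow> 'b" where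
  "partial_u S u v F p = diff_at S u v F p (axis 1 1)"

definition partial_v ::
  "'a::t2_space set \<Rightarrow> ('a \<Rightarrow> real) \<Rightarrow> ('a \<Rightarrow> real) \<Rightarrow> ('a \<Rightarrow> 'b::real_normed_vector) \<Rightarrow> 'a \<Rightarrow> 'b" where
  "partial_v S u v F p = diff_at S u v F p (axis 2 1)"


section \<open>The ambient Lie groups\<close>

text \<open>
  Quaternion multiplication, with \<open>(a, x)\<close> standing for \<open>a + x\<^sub>1 i + x\<^sub>2 j + x\<^sub>3 k\<close>. The Lie group
  \<open>S\<^sup>3\<close> is \<open>sphere 0 1\<close> with this product and the metric induced from \<open>\<real> \<times> \<real>\<^sup>3\<close>.
\<close>

definition qmult :: "real \<times> (real^3) \<Rightarrow> real \<times> (real^3) \<Rightarrow> real \<times> (real^3)" where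
  "qmult p q =
     (fst p * fst q - snd p \<bullet> snd q, fst p *\<^sub>R snd q + fst q *\<^sub>R snd p + cross3 (snd p) (snd q))"

abbreviation S3 :: "(real \<times> (real^3)) set" where
  "S3 \<equiv> sphere 0 1"

abbreviation R3 :: "(real^3) set" where
  "R3 \<equiv> UNIV"

text \<open>
  Both frames are declared positively oriented; the one on \<open>S\<^sup>3\<close> is \<open>q i, q j, q k\<close>.
\<close>

definition frame_S3 :: "real \<times> (real^3) \<Rightarrow> 3 \<Rightarrow> real \<times> (real^3)" where
  "frame_S3 q i = qmult q (0, axis i 1)"

definition frame_R3 :: "real^3 \<Rightarrow> 3 \<Rightarrow> real^3" where
  "frame_R3 q i = axis i 1"

lemma frame_S3_left_invariant:
  "frame_S3 (qmult p q) i = qmult p (frame_S3 q i)"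
proof -
  have "qmult (qmult a b) c = qmult a (qmult b c)" for a b c
    by (auto simp: qmult_def cross3_simps prod_eq_iff inner_vec_def sum_3 vec_eq_iff forall_3)
  then show ?thesis by (simp add: frame_S3_def)
qed

lemma frame_S3_orthonormal:
  assumes "q \<in> S3"
  shows "frame_S3 q i \<bullet> frame_S3 q j = (if i = j then 1 else 0)" "frame_S3 q i \<bullet> q = 0"
proof -
  have 1: "fst q * fst q + snd q $ 1 * snd q $ 1 + snd q $ 2 * snd q $ 2 + snd q $ 3 * snd q $ 3 = 1"
    using assms by (cases q) (simp add: norm_eq_1 inner_vec_def sum_3)
  show "frame_S3 q i \<bullet> frame_S3 q j = (if i = j then 1 else 0)"
    using exhaust_3[of i] exhaust_3[of j] 1
    by (auto simp: frame_S3_def qmult_def inner_vec_def sum_3 cross3_def axis_def inner_prod_def;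
        algebra)
  show "frame_S3 q i \<bullet> q = 0"
    using exhaust_3[of i]
    by (auto simp: frame_S3_def qmult_def inner_vec_def sum_3 cross3_def axis_def inner_prod_def
        algebra_simps)
qed

text \<open>
  The bracket relations. The fields \<open>E\<^sub>i = \<lambda>q. frame_S3 q i\<close> are restrictions of linear maps, so that
  \<open>[E\<^sub>i, E\<^sub>j](q) = DE\<^sub>j(E\<^sub>i(q)) - DE\<^sub>i(E\<^sub>j(q)) = E\<^sub>j(E\<^sub>i(q)) - E\<^sub>i(E\<^sub>j(q))\<close>.
\<close>

lemma frame_S3_brackets:
  "frame_S3 (frame_S3 q 2) 3 - frame_S3 (frame_S3 q 3) 2 = 2 *\<^sub>R frame_S3 q 1"
  "frame_S3 (frame_S3 q 3) 1 - frame_S3 (frame_S3 q 1) 3 = 2 *\<^sub>R frame_S3 q 2"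
  "frame_S3 (frame_S3 q 1) 2 - frame_S3 (frame_S3 q 2) 1 = 2 *\<^sub>R frame_S3 q 3"
  by (auto simp: frame_S3_def qmult_def cross3_def prod_eq_iff inner_vec_def sum_3 vec_eq_iff
      forall_3 axis_def)


text \<open>
  From here on \<open>M\<close> is a submanifold of a Euclidean space and \<open>E\<close> a positive orthonormal frame of \<open>M\<close>.
\<close>

definition frame_comp :: "('e::euclidean_space \<Rightarrow> 3 \<Rightarrow> 'e) \<Rightarrow> 'e \<Rightarrow> 'e \<Rightarrow> real^3" where
  "frame_comp E q X = (\<chi> i. X \<bullet> E q i)"

definition of_comp :: "('e::euclidean_space \<Rightarrow> 3 \<Rightarrow> 'e) \<Rightarrow> 'e \<Rightarrow> real^3 \<Rightarrow> 'e" where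
  "of_comp E q x = (\<Sum>i\<in>UNIV. x $ i *\<^sub>R E q i)"

definition cross_at :: "('e::euclidean_space \<Rightarrow> 3 \<Rightarrow> 'e) \<Rightarrow> 'e \<Rightarrow> 'e \<Rightarrow> 'e \<Rightarrow> 'e" where
  "cross_at E q X Y = of_comp E q (cross3 (frame_comp E q X) (frame_comp E q Y))"

text \<open>
  \<open>cov_deriv S u v E \<psi> N p X\<close> is the covariant derivative in \<open>M\<close>, in the direction of the tangent
  vector \<open>X\<close> of the surface, of the field \<open>N\<close> along \<open>\<psi>\<close>. The Levi-Civita connection of a submanifold
  of a Euclidean space is the tangential part of the Euclidean derivative.
\<close>

definition cov_deriv ::
  "'a::t2_space set \<Rightarrow> ('a \<Rightarrow> real) \<Rightarrow> ('a \<Rightarrow> real) \<Rightarrow> ('e::euclidean_space \<Rightarrow> 3 \<Rightarrow> 'e) \<Rightarrow>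
     ('a \<Rightarrow> 'e) \<Rightarrow> ('a \<Rightarrow> 'e) \<Rightarrow> 'a \<Rightarrow> real^2 \<Rightarrow> 'e" where
  "cov_deriv S u v E \<psi> N p X =
     of_comp E (\<psi> p) (frame_comp E (\<psi> p) (diff_at S u v N p X))"


section \<open>Immersions, extrinsic curvature, null coordinates, Gauss map\<close>

text \<open>
  The surface carries no separate metric: every immersion is isometric for the metric it induces.
\<close>

definition immersion ::
  "'a::t2_space set \<Rightarrow> ('a \<Rightarrow> real) \<Rightarrow> ('a \<Rightarrow> real) \<Rightarrow> 'e::euclidean_space set \<Rightarrow>
     ('a \<Rightarrow> 'e) \<Rightarrow> bool" where
  "immersion S u v M \<psi> \<longleftrightarrow>
     coordinates_on S u v \<and> smooth_map S u v \<psi> \<and> \<psi> ` S \<subseteq> M \<and>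
     (\<forall>p\<in>S. inj (diff_at S u v \<psi> p))"

definition unit_normal ::
  "'a::t2_space set \<Rightarrow> ('a \<Rightarrow> real) \<Rightarrow> ('a \<Rightarrow> real) \<Rightarrow> ('e::euclidean_space \<Rightarrow> 3 \<Rightarrow> 'e) \<Rightarrow>
     ('a \<Rightarrow> 'e) \<Rightarrow> ('a \<Rightarrow> 'e) \<Rightarrow> bool" where
  "unit_normal S u v E \<psi> N \<longleftrightarrow>
     smooth_map S u v N \<and>
     (\<forall>p\<in>S. N p \<in> span (range (E (\<psi> p))) \<and> norm (N p) = 1 \<and>
            (\<forall>X. N p \<bullet> diff_at S u v \<psi> p X = 0))"

definition second_ff ::
  "'a::t2_space set \<Rightarrow> ('a \<Rightarrow> real) \<Rightarrow> ('a \<Rightarrow> real) \<Rightarrow> ('e::euclidean_space \<Rightarrow> 3 \<Rightarrow> 'e) \<Rightarrow>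
     ('a \<Rightarrow> 'e) \<Rightarrow> ('a \<Rightarrow> 'e) \<Rightarrow> 'a \<Rightarrow> real^2 \<Rightarrow> real^2 \<Rightarrow> real" where
  "second_ff S u v E \<psi> N p X Y = - cov_deriv S u v E \<psi> N p X \<bullet> diff_at S u v \<psi> p Y"

definition shape_operator ::
  "'a::t2_space set \<Rightarrow> ('a \<Rightarrow> real) \<Rightarrow> ('a \<Rightarrow> real) \<Rightarrow> ('e::euclidean_space \<Rightarrow> 3 \<Rightarrow> 'e) \<Rightarrow>
     ('a \<Rightarrow> 'e) \<Rightarrow> ('a \<Rightarrow> 'e) \<Rightarrow> 'a \<Rightarrow> real^2 \<Rightarrow> real^2" where
  "shape_operator S u v E \<psi> N p X =
     (THE Y. diff_at S u v \<psi> p Y = - cov_deriv S u v E \<psi> N p X)"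

definition shape_det ::
  "'a::t2_space set \<Rightarrow> ('a \<Rightarrow> real) \<Rightarrow> ('a \<Rightarrow> real) \<Rightarrow> ('e::euclidean_space \<Rightarrow> 3 \<Rightarrow> 'e) \<Rightarrow>
     ('a \<Rightarrow> 'e) \<Rightarrow> ('a \<Rightarrow> 'e) \<Rightarrow> 'a \<Rightarrow> real" where
  "shape_det S u v E \<psi> N p = det (matrix (shape_operator S u v E \<psi> N p))"

text \<open>The choice of the unit normal is immaterial: replacing \<open>N\<close> by \<open>-N\<close> keeps the determinant.\<close>

definition extrinsic_curvature ::
  "'a::t2_space set \<Rightarrow> ('a \<Rightarrow> real) \<Rightarrow> ('a \<Rightarrow> real) \<Rightarrow> ('e::euclidean_space \<Rightarrow> 3 \<Rightarrow> 'e) \<Rightarrow>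
     ('a \<Rightarrow> 'e) \<Rightarrow> ('a \<Rightarrow> real) \<Rightarrow> bool" where
  "extrinsic_curvature S u v E \<psi> K \<longleftrightarrow>
     (\<exists>N. unit_normal S u v E \<psi> N \<and> (\<forall>p\<in>S. K p = shape_det S u v E \<psi> N p))"

text \<open>
  \<open>N\<close> is the unit normal for which \<open>(u, v)\<close> are proper null coordinates. The second fundamental form
  is compared with \<open>2 f du dv\<close> as a quadratic form, where \<open>du(X) = X $ 1\<close> and \<open>dv(X) = X $ 2\<close>.
\<close>

definition compatible_normal ::
  "'a::t2_space set \<Rightarrow> ('a \<Rightarrow> real) \<Rightarrow> ('a \<Rightarrow> real) \<Rightarrow> ('e::euclidean_space \<Rightarrow> 3 \<Rightarrow> 'e) \<Rightarrow>
     ('a \<Rightarrow> 'e) \<Rightarrow> ('a \<Rightarrow> 'e) \<Rightarrow> bool" where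
  "compatible_normal S u v E \<psi> N \<longleftrightarrow>
     unit_normal S u v E \<psi> N \<and>
     (\<forall>p\<in>S. \<exists>f>0. \<forall>X. second_ff S u v E \<psi> N p X X = 2 * f * X $ 1 * X $ 2) \<and>
     (\<forall>p\<in>S. partial_u S u v \<psi> p =
        (1 / sqrt (- shape_det S u v E \<psi> N p)) *\<^sub>R
          cross_at E (\<psi> p) (N p) (cov_deriv S u v E \<psi> N p (axis 1 1))) \<and>
     (\<forall>p\<in>S. partial_v S u v \<psi> p =
        - (1 / sqrt (- shape_det S u v E \<psi> N p)) *\<^sub>R
          cross_at E (\<psi> p) (N p) (cov_deriv S u v E \<psi> N p (axis 2 1)))"

definition proper_null_coordinates ::
  "'a::t2_space set \<Rightarrow> ('a \<Rightarrow> real) \<Rightarrow> ('a \<Rightarrow> real) \<Rightarrow> ('e::euclidean_space \<Rightarrow> 3 \<Rightarrow> 'e) \<Rightarrow>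
     ('a \<Rightarrow> 'e) \<Rightarrow> bool" where
  "proper_null_coordinates S u v E \<psi> \<longleftrightarrow>
     coordinates_on S u v \<and> (\<exists>N. compatible_normal S u v E \<psi> N)"

text \<open>The stereographic projection; \<open>None\<close> is the point at infinity.\<close>

definition stereo :: "real^3 \<Rightarrow> complex option" where
  "stereo n = (if n $ 3 = 1 then None else Some (Complex (n $ 1) (n $ 2) / of_real (1 - n $ 3)))"

definition gauss_map ::
  "'a::t2_space set \<Rightarrow> ('a \<Rightarrow> real) \<Rightarrow> ('a \<Rightarrow> real) \<Rightarrow> ('e::euclidean_space \<Rightarrow> 3 \<Rightarrow> 'e) \<Rightarrow>
     ('a \<Rightarrow> 'e) \<Rightarrow> ('a \<Rightarrow> complex option) \<Rightarrow> bool" where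
  "gauss_map S u v E \<psi> g \<longleftrightarrow>
     (\<exists>N. unit_normal S u v E \<psi> N \<and> (\<forall>p\<in>S. g p = stereo (frame_comp E (\<psi> p) (N p))))"

text \<open>
  For a normal \<open>n\<close> given by its frame components, ordered null coordinates with \<open>f > 0\<close> satisfy
  \<open>det (n, n\<^sub>u, n\<^sub>v) < 0\<close> in \<open>\<real>\<^sup>3\<close> and in \<open>S\<^sup>3\<close> with \<open>K < -1\<close>, but \<open>det (n, n\<^sub>u, n\<^sub>v) > 0\<close> in \<open>S\<^sup>3\<close> with
  \<open>-1 < K < 0\<close>. So a Gauss map shared by a surface of the latter kind and a surface in \<open>\<real>\<^sup>3\<close> can be
  compatible with \<open>(u, v)\<close> for one of them only; for the other it is compatible with \<open>(-u, v)\<close>.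
\<close>

definition compatible_gauss_map ::
  "'a::t2_space set \<Rightarrow> ('a \<Rightarrow> real) \<Rightarrow> ('a \<Rightarrow> real) \<Rightarrow> ('e::euclidean_space \<Rightarrow> 3 \<Rightarrow> 'e) \<Rightarrow>
     ('a \<Rightarrow> 'e) \<Rightarrow> ('a \<Rightarrow> complex option) \<Rightarrow> bool" where
  "compatible_gauss_map S u v E \<psi> g \<longleftrightarrow>
     (\<exists>N. compatible_normal S u v E \<psi> N \<and> (\<forall>p\<in>S. g p = stereo (frame_comp E (\<psi> p) (N p))))"

definition curvature_system ::
  "'a::t2_space set \<Rightarrow> ('a \<Rightarrow> real) \<Rightarrow> ('a \<Rightarrow> real) \<Rightarrow> ('a \<Rightarrow> real) \<Rightarrow> ('a \<Rightarrow> real) \<Rightarrow> bool" where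
  "curvature_system S u v K K' \<longleftrightarrow>
     (\<forall>p\<in>S.
        partial_u S u v (\<lambda>q. ln ((1 + sqrt (- K q)) ^ 4 / (- K q))) p = partial_u S u v K' p / K' p \<and>
        partial_v S u v (\<lambda>q. ln ((-1 + sqrt (- K q)) ^ 4 / (- K q))) p = partial_v S u v K' p / K' p)"

end

theory Submission
  imports Defs
begin

text \<open>
  Let \<open>n\<close> be the normal in the left invariant frame, \<open>a, b\<close> the components of \<open>\<psi>\<^sub>u, \<psi>\<^sub>v\<close>, and
  \<open>s = sqrt (-K)\<close>, \<open>r = sqrt (-K*)\<close>. Compatible null coordinates mean \<open>(s - 1) a = n \<times> n\<^sub>u\<close> and
  \<open>(s + 1) b = - n \<times> n\<^sub>v\<close> in \<open>S\<^sup>3\<close>, but \<open>r a* = n \<times> n\<^sub>u\<close> and \<open>r b* = - n \<times> n\<^sub>v\<close> in \<open>\<real>\<^sup>3\<close>. So a common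
  Gauss map forces \<open>r a* = (s - 1) a\<close> and \<open>r b* = (s + 1) b\<close>, and each immersion is found by integrating
  the form determined by the other one. By the Codazzi equation, closedness of \<open>a* du + b* dv\<close> and
  flatness of \<open>a du + b dv\<close>, that is \<open>a\<^sub>v - b\<^sub>u = 2 a \<times> b\<close>, imply each other exactly when \<open>(*)\<close> holds; and
  \<open>(*)\<close>, as a system for \<open>log r\<close>, is integrable exactly when the hypothesis on \<open>K\<close> holds. Flat linear
  systems are solved locally by Picard iteration and globally by continuation along paths, which is
  independent of the path by simple connectedness. The factor \<open>s - 1\<close> is negative for \<open>-1 < K\<close>; then
  \<open>(n, a, b)\<close> and \<open>(n, a*, b*)\<close> have opposite orientations.
\<close>

section \<open>Functions of class \<open>C\<^sup>k\<close>\<close>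

text \<open>The shifts in \<open>s - 1\<close> and \<open>s + 1\<close> come from the group: for
  \<open>N = \<psi> n\<close> with quaternions, the covariant derivative of \<open>N\<close> in
  direction \<open>u\<close> has components \<open>n\<^sub>u + a \<times> n\<close>, and
  \<open>n \<times> (a \<times> n) = a\<close>. The second fundamental form is
  \<open>2 s D du dv\<close> with \<open>D = det (n, a, b)\<close>, and \<open>2 r D du dv\<close>
  in Euclidean space, so the sign of \<open>D\<close> decides compatibility. Passing between the two
  spaces multiplies \<open>D\<close> by a positive multiple of \<open>s - 1\<close> or of its
  inverse. A negative sign can be repaired by reversing \<open>n\<close>, which keeps the
  coordinates, or by reversing \<open>u\<close>, which keeps the Gauss map, but not by both at once.
  Two obstacles shape the rest. The coordinates need not be injective on the surface, so it cannot
  be treated as a plane domain: equations are solved on coordinate balls and continued over a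
  topological space. And the given curvature is only known as a determinant for some unit normal,
  possibly not the compatible one, so its root must be matched with the null equations before they
  can be used.\<close>

lemma Ck_on_cong:
  assumes "open W" "\<And>x. x \<in> W \<Longrightarrow> f x = g x"
  shows "Ck_on n W f \<longleftrightarrow> Ck_on n W g"
  using assms(2)
proof (induction n arbitrary: f g)
  case 0
  then show ?case by (simp cong: continuous_on_cong)
next
  case (Suc n)
  have imp: "g differentiable_on W" if "\<And>x. x \<in> W \<Longrightarrow> f x = g x" "f differentiable_on W"
    for f g :: "'a \<Rightarrow> 'b"
    unfolding differentiable_on_def
  proof
    fix x assume "x \<in> W"
    then show "g differentiable at x within W"
      using that by - (rule differentiable_transform_within[of f x W 1], auto simp: differentiable_on_def)
  qed
  have diff: "f differentiable_on W \<longleftrightarrow> g differentiable_on W" if "\<And>x. x \<in> W \<Longrightarrow> f x = g x"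
    for f g :: "'a \<Rightarrow> 'b"
    by (rule iffI; erule imp[rotated]; simp add: that)
  have fr: "frechet_derivative f (at x) = frechet_derivative g (at x)"
    if "x \<in> W" "f differentiable_on W" for x
  proof (rule frechet_derivative_transform_within_open[OF _ assms(1) that(1) Suc.prems])
    show "f differentiable at x"
      using that assms(1) unfolding differentiable_on_def by (metis at_within_open)
  qed
  show ?case
  proof (cases "f differentiable_on W")
    case True
    have "Ck_on n W (\<lambda>x. frechet_derivative f (at x) w) \<longleftrightarrow> Ck_on n W (\<lambda>x. frechet_derivative g (at x) w)" for w
      by (rule Suc.IH) (simp add: fr True)
    then show ?thesis using diff[of f g] Suc.prems by simp
  next
    case False
    then show ?thesis using diff[of f g] Suc.prems by simp
  qed
qed

text \<open>Any explicit derivative \<open>f'\<close> may stand in for the choice-based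
  \<open>frechet_derivative\<close> of the definition, so the closure rules reduce to the usual
  differentiation rules and induction on the order.\<close>

lemma Ck_on_SucI:
  assumes "open W" "\<And>x. x \<in> W \<Longrightarrow> (f has_derivative f' x) (at x)"
    and "\<And>w. Ck_on n W (\<lambda>x. f' x w)"
  shows "Ck_on (Suc n) W f"
proof -
  have "Ck_on n W (\<lambda>x. frechet_derivative f (at x) w)" for w
    using assms(3)[of w]
    by (rule iffD1[OF Ck_on_cong[OF assms(1)], rotated]) (simp add: frechet_derivative_at[OF assms(2), symmetric])
  moreover have "f differentiable_on W"
    unfolding differentiable_on_def
    using assms(2) has_derivative_at_withinI by (blast intro: differentiableI)
  ultimately show ?thesis by simp
qed

lemma Ck_on_Suc_has_derivative:
  assumes "open W" "Ck_on (Suc n) W f" "x \<in> W"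
  shows "(f has_derivative frechet_derivative f (at x)) (at x)"
proof -
  have "f differentiable (at x within W)" using assms(2,3) by (simp add: differentiable_on_def)
  then have "f differentiable (at x)" using at_within_open[OF assms(3,1)] by simp
  then show ?thesis by (simp only: frechet_derivative_works)
qed

lemma Ck_on_SucD: "Ck_on (Suc n) W f \<Longrightarrow> Ck_on n W (\<lambda>x. frechet_derivative f (at x) w)"
  by simp

lemma Ck_on_Suc_imp: "Ck_on (Suc n) W f \<Longrightarrow> Ck_on n W f"
proof (induction n arbitrary: f)
  case 0
  then show ?case by (simp add: differentiable_imp_continuous_on)
next
  case (Suc n)
  have "f differentiable_on W" using Suc.prems by simp
  moreover have "Ck_on n W (\<lambda>x. frechet_derivative f (at x) w)" for w
    by (rule Suc.IH[OF Ck_on_SucD[OF Suc.prems]])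
  ultimately show ?case by simp
qed

lemma Ck_on_imp_continuous_on: "Ck_on n W f \<Longrightarrow> continuous_on W f"
  by (cases n) (simp_all add: differentiable_imp_continuous_on)

lemma Ck_on_const: "open W \<Longrightarrow> Ck_on n W (\<lambda>x. c)"
proof (induction n arbitrary: c)
  case 0
  then show ?case by simp
next
  case (Suc n)
  show ?case
    by (rule Ck_on_SucI[where f'="\<lambda>x w. 0"]) (use Suc in auto)
qed

lemma Ck_on_subset:
  assumes "open W" "open W'" "W' \<subseteq> W"
  shows "Ck_on n W f \<Longrightarrow> Ck_on n W' f"
proof (induction n arbitrary: f)
  case 0
  then show ?case using continuous_on_subset[OF _ assms(3)] by simp
next
  case (Suc n)
  have "f differentiable_on W'"
    by (rule differentiable_on_subset[OF _ assms(3)]) (use Suc.prems in simp)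
  then show ?case using Suc.IH[OF Ck_on_SucD[OF Suc.prems]] by simp
qed

lemma Ck_on_bounded_linear:
  assumes "open W" "bounded_linear L"
  shows "Ck_on n W f \<Longrightarrow> Ck_on n W (\<lambda>x. L (f x))"
proof (induction n arbitrary: f)
  case 0
  then show ?case using bounded_linear.continuous_on[OF assms(2)] by simp
next
  case (Suc n)
  show ?case
    by (rule Ck_on_SucI[OF assms(1) bounded_linear.has_derivative[OF assms(2)
            Ck_on_Suc_has_derivative[OF assms(1) Suc.prems]]])
      (assumption, rule Suc.IH[OF Ck_on_SucD[OF Suc.prems]])
qed

lemma Ck_on_add:
  assumes "open W"
  shows "Ck_on n W f \<Longrightarrow> Ck_on n W g \<Longrightarrow> Ck_on n W (\<lambda>x. f x + g x)"
proof (induction n arbitrary: f g)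
  case 0
  then show ?case by (simp add: continuous_on_add)
next
  case (Suc n)
  note d = Ck_on_Suc_has_derivative[OF assms]
  show ?case
    by (rule Ck_on_SucI[OF assms has_derivative_add[OF d[OF Suc.prems(1)] d[OF Suc.prems(2)]]])
      (assumption, assumption, rule Suc.IH[OF Ck_on_SucD[OF Suc.prems(1)] Ck_on_SucD[OF Suc.prems(2)]])
qed

lemma Ck_on_bilinear:
  assumes "open W" "bounded_bilinear h"
  shows "Ck_on n W f \<Longrightarrow> Ck_on n W g \<Longrightarrow> Ck_on n W (\<lambda>x. h (f x) (g x))"
proof (induction n arbitrary: f g)
  case 0
  then show ?case using bounded_bilinear.continuous_on[OF assms(2)] by simp
next
  case (Suc n)
  show ?case
  proof (rule Ck_on_SucI[OF assms(1)])
    fix x assume "x \<in> W"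
    then show "((\<lambda>x. h (f x) (g x)) has_derivative
        (\<lambda>w. h (f x) (frechet_derivative g (at x) w) + h (frechet_derivative f (at x) w) (g x))) (at x)"
      by (intro bounded_bilinear.FDERIV[OF assms(2)] Ck_on_Suc_has_derivative[OF assms(1) Suc.prems(1)]
          Ck_on_Suc_has_derivative[OF assms(1) Suc.prems(2)])
  next
    show "Ck_on n W (\<lambda>x. h (f x) (frechet_derivative g (at x) w) + h (frechet_derivative f (at x) w) (g x))" for w
      by (intro Ck_on_add[OF assms(1)] Suc.IH Ck_on_SucD[OF Suc.prems(1)] Ck_on_SucD[OF Suc.prems(2)] Ck_on_Suc_imp[OF Suc.prems(1)]
        Ck_on_Suc_imp[OF Suc.prems(2)])
  qed
qed

lemmas Ck_on_scaleR = Ck_on_bilinear[OF _ bounded_bilinear_scaleR]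
lemmas Ck_on_mult = Ck_on_bilinear[OF _ bounded_bilinear_mult]

text \<open>\<open>\<phi>'\<close> is a function of \<open>x\<close>, not of \<open>f x\<close>: the
  derivatives of \<open>inverse\<close>, \<open>exp\<close> and \<open>sqrt\<close> are expressed
  through \<open>\<phi> (f x)\<close> itself, so in the three applications below the induction
  hypothesis supplies the regularity of \<open>\<phi>'\<close>.\<close>

lemma Ck_on_compose_Suc:
  fixes f :: "'a::euclidean_space \<Rightarrow> real"
  assumes "open W" "\<And>x. x \<in> W \<Longrightarrow> (\<phi> has_real_derivative \<phi>' x) (at (f x))"
    and "Ck_on (Suc n) W f" "Ck_on n W \<phi>'"
  shows "Ck_on (Suc n) W (\<lambda>x. \<phi> (f x))"
  by (rule Ck_on_SucI[OF assms(1)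
        DERIV_compose_FDERIV[OF assms(2) Ck_on_Suc_has_derivative[OF assms(1,3)]]])
    (assumption, assumption, intro Ck_on_mult[OF assms(1)] Ck_on_SucD[OF assms(3)] assms(4))

lemma Ck_on_inverse:
  fixes f :: "'a::euclidean_space \<Rightarrow> real"
  assumes "open W" "\<And>x. x \<in> W \<Longrightarrow> f x \<noteq> 0"
  shows "Ck_on n W f \<Longrightarrow> Ck_on n W (\<lambda>x. inverse (f x))"
proof (induction n)
  case 0
  then show ?case using assms(2) by (simp add: continuous_on_inverse)
next
  case (Suc n)
  note IH = Suc.IH[OF Ck_on_Suc_imp[OF Suc.prems]]
  show ?case
    by (rule Ck_on_compose_Suc[OF assms(1) _ Suc.prems, where \<phi>'="\<lambda>x. - 1 * (inverse (f x) * inverse (f x))"])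
      (use DERIV_inverse[OF assms(2)] in \<open>simp add: numeral_2_eq_2\<close>,
        intro Ck_on_mult[OF assms(1)] Ck_on_const[OF assms(1)] IH)
qed

lemma Ck_on_exp:
  fixes f :: "'a::euclidean_space \<Rightarrow> real"
  assumes "open W"
  shows "Ck_on n W f \<Longrightarrow> Ck_on n W (\<lambda>x. exp (f x))"
proof (induction n)
  case 0
  then show ?case by (simp add: continuous_on_exp)
next
  case (Suc n)
  show ?case
    by (rule Ck_on_compose_Suc[OF assms(1) DERIV_exp Suc.prems Suc.IH[OF Ck_on_Suc_imp[OF Suc.prems]]])
qed

lemma Ck_on_sqrt:
  fixes f :: "'a::euclidean_space \<Rightarrow> real"
  assumes "open W" "\<And>x. x \<in> W \<Longrightarrow> f x > 0"
  shows "Ck_on n W f \<Longrightarrow> Ck_on n W (\<lambda>x. sqrt (f x))"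
proof (induction n)
  case 0
  then show ?case by (simp add: continuous_on_real_sqrt)
next
  case (Suc n)
  have nz: "sqrt (f x) \<noteq> 0" if "x \<in> W" for x using assms(2)[OF that] by simp
  note IH = Ck_on_inverse[OF assms(1) nz Suc.IH[OF Ck_on_Suc_imp[OF Suc.prems]]]
  show ?case
    by (rule Ck_on_compose_Suc[OF assms(1) _ Suc.prems, where \<phi>'="\<lambda>x. inverse (sqrt (f x)) * (1/2)"])
      (use DERIV_real_sqrt[OF assms(2)] in simp,
        intro Ck_on_mult[OF assms(1)] Ck_on_const[OF assms(1)] IH)
qed

section \<open>Radial integrals\<close>

lemma radial_in_convex:
  fixes z :: "'a::real_vector"
  assumes "convex W" "z0 \<in> W" "z \<in> W" "t \<in> {0..1}"
  shows "z0 + t *\<^sub>R (z - z0) \<in> W"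
proof -
  have "z0 + t *\<^sub>R (z - z0) = (1 - t) *\<^sub>R z0 + t *\<^sub>R z" by (simp add: algebra_simps)
  then show ?thesis using assms by (auto intro: convexD)
qed

text \<open>The derivative of the ray in its end point is multiplication by \<open>t\<close>, so
  differentiating under the integral raises the weight by one. Keeping the weight
  \<open>t ^ m\<close> general closes this family of integrals under differentiation, as the
  induction on the order requires.\<close>

lemma radial_integral_has_derivative:
  fixes a :: "'a::euclidean_space \<Rightarrow> 'b::euclidean_space"
  assumes W: "open W" "convex W" "z0 \<in> W" and a: "Ck_on (Suc 0) W a" and z: "z \<in> W"
  shows "((\<lambda>z. integral {0..1} (\<lambda>t. t ^ m *\<^sub>R a (z0 + t *\<^sub>R (z - z0)))) has_derivative
     (\<lambda>w. integral {0..1} (\<lambda>t. t ^ Suc m *\<^sub>R frechet_derivative a (at (z0 + t *\<^sub>R (z - z0))) w))) (at z)"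
proof -
  let ?g = "\<lambda>z t. z0 + t *\<^sub>R (z - z0)"
  \<comment> \<open>The Leibniz rule asks for a continuous family of bounded linear maps; in finite
    dimension continuity of \<open>D\<close> may be tested on basis vectors, which is what
    \<open>Ck_on\<close> provides.\<close>
  define D where "D x = Blinfun (frechet_derivative a (at x))" for x
  have gW: "?g z t \<in> W" if "z \<in> W" "t \<in> {0..1}" for z t
    using radial_in_convex[OF W(2,3)] that by blast
  note d = Ck_on_Suc_has_derivative[OF W(1) a]
  have Dapp: "blinfun_apply (D x) = frechet_derivative a (at x)" if "x \<in> W" for x
    unfolding D_def by (rule bounded_linear_Blinfun_apply) (rule has_derivative_bounded_linear[OF d[OF that]])
  have cD: "continuous_on W D"
  proof (rule continuous_on_blinfun_componentwise)
    fix i :: 'a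
    show "continuous_on W (\<lambda>x. blinfun_apply (D x) i)"
      using Ck_on_SucD[OF a, of i] by (simp add: Dapp cong: continuous_on_cong)
  qed
  define fx where "fx z t = (t ^ Suc m) *\<^sub>R D (?g z t)" for z t
  have ca: "continuous_on W a" by (rule Ck_on_imp_continuous_on[OF a])
  have cfx: "continuous_on (W \<times> cbox 0 1) (\<lambda>(z, t). fx z t)"
    unfolding fx_def split_beta
    by (intro continuous_intros continuous_on_compose2[OF cD]) (auto simp: gW)
  have "((\<lambda>z. integral (cbox 0 1) (\<lambda>t. t ^ m *\<^sub>R a (?g z t))) has_derivative
      blinfun_apply (integral (cbox 0 1) (fx z))) (at z within W)"
  proof (rule leibniz_rule[OF _ _ cfx z W(2)])
    show "(\<lambda>t. t ^ m *\<^sub>R a (?g z t)) integrable_on cbox 0 1" if "z \<in> W" for z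
      by (intro integrable_continuous continuous_intros continuous_on_compose2[OF ca]) (use gW that in auto)
    show "((\<lambda>z. t ^ m *\<^sub>R a (?g z t)) has_derivative blinfun_apply (fx z t)) (at z within W)"
      if "z \<in> W" "t \<in> cbox 0 1" for z t
    proof -
      have t: "t \<in> {0..1}" using that by simp
      have "((\<lambda>z. a (?g z t)) has_derivative (\<lambda>w. frechet_derivative a (at (?g z t)) (t *\<^sub>R w))) (at z within W)"
        by (rule has_derivative_compose[where f="\<lambda>z. ?g z t" and g=a and f'="\<lambda>w. t *\<^sub>R w" and x=z,
              OF _ d[OF gW[OF that(1) t]]])
          (auto intro!: derivative_eq_intros)
      then have "((\<lambda>z. t ^ m *\<^sub>R a (?g z t)) has_derivative
          (\<lambda>w. t ^ m *\<^sub>R frechet_derivative a (at (?g z t)) (t *\<^sub>R w))) (at z within W)"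
        by (intro has_derivative_scaleR_right)
      moreover have "(\<lambda>w. t ^ m *\<^sub>R frechet_derivative a (at (?g z t)) (t *\<^sub>R w)) = blinfun_apply (fx z t)"
        by (rule ext) (simp add: fx_def Dapp[OF gW[OF that(1) t], symmetric] blinfun.scaleR_left blinfun.scaleR_right)
      ultimately show ?thesis by simp
    qed
  qed
  moreover have "blinfun_apply (integral (cbox 0 1) (fx z)) =
      (\<lambda>w. integral {0..1} (\<lambda>t. t ^ Suc m *\<^sub>R frechet_derivative a (at (?g z t)) w))"
  proof
    fix w
    have "fx z integrable_on cbox 0 1"
      unfolding fx_def by (intro integrable_continuous continuous_intros continuous_on_compose2[OF cD]) (use gW z in auto)
    then have "blinfun_apply (integral (cbox 0 1) (fx z)) w = integral (cbox 0 1) (\<lambda>t. blinfun_apply (fx z t) w)"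
      by (rule blinfun_apply_integral)
    also have "\<dots> = integral {0..1} (\<lambda>t. t ^ Suc m *\<^sub>R frechet_derivative a (at (?g z t)) w)"
      unfolding interval_cbox
      by (rule integral_cong) (use gW[OF z] in \<open>simp add: fx_def Dapp blinfun.scaleR_left\<close>)
    finally show "blinfun_apply (integral (cbox 0 1) (fx z)) w = \<dots>" .
  qed
  ultimately show ?thesis unfolding at_within_open[OF z W(1)] box_real by metis
qed

lemma Ck_on_radial_integral:
  fixes a :: "'a::euclidean_space \<Rightarrow> 'b::euclidean_space"
  assumes W: "open W" "convex W" "z0 \<in> W"
  shows "Ck_on n W a \<Longrightarrow> Ck_on n W (\<lambda>z. integral {0..1} (\<lambda>t. t ^ m *\<^sub>R a (z0 + t *\<^sub>R (z - z0))))"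
proof (induction n arbitrary: a m)
  case 0
  have ca: "continuous_on W a" using 0 by simp
  have "continuous_on (W \<times> cbox 0 1) (\<lambda>(z, t). t ^ m *\<^sub>R a (z0 + t *\<^sub>R (z - z0)))"
    unfolding split_beta
    by (intro continuous_intros continuous_on_compose2[OF ca])
      (use radial_in_convex[OF W(2,3)] in auto)
  from integral_continuous_on_param[OF this] show ?case by simp
next
  case (Suc n)
  have "Ck_on (Suc 0) W a" using Suc.prems Ck_on_imp_continuous_on[OF Ck_on_SucD[OF Suc.prems]] by simp
  then show ?case
    by (intro Ck_on_SucI[OF W(1) radial_integral_has_derivative[OF W]] Suc.IH[OF Ck_on_SucD[OF Suc.prems]])
qed

section \<open>Linear systems in a convex domain\<close>

text \<open>The geometric series bounds the tail from \<open>n\<close> on by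
  \<open>2 * c / 2 ^ n\<close>. For iterates with \<open>c\<close> independent of the point this is
  uniform convergence with a rate.\<close>

lemma geometric_increments_converge:
  fixes x :: "nat \<Rightarrow> 'b::banach"
  assumes "\<And>n. norm (x (Suc n) - x n) \<le> c / 2 ^ n"
  shows "x \<longlonglongrightarrow> lim x" "norm (x n - lim x) \<le> 2 * c / 2 ^ n"
proof -
  have gs: "(\<lambda>k. c / 2 ^ n * (1/2) ^ k) sums (2 * c / 2 ^ n)" for n
  proof -
    have "(\<lambda>k. c / 2 ^ n * (1/2) ^ k) sums (c / 2 ^ n * (1 / (1 - 1/2)))"
      by (rule sums_mult[OF geometric_sums]) simp
    moreover have "c / 2 ^ n * (1 / (1 - 1/2)) = 2 * c / 2 ^ n" by simp
    ultimately show ?thesis by metis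
  qed
  have le: "norm (x (Suc (k + n)) - x (k + n)) \<le> c / 2 ^ n * (1/2) ^ k" for k n
    using assms[of "k + n"] by (simp add: power_add field_simps)
  have sm: "summable (\<lambda>k. norm (x (Suc (k + n)) - x (k + n)))" for n
    by (rule summable_comparison_test'[OF sums_summable[OF gs[of n]]]) (use le in auto)
  have tel: "(\<Sum>k<m. x (Suc (k + n)) - x (k + n)) = x (m + n) - x n" for m n
    by (induction m) auto
  have lim: "(\<lambda>m. x (m + n) - x n) \<longlonglongrightarrow> (\<Sum>k. x (Suc (k + n)) - x (k + n))" for n
    using summable_LIMSEQ[OF summable_norm_cancel[OF sm[of n]]] unfolding tel .
  have "(\<lambda>m. x m - x 0) \<longlonglongrightarrow> (\<Sum>k. x (Suc k) - x k)" using lim[of 0] by simp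
  from tendsto_add[OF this tendsto_const[of "x 0"]] have "convergent x" by (auto simp: convergent_def)
  then show l: "x \<longlonglongrightarrow> lim x" by (simp add: convergent_LIMSEQ_iff)
  have "(\<lambda>m. x (m + n) - x n) \<longlonglongrightarrow> lim x - x n"
    by (rule tendsto_diff[OF LIMSEQ_ignore_initial_segment[OF l] tendsto_const])
  then have "lim x - x n = (\<Sum>k. x (Suc (k + n)) - x (k + n))" using lim[of n] LIMSEQ_unique by blast
  also have "norm \<dots> \<le> (\<Sum>k. norm (x (Suc (k + n)) - x (k + n)))" by (rule summable_norm[OF sm])
  also have "\<dots> \<le> 2 * c / 2 ^ n"
    using suminf_le[OF le sm sums_summable[OF gs[of n]]] sums_unique[OF gs[of n]] by simp
  finally show "norm (x n - lim x) \<le> 2 * c / 2 ^ n" by (simp add: norm_minus_commute)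
qed

text \<open>The total differential equation \<open>d\<Phi> = bl \<omega> \<Phi>\<close>. The product
  \<open>bl\<close> stays abstract because the same existence proof serves right multiplication of
  quaternions and the primitive of a closed form.\<close>

locale linear_system =
  fixes bl :: "'w::real_normed_vector \<Rightarrow> 'v::euclidean_space \<Rightarrow> 'v"
    and W :: "'e::euclidean_space set" and \<omega> :: "'e \<Rightarrow> 'e \<Rightarrow> 'w"
  assumes bl: "bounded_bilinear bl"
    and W: "open W" "convex W"
    and lin: "\<And>z. linear (\<omega> z)"
    and smooth: "\<And>n w. Ck_on n W (\<lambda>z. \<omega> z w)"
begin

definition solution :: "('e \<Rightarrow> 'v) \<Rightarrow> bool" where
  "solution \<Phi> \<longleftrightarrow> (\<forall>z\<in>W. (\<Phi> has_derivative (\<lambda>w. bl (\<omega> z w) (\<Phi> z))) (at z))"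

text \<open>Integration of \<open>bl \<omega> \<Phi>\<close> along the segment from
  \<open>z0\<close>, resolved into basis directions and written with the trivial weight
  \<open>t ^ 0\<close>, so that the regularity of radial integrals applies to each summand.\<close>

definition picard :: "'e \<Rightarrow> 'v \<Rightarrow> ('e \<Rightarrow> 'v) \<Rightarrow> 'e \<Rightarrow> 'v" where
  "picard z0 a \<Phi> z = a + (\<Sum>i\<in>Basis. ((z - z0) \<bullet> i) *\<^sub>R
     integral {0..1} (\<lambda>t. t ^ 0 *\<^sub>R bl (\<omega> (z0 + t *\<^sub>R (z - z0)) i) (\<Phi> (z0 + t *\<^sub>R (z - z0)))))"

text \<open>Leaves finitely many coefficient functions in place of one for each direction; the
  scalars can then be pulled out of integrals and derivatives.\<close>

lemma bl_basis: "bl (\<omega> z w) x = (\<Sum>i\<in>Basis. (w \<bullet> i) *\<^sub>R bl (\<omega> z i) x)"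
proof -
  have "\<omega> z w = (\<Sum>i\<in>Basis. (w \<bullet> i) *\<^sub>R \<omega> z i)"
    by (subst euclidean_representation[symmetric, of w]) (simp add: linear_sum[OF lin] linear_cmul[OF lin])
  then show ?thesis
    by (simp add: bounded_bilinear.sum_left[OF bl] bounded_bilinear.scaleR_left[OF bl])
qed

lemma smooth_bl: "Ck_on n W \<Phi> \<Longrightarrow> Ck_on n W (\<lambda>z. bl (\<omega> z w) (\<Phi> z))"
  by (intro Ck_on_bilinear[OF W(1) bl] smooth)

context
  fixes z0 :: 'e and a :: 'v assumes z0: "z0 \<in> W"
begin

abbreviation "ray z t \<equiv> z0 + t *\<^sub>R (z - z0)"

lemma ray_in: "z \<in> W \<Longrightarrow> t \<in> {0..1} \<Longrightarrow> ray z t \<in> W"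
  using radial_in_convex[OF W(2) z0] by blast

lemma ray_integrable:
  "continuous_on W f \<Longrightarrow> z \<in> W \<Longrightarrow> (\<lambda>t. t ^ m *\<^sub>R (f (ray z t)::'v)) integrable_on {0..1}"
  by (intro integrable_continuous_interval continuous_intros continuous_on_compose2[where g=f and t=W and s="{0..1}"])
    (use ray_in in auto)

lemma picard_eq:
  assumes "continuous_on W \<Phi>" "z \<in> W"
  shows "picard z0 a \<Phi> z = a + integral {0..1} (\<lambda>t. bl (\<omega> (ray z t) (z - z0)) (\<Phi> (ray z t)))"
proof -
  have c: "continuous_on W (\<lambda>z. bl (\<omega> z i) (\<Phi> z))" for i
    using smooth_bl[of 0] assms(1) by simp
  show ?thesis
    unfolding picard_def bl_basis[of _ "z - z0"]
    using ray_integrable[OF c assms(2), of 0]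
    by (subst integral_sum) (auto intro: integrable_cmul)
qed

lemma Ck_on_picard:
  assumes "Ck_on n W \<Phi>"
  shows "Ck_on n W (picard z0 a \<Phi>)"
proof -
  have 1: "Ck_on n W (\<lambda>z. \<Sum>i\<in>I. ((z - z0) \<bullet> i) *\<^sub>R
     integral {0..1} (\<lambda>t. t ^ 0 *\<^sub>R bl (\<omega> (ray z t) i) (\<Phi> (ray z t))))" if "finite I" for I
    using that
  proof induction
    case empty
    then show ?case by (simp add: Ck_on_const W)
  next
    case (insert i I)
    have d: "Ck_on n W (\<lambda>z. (z - z0) \<bullet> i)"
    proof (cases n)
      case (Suc m)
      show ?thesis unfolding Suc
        by (rule Ck_on_SucI[OF W(1), where f'="\<lambda>z w. w \<bullet> i"])
          (auto intro!: derivative_eq_intros Ck_on_const W)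
    qed (auto intro!: continuous_intros)
    show ?case using insert
      by (simp add: Ck_on_add[OF W(1)] Ck_on_scaleR[OF W(1) d] Ck_on_radial_integral[OF W z0 smooth_bl[OF assms], of 0, simplified])
  qed
  show ?thesis unfolding picard_def[abs_def]
    by (intro Ck_on_add[OF W(1)] Ck_on_const[OF W(1)] 1) auto
qed

text \<open>The homotopy formula \<open>d h \<alpha> = \<alpha> - h d \<alpha>\<close> for the radial homotopy operator \<open>h\<close>, applied to
  \<open>\<alpha> = bl \<omega> \<Phi>\<close>.\<close>

lemma picard_has_derivative:
  fixes \<Phi> :: "'e \<Rightarrow> 'v"
  defines "c \<equiv> \<lambda>w z. bl (\<omega> z w) (\<Phi> z)"
  assumes \<Phi>: "\<And>n. Ck_on n W \<Phi>" and z: "z \<in> W"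
  shows "(picard z0 a \<Phi> has_derivative (\<lambda>w. c w z + integral {0..1} (\<lambda>t. t *\<^sub>R
     (frechet_derivative (c (z - z0)) (at (ray z t)) w - frechet_derivative (c w) (at (ray z t)) (z - z0))))) (at z)"
proof -
  have cs: "Ck_on n W (c w)" for n w unfolding c_def by (intro smooth_bl \<Phi>)
  let ?D = "\<lambda>w y. frechet_derivative (c w) (at y)"
  have D: "(c w has_derivative ?D w y) (at y)" if "y \<in> W" for w y
    by (rule Ck_on_Suc_has_derivative[OF W(1) cs[of "Suc 0"] that])
  have cD: "continuous_on W (\<lambda>y. ?D w y h)" for w h
    using cs[of "Suc 0" w] by simp
  have Dsum: "?D w y h = (\<Sum>i\<in>Basis. (w \<bullet> i) *\<^sub>R ?D i y h)" if "y \<in> W" for w y h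
  proof -
    have "((\<lambda>y. \<Sum>i\<in>Basis. (w \<bullet> i) *\<^sub>R c i y) has_derivative (\<lambda>h. \<Sum>i\<in>Basis. (w \<bullet> i) *\<^sub>R ?D i y h)) (at y)"
      by (intro has_derivative_sum has_derivative_scaleR_right D that)
    moreover have "(\<lambda>y. \<Sum>i\<in>Basis. (w \<bullet> i) *\<^sub>R c i y) = c w"
      unfolding c_def by (rule ext) (rule bl_basis[symmetric])
    ultimately show ?thesis using has_derivative_unique[OF D[OF that, of w]] by metis
  qed
  define J where "J i z = integral {0..1} (\<lambda>t. t ^ 0 *\<^sub>R c i (ray z t))" for i z
  have J: "(J i has_derivative (\<lambda>w. integral {0..1} (\<lambda>t. t ^ Suc 0 *\<^sub>R ?D i (ray z t) w))) (at z)" for i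
    unfolding J_def[abs_def] by (rule radial_integral_has_derivative[OF W z0 cs z])
  have pic: "picard z0 a \<Phi> = (\<lambda>z. a + (\<Sum>i\<in>Basis. ((z - z0) \<bullet> i) *\<^sub>R J i z))"
    by (auto simp: picard_def J_def c_def)
  have "(picard z0 a \<Phi> has_derivative (\<lambda>w. \<Sum>i\<in>Basis. ((z - z0) \<bullet> i) *\<^sub>R
      integral {0..1} (\<lambda>t. t ^ Suc 0 *\<^sub>R ?D i (ray z t) w) + (w \<bullet> i) *\<^sub>R J i z)) (at z)"
    unfolding pic by (rule derivative_eq_intros J | simp)+
  moreover have "(\<Sum>i\<in>Basis. ((z - z0) \<bullet> i) *\<^sub>R
      integral {0..1} (\<lambda>t. t ^ Suc 0 *\<^sub>R ?D i (ray z t) w) + (w \<bullet> i) *\<^sub>R J i z) =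
      c w z + integral {0..1} (\<lambda>t. t *\<^sub>R (?D (z - z0) (ray z t) w - ?D w (ray z t) (z - z0)))" (is "?L = _") for w
  proof -
    have i1: "(\<lambda>t. t *\<^sub>R ?D v (ray z t) h) integrable_on {0..1}" for v h
      using ray_integrable[OF cD z, of 1] by simp
    have i0: "(\<lambda>t. c v (ray z t)) integrable_on {0..1}" for v
      using ray_integrable[OF _ z, of "c v" 0] cs[of 0] by simp
    \<comment> \<open>The product rule has produced one sum weighted by \<open>z - z0\<close> and
      one weighted by \<open>w\<close>; by linearity of \<open>\<omega>\<close> they are single
      integrals in the directions \<open>z - z0\<close> and \<open>w\<close>.\<close>
    have L: "?L = integral {0..1} (\<lambda>t. t *\<^sub>R ?D (z - z0) (ray z t) w) + integral {0..1} (\<lambda>t. c w (ray z t))"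
    proof -
      have "integral {0..1} (\<lambda>t. t *\<^sub>R ?D (z - z0) (ray z t) w) =
          integral {0..1} (\<lambda>t. \<Sum>i\<in>Basis. ((z - z0) \<bullet> i) *\<^sub>R t *\<^sub>R ?D i (ray z t) w)"
        by (rule integral_cong) (use Dsum[OF ray_in[OF z], of _ "z - z0"] in
            \<open>simp add: scaleR_sum_right mult.commute\<close>)
      also have "\<dots> = (\<Sum>i\<in>Basis. ((z - z0) \<bullet> i) *\<^sub>R integral {0..1} (\<lambda>t. t *\<^sub>R ?D i (ray z t) w))"
        by (subst integral_sum) (auto intro: integrable_cmul i1 simp del: scaleR_scaleR)
      finally have 1: "integral {0..1} (\<lambda>t. t *\<^sub>R ?D (z - z0) (ray z t) w) = \<dots>" .
      have "integral {0..1} (\<lambda>t. c w (ray z t)) = integral {0..1} (\<lambda>t. \<Sum>i\<in>Basis. (w \<bullet> i) *\<^sub>R c i (ray z t))"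
        unfolding c_def by (rule integral_cong) (rule bl_basis)
      also have "\<dots> = (\<Sum>i\<in>Basis. (w \<bullet> i) *\<^sub>R J i z)"
        by (subst integral_sum) (auto intro: integrable_cmul i0 simp: J_def)
      finally show ?thesis using 1 by (simp add: sum.distrib)
    qed
    \<comment> \<open>The integrand is the derivative of \<open>t *\<^sub>R c w (ray z t)\<close>.
      This integration by parts turns the unweighted integral in \<open>L\<close> into the boundary
      value \<open>c w z\<close> minus a weighted integral.\<close>
    have "((\<lambda>t. c w (ray z t) + t *\<^sub>R ?D w (ray z t) (z - z0)) has_integral
        (1::real) *\<^sub>R c w (ray z 1) - (0::real) *\<^sub>R c w (ray z 0)) {0..1}"
    proof (rule fundamental_theorem_of_calculus)
      fix t :: real assume t: "t \<in> {0..1}"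
      have "((\<lambda>t. c w (ray z t)) has_derivative (\<lambda>h. ?D w (ray z t) (h *\<^sub>R (z - z0)))) (at t within {0..1})"
        by (rule has_derivative_compose[where f="\<lambda>t. ray z t" and f'="\<lambda>h. h *\<^sub>R (z - z0)" and g="c w" and x=t,
              OF _ D[OF ray_in[OF z t]]])
          (auto intro!: derivative_eq_intros)
      then have "((\<lambda>t. c w (ray z t)) has_vector_derivative ?D w (ray z t) (z - z0)) (at t within {0..1})"
        using linear_cmul[OF has_derivative_linear[OF D[OF ray_in[OF z t]]]]
        by (simp add: has_vector_derivative_def)
      from has_vector_derivative_scaleR[OF DERIV_ident this]
      show "((\<lambda>t. t *\<^sub>R c w (ray z t)) has_vector_derivative
          c w (ray z t) + t *\<^sub>R ?D w (ray z t) (z - z0)) (at t within {0..1})"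
        by (simp add: add.commute)
    qed auto
    then have "c w z = integral {0..1} (\<lambda>t. c w (ray z t) + t *\<^sub>R ?D w (ray z t) (z - z0))"
      by (simp add: integral_unique)
    also have "\<dots> = integral {0..1} (\<lambda>t. c w (ray z t)) + integral {0..1} (\<lambda>t. t *\<^sub>R ?D w (ray z t) (z - z0))"
      by (intro integral_add i0 i1)
    finally have c: "c w z = \<dots>" .
    have I: "integral {0..1} (\<lambda>t. t *\<^sub>R (?D (z - z0) (ray z t) w - ?D w (ray z t) (z - z0))) =
        integral {0..1} (\<lambda>t. t *\<^sub>R ?D (z - z0) (ray z t) w) - integral {0..1} (\<lambda>t. t *\<^sub>R ?D w (ray z t) (z - z0))"
      unfolding scaleR_diff_right[where 'a='v] by (rule integral_diff[OF i1 i1])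
    have "x + y = (y + b) + (x - b)" for x y b :: 'v by simp
    then show ?thesis unfolding L I c .
  qed
  ultimately show ?thesis by (simp only:)
qed

end

text \<open>Picard iteration converges in \<open>C\<^sup>1\<close>: by the homotopy formula and flatness, the defect
  \<open>d\<Phi> - bl \<omega> \<Phi>\<close> of the iterates is contracted as well.\<close>

lemma flat_solution_exists:
  assumes flat: "\<And>z w v x. z \<in> W \<Longrightarrow>
      bl (frechet_derivative (\<lambda>z. \<omega> z w) (at z) v) x + bl (\<omega> z w) (bl (\<omega> z v) x) =
      bl (frechet_derivative (\<lambda>z. \<omega> z v) (at z) w) x + bl (\<omega> z v) (bl (\<omega> z w) x)"
    and M: "\<And>z w x. z \<in> W \<Longrightarrow> norm (bl (\<omega> z w) x) \<le> M * norm w * norm x" "0 \<le> M"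
    and \<delta>: "\<And>z. z \<in> W \<Longrightarrow> norm (z - z0) \<le> \<delta>" "M * \<delta> \<le> 1/8"
    and z0: "z0 \<in> W"
  shows "\<exists>\<Phi>. solution \<Phi> \<and> \<Phi> z0 = a"
proof -
  let ?ray = "\<lambda>z t. z0 + t *\<^sub>R (z - z0)"
  define f where "f n = (picard z0 a ^^ n) (\<lambda>_. a)" for n
  have fS: "f (Suc n) = picard z0 a (f n)" and f0: "f 0 = (\<lambda>_. a)" for n by (auto simp: f_def)
  have sf: "Ck_on k W (f n)" for k n
    by (induction n) (auto simp: f0 fS Ck_on_const W(1) intro: Ck_on_picard[OF z0])
  have cf: "continuous_on W (f n)" for n using sf[of 0] by simp
  have fz0: "f n z0 = a" for n by (cases n) (auto simp: f0 fS picard_def)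
  \<comment> \<open>A factor \<open>1/2\<close> would do for the increments of the iterates. The
    smaller \<open>1/8\<close> is for the defect, where flatness leaves two such terms, together at
    most a quarter of the previous bound.\<close>
  have Mv: "M * norm (z - z0) \<le> 1/8" if "z \<in> W" for z
    using mult_left_mono[OF \<delta>(1)[OF that] M(2)] \<delta>(2) by linarith
  have rayW: "?ray z t \<in> W" if "z \<in> W" "t \<in> {0..1}" for z t using ray_in[OF z0 that] .
  have cbl: "continuous_on W g \<Longrightarrow> continuous_on W (\<lambda>y. bl (\<omega> y w) (g y))" for g w
    using smooth_bl[of 0 g w] by simp
  have int_le: "norm (integral {0..1} g) \<le> B" if "continuous_on {0..1} g" "\<And>t. t \<in> {0..1} \<Longrightarrow> norm (g t) \<le> B"
    for g :: "real \<Rightarrow> 'v" and B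
    using integral_bound[of 0 1 g B] that by simp
  have cray: "continuous_on {0..1} (\<lambda>t. g (?ray z t))" if "continuous_on W g" "z \<in> W" for g :: "'e \<Rightarrow> 'v" and z
    by (intro continuous_on_compose2[OF that(1)] continuous_intros) (use rayW[OF that(2)] in auto)
  have incr: "norm (f (Suc n) z - f n z) \<le> norm a / 2 ^ n" if "z \<in> W" for n z
    using that
  proof (induction n arbitrary: z)
    case 0
    have "f (Suc 0) z - f 0 z = integral {0..1} (\<lambda>t. bl (\<omega> (?ray z t) (z - z0)) a)"
      using picard_eq[OF z0 cf[of 0] 0, of a] by (simp add: fS f0)
    also have "norm \<dots> \<le> norm a"
    proof (rule int_le)
      show "continuous_on {0..1} (\<lambda>t. bl (\<omega> (?ray z t) (z - z0)) a)"
        by (rule cray[OF cbl 0]) auto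
      fix t :: real assume "t \<in> {0..1}"
      then have "norm (bl (\<omega> (?ray z t) (z - z0)) a) \<le> M * norm (z - z0) * norm a"
        using M(1) rayW 0 by blast
      also have "\<dots> \<le> 1/8 * norm a" by (intro mult_right_mono Mv 0) auto
      finally show "norm (bl (\<omega> (?ray z t) (z - z0)) a) \<le> norm a"
        using norm_ge_zero[of a] by linarith
    qed
    finally show ?case by simp
  next
    case (Suc n)
    let ?v = "z - z0"
    have "f (Suc (Suc n)) z - f (Suc n) z = integral {0..1} (\<lambda>t. bl (\<omega> (?ray z t) ?v) (f (Suc n) (?ray z t)))
        - integral {0..1} (\<lambda>t. bl (\<omega> (?ray z t) ?v) (f n (?ray z t)))"
      using picard_eq[OF z0 cf Suc.prems, of a n] picard_eq[OF z0 cf Suc.prems, of a "Suc n"] by (simp add: fS)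
    also have "\<dots> = integral {0..1} (\<lambda>t. bl (\<omega> (?ray z t) ?v) (f (Suc n) (?ray z t)) - bl (\<omega> (?ray z t) ?v) (f n (?ray z t)))"
      by (intro integral_diff[symmetric] integrable_continuous_interval cray[OF cbl[OF cf] Suc.prems])
    also have "norm \<dots> \<le> norm a / 2 ^ Suc n"
    proof (rule int_le)
      show "continuous_on {0..1} (\<lambda>t. bl (\<omega> (?ray z t) ?v) (f (Suc n) (?ray z t)) - bl (\<omega> (?ray z t) ?v) (f n (?ray z t)))"
        by (intro continuous_on_diff cray[OF cbl[OF cf] Suc.prems])
      fix t :: real assume t: "t \<in> {0..1}"
      note r = rayW[OF Suc.prems t]
      have "norm (bl (\<omega> (?ray z t) ?v) (f (Suc n) (?ray z t)) - bl (\<omega> (?ray z t) ?v) (f n (?ray z t)))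
        = norm (bl (\<omega> (?ray z t) ?v) (f (Suc n) (?ray z t) - f n (?ray z t)))"
        by (simp add: bounded_bilinear.diff_right[OF bl])
      also have "\<dots> \<le> M * norm ?v * norm (f (Suc n) (?ray z t) - f n (?ray z t))" by (rule M(1)[OF r])
      also have "\<dots> \<le> 1/8 * (norm a / 2 ^ n)"
        by (intro mult_mono Mv Suc.IH Suc.prems r) (auto)
      also have "\<dots> \<le> norm a / 2 ^ Suc n" by (simp add: field_simps)
      finally show "norm (bl (\<omega> (?ray z t) ?v) (f (Suc n) (?ray z t)) - bl (\<omega> (?ray z t) ?v) (f n (?ray z t))) \<le> norm a / 2 ^ Suc n" .
    qed
    finally show ?case .
  qed
  define F where "F z = lim (\<lambda>n. f n z)" for z
  have Flim: "(\<lambda>n. f n z) \<longlonglongrightarrow> F z" and Fle: "norm (f n z - F z) \<le> 2 * norm a / 2 ^ n" if "z \<in> W" for z n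
    using geometric_increments_converge[of "\<lambda>n. f n z"] incr[OF that] by (auto simp: F_def)
  define f' where "f' n z = frechet_derivative (f n) (at z)" for n z
  have f': "(f n has_derivative f' n z) (at z)" if "z \<in> W" for n z
    unfolding f'_def by (rule Ck_on_Suc_has_derivative[OF W(1) sf[of "Suc 0"] that])
  \<comment> \<open>\<open>C / 4 = M * norm a\<close> makes the recursion exact: the increment of
    the iterates and the old defect each contribute \<open>C / 4\<close> times
    \<open>norm w / 2 ^ n\<close>, and the sum is the bound for \<open>Suc n\<close>.\<close>
  define C where "C = 4 * M * norm a"
  have C0: "0 \<le> C" using M(2) by (simp add: C_def)
  have defect: "norm (f' n z w - bl (\<omega> z w) (f n z)) \<le> C / 2 ^ n * norm w" if "z \<in> W" for n z w
    using that
  proof (induction n arbitrary: z w)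
    case 0
    have "f' 0 z w = 0" by (simp add: f'_def f0)
    then have "norm (f' 0 z w - bl (\<omega> z w) (f 0 z)) \<le> M * norm w * norm a" using M(1)[OF 0] by (simp add: f0)
    also have "\<dots> \<le> C / 2 ^ 0 * norm w"
      using M(2) by (simp add: C_def mult.assoc mult_left_mono mult.commute[of "norm a"])
    finally show ?case .
  next
    case (Suc n)
    let ?c = "\<lambda>w z. bl (\<omega> z w) (f n z)" and ?v = "z - z0"
    define E where "E y w = f' n y w - bl (\<omega> y w) (f n y)" for y w
    have Ele: "norm (E y w) \<le> C / 2 ^ n * norm w" if "y \<in> W" for y w
      using Suc.IH[OF that] by (simp add: E_def)
    have Dc: "frechet_derivative (?c w) (at y) h = bl (\<omega> y w) (f' n y h) + bl (frechet_derivative (\<lambda>z. \<omega> z w) (at y) h) (f n y)"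
      if "y \<in> W" for y w h
      using frechet_derivative_at[OF bounded_bilinear.FDERIV[OF bl Ck_on_Suc_has_derivative[OF W(1) smooth[of "Suc 0" w] that] f'[OF that]], of n]
      by metis
    \<comment> \<open>The exterior derivative of the form \<open>bl \<omega> (f n)\<close>. After
      substituting \<open>bl \<omega> (f n) + E\<close> for the derivative of \<open>f n\<close>,
      all terms free of the defect \<open>E\<close> cancel by flatness.\<close>
    have key: "frechet_derivative (?c v) (at y) w - frechet_derivative (?c w) (at y) v = bl (\<omega> y v) (E y w) - bl (\<omega> y w) (E y v)"
      if "y \<in> W" for y v w
      using flat[OF that, of v w "f n y"]
      by (simp add: Dc[OF that] E_def bounded_bilinear.diff_right[OF bl] algebra_simps)
    have "f' (Suc n) z = (\<lambda>w. ?c w z + integral {0..1} (\<lambda>t. t *\<^sub>R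
       (frechet_derivative (?c ?v) (at (?ray z t)) w - frechet_derivative (?c w) (at (?ray z t)) ?v)))"
      unfolding f'_def fS by (rule frechet_derivative_at[OF picard_has_derivative[OF z0 sf Suc.prems], symmetric])
    then have "f' (Suc n) z w - bl (\<omega> z w) (f (Suc n) z) = bl (\<omega> z w) (f n z - f (Suc n) z) +
      integral {0..1} (\<lambda>t. t *\<^sub>R
       (frechet_derivative (?c ?v) (at (?ray z t)) w - frechet_derivative (?c w) (at (?ray z t)) ?v))" (is "_ = _ + integral _ ?I")
      by (simp add: bounded_bilinear.diff_right[OF bl])
    also have "norm \<dots> \<le> M * norm w * (norm a / 2 ^ n) + C / 2 ^ n * norm w / 4"
    proof (rule norm_triangle_mono)
      have "norm (bl (\<omega> z w) (f n z - f (Suc n) z)) \<le> M * norm w * norm (f n z - f (Suc n) z)"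
        by (rule M(1)[OF Suc.prems])
      also have "\<dots> \<le> M * norm w * (norm a / 2 ^ n)"
        using incr[OF Suc.prems, of n] M(2) by (intro mult_left_mono) (auto simp: norm_minus_commute)
      finally show "norm (bl (\<omega> z w) (f n z - f (Suc n) z)) \<le> M * norm w * (norm a / 2 ^ n)" .
      show "norm (integral {0..1} ?I) \<le> C / 2 ^ n * norm w / 4"
      proof (rule int_le)
        have "continuous_on W (\<lambda>y. frechet_derivative (?c v) (at y) h)" for v h
          using smooth_bl[OF sf[of "Suc 0" n], of v] by simp
        from cray[OF this Suc.prems] show "continuous_on {0..1} ?I"
          by (intro continuous_intros)
        fix t :: real assume t: "t \<in> {0..1}"
        note r = rayW[OF Suc.prems t]
        have "norm (?I t) = \<bar>t\<bar> * norm (bl (\<omega> (?ray z t) ?v) (E (?ray z t) w) - bl (\<omega> (?ray z t) w) (E (?ray z t) ?v))"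
          by (simp add: key[OF r])
        also have "\<dots> \<le> 1 * norm (bl (\<omega> (?ray z t) ?v) (E (?ray z t) w) - bl (\<omega> (?ray z t) w) (E (?ray z t) ?v))"
          using t by (intro mult_right_mono) auto
        also have "\<dots> \<le> norm (bl (\<omega> (?ray z t) ?v) (E (?ray z t) w)) + norm (bl (\<omega> (?ray z t) w) (E (?ray z t) ?v))"
          by (simp add: norm_triangle_ineq4)
        also have "\<dots> \<le> M * norm ?v * (C / 2 ^ n * norm w) + M * norm w * (C / 2 ^ n * norm ?v)"
          by (intro add_mono order_trans[OF M(1)[OF r]] mult_left_mono Ele[OF r]) (use M(2) in auto)
        also have "\<dots> = (M * norm ?v) * (2 * (C / 2 ^ n * norm w))" by (simp add: algebra_simps)
        also have "\<dots> \<le> 1/8 * (2 * (C / 2 ^ n * norm w))" using C0 by (intro mult_right_mono Mv Suc.prems) auto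
        finally show "norm (?I t) \<le> C / 2 ^ n * norm w / 4" by simp
      qed
    qed
    also have "\<dots> = C / 2 ^ Suc n * norm w" by (simp add: C_def field_simps)
    finally show ?case .
  qed
  \<comment> \<open>The derivatives of the iterates converge uniformly to
    \<open>bl \<omega> F\<close>, so limit and derivative may be exchanged. Convergence of the
    values need only be supplied at \<open>z0\<close>, where all iterates equal
    \<open>a\<close>.\<close>
  have "\<exists>g. \<forall>z\<in>W. (\<lambda>n. f n z) \<longlonglongrightarrow> g z \<and> (g has_derivative (\<lambda>w. bl (\<omega> z w) (F z))) (at z within W)"
  proof (rule has_derivative_sequence[OF W(2) _ _ z0, where f'=f'])
    show "(f n has_derivative f' n z) (at z within W)" if "z \<in> W" for n z
      using f'[OF that] has_derivative_at_withinI by blast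
    show "(\<lambda>n. f n z0) \<longlonglongrightarrow> a" by (simp add: fz0)
    fix e :: real assume "e > 0"
    have "(\<lambda>n. (C + 2 * M * norm a) * (1/2) ^ n) \<longlonglongrightarrow> (C + 2 * M * norm a) * 0"
      by (intro tendsto_intros) auto
    then have "\<forall>\<^sub>F n in sequentially. (C + 2 * M * norm a) * (1/2) ^ n < e"
      using \<open>e > 0\<close> by (simp add: order_tendsto_iff)
    then show "\<forall>\<^sub>F n in sequentially. \<forall>z\<in>W. \<forall>w. norm (f' n z w - bl (\<omega> z w) (F z)) \<le> e * norm w"
    proof eventually_elim
      case (elim n)
      show ?case
      proof (intro ballI allI)
        fix z w assume z: "z \<in> W"
        have "norm (f' n z w - bl (\<omega> z w) (F z)) =
            norm ((f' n z w - bl (\<omega> z w) (f n z)) + bl (\<omega> z w) (f n z - F z))"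
          by (simp add: bounded_bilinear.diff_right[OF bl])
        also have "\<dots> \<le> C / 2 ^ n * norm w + M * norm w * (2 * norm a / 2 ^ n)"
          by (intro norm_triangle_mono defect z order_trans[OF M(1)[OF z]] mult_left_mono Fle) (use M(2) in auto)
        also have "\<dots> = (C + 2 * M * norm a) * (1/2) ^ n * norm w" by (simp add: field_simps power_one_over)
        also have "\<dots> \<le> e * norm w" using elim by (intro mult_right_mono) auto
        finally show "norm (f' n z w - bl (\<omega> z w) (F z)) \<le> e * norm w" .
      qed
    qed
  qed
  then obtain g where g: "\<And>z. z \<in> W \<Longrightarrow> (\<lambda>n. f n z) \<longlonglongrightarrow> g z"
    "\<And>z. z \<in> W \<Longrightarrow> (g has_derivative (\<lambda>w. bl (\<omega> z w) (F z))) (at z within W)" by blast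
  have gF: "g z = F z" if "z \<in> W" for z using LIMSEQ_unique[OF g(1) Flim] that by blast
  have "solution g"
    unfolding solution_def
  proof
    fix z assume z: "z \<in> W"
    show "(g has_derivative (\<lambda>w. bl (\<omega> z w) (g z))) (at z)"
      using g(2)[OF z] unfolding at_within_open[OF z W(1)] gF[OF z] .
  qed
  moreover have "g z0 = a" using LIMSEQ_unique[OF g(1)[OF z0], of a] by (simp add: fz0)
  ultimately show ?thesis by blast
qed

text \<open>The difference \<open>H\<close> of two solutions solves the same linear equation and
  vanishes at \<open>z0\<close>. On a ball of radius \<open>\<rho>\<close> with
  \<open>\<bar>M\<bar> * \<rho> \<le> 1/2\<close> the mean value inequality, used at a point where
  \<open>norm (H y)\<close> is maximal, bounds this maximum by half of itself.\<close>

lemma solutions_agree_near: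
  assumes M: "\<And>z w x. z \<in> W \<Longrightarrow> norm (bl (\<omega> z w) x) \<le> M * norm w * norm x"
    and sol: "\<And>z. z \<in> B \<Longrightarrow> (F has_derivative (\<lambda>w. bl (\<omega> z w) (F z))) (at z)"
      "\<And>z. z \<in> B \<Longrightarrow> (G has_derivative (\<lambda>w. bl (\<omega> z w) (G z))) (at z)"
    and B: "open B" "B \<subseteq> W" "z0 \<in> B" and eq: "F z0 = G z0"
  shows "\<exists>e>0. ball z0 e \<subseteq> B \<and> (\<forall>z\<in>ball z0 e. F z = G z)"
proof -
  obtain r where r: "r > 0" "cball z0 r \<subseteq> B" using B open_contains_cball by blast
  define \<rho> where "\<rho> = min r (1 / (2 * (\<bar>M\<bar> + 1)))"
  have \<rho>: "\<rho> > 0" "cball z0 \<rho> \<subseteq> B" using r by (auto simp: \<rho>_def)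
  have "\<bar>M\<bar> * \<rho> \<le> (\<bar>M\<bar> + 1) * (1 / (2 * (\<bar>M\<bar> + 1)))"
    by (intro mult_mono) (use r in \<open>auto simp: \<rho>_def\<close>)
  also have "\<dots> = 1/2" by simp
  finally have M\<rho>: "\<bar>M\<bar> * \<rho> \<le> 1/2" .
  define H where "H z = F z - G z" for z
  have H: "(H has_derivative (\<lambda>w. bl (\<omega> z w) (H z))) (at z within S)" if "z \<in> B" for z S
    using has_derivative_diff[OF sol(1)[OF that] sol(2)[OF that]]
    by (auto simp: H_def[abs_def] bounded_bilinear.diff_right[OF bl] intro: has_derivative_at_withinI)
  have "continuous_on (cball z0 \<rho>) H"
    using H \<rho>(2) by (meson has_derivative_continuous continuous_on_eq_continuous_within subsetD)
  then have "continuous_on (cball z0 \<rho>) (\<lambda>z. norm (H z))" by (intro continuous_intros)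
  then obtain y where y: "y \<in> cball z0 \<rho>" "\<And>z. z \<in> cball z0 \<rho> \<Longrightarrow> norm (H z) \<le> norm (H y)"
    using continuous_attains_sup[of "cball z0 \<rho>" "\<lambda>z. norm (H z)"] \<rho>(1) by (auto simp: cball_eq_empty)
  have "norm (H y - H z0) \<le> (\<bar>M\<bar> * norm (H y)) * norm (y - z0)"
  proof (rule differentiable_bound[OF convex_cball H])
    fix z assume z: "z \<in> cball z0 \<rho>"
    show "onorm (\<lambda>w. bl (\<omega> z w) (H z)) \<le> \<bar>M\<bar> * norm (H y)"
    proof (rule onorm_le)
      fix w
      have "norm (bl (\<omega> z w) (H z)) \<le> M * norm w * norm (H z)" using M z \<rho>(2) B(2) by blast
      also have "\<dots> \<le> \<bar>M\<bar> * norm w * norm (H y)" by (intro mult_mono y(2) z) auto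
      finally show "norm (bl (\<omega> z w) (H z)) \<le> \<bar>M\<bar> * norm (H y) * norm w" by (simp add: algebra_simps)
    qed
  qed (use y \<rho> in auto)
  also have "\<dots> \<le> (\<bar>M\<bar> * norm (H y)) * \<rho>"
    using y(1) by (intro mult_left_mono) (auto simp: dist_norm norm_minus_commute)
  also have "\<dots> \<le> 1/2 * norm (H y)" using mult_right_mono[OF M\<rho>, of "norm (H y)"] by (simp add: algebra_simps)
  finally have "norm (H y) \<le> 1/2 * norm (H y)" using eq by (simp add: H_def)
  then have "norm (H y) \<le> 0" by simp
  then have "H z = 0" if "z \<in> cball z0 \<rho>" for z using y(2)[OF that] by simp
  then have "\<forall>z\<in>ball z0 \<rho>. F z = G z" by (auto simp: H_def)
  then show ?thesis using \<rho> ball_subset_cball[of z0 \<rho>] by blast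
qed

end

section \<open>Continuation on simply connected sets\<close>

text \<open>\<open>simply_connected\<close> compares any two loops up to free homotopy. For two
  constant loops, the track of the base point under such a homotopy is a path between the two
  points.\<close>

lemma simply_connected_path_connected:
  fixes S :: "'a::topological_space set"
  assumes "simply_connected S"
  shows "path_connected S"
  unfolding path_connected_def
proof (intro ballI)
  let ?I = "{0..1::real}"
  fix p q assume pq: "p \<in> S" "q \<in> S"
  have "homotopic_loops S (\<lambda>_. p) (\<lambda>_. q)"
    using assms[unfolded simply_connected_def, rule_format, of "\<lambda>_. p" "\<lambda>_. q"] pq
    by (auto simp: path_def path_image_def pathstart_def pathfinish_def)
  then obtain H where "continuous_on (?I \<times> ?I) H" "H \<in> (?I \<times> ?I) \<rightarrow> S"
    "\<forall>x\<in>?I. H (0, x) = p" "\<forall>x\<in>?I. H (1, x) = q"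
    unfolding homotopic_loops by blast
  then have H: "continuous_on (?I \<times> ?I) H" "H ` (?I \<times> ?I) \<subseteq> S" "H (0, 0) = p" "H (1, 0) = q"
    by auto
  have "path (\<lambda>t. H (t, 0))" "path_image (\<lambda>t. H (t, 0)) \<subseteq> S"
    "pathstart (\<lambda>t. H (t, 0)) = p" "pathfinish (\<lambda>t. H (t, 0)) = q"
    using H(2-) by (auto simp: path_def path_image_def pathstart_def pathfinish_def
        intro!: continuous_on_compose2[OF H(1)] continuous_intros)
  then show "\<exists>g. path g \<and> path_image g \<subseteq> S \<and> pathstart g = p \<and> pathfinish g = q" by blast
qed

text \<open>Only these topological facts about a differential equation enter the continuation: the
  germs of solutions cover the set, with exactly one sheet through each point and value, and a
  single neighbourhood \<open>U\<close> serves all its points \<open>q\<close> and all values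
  \<open>a\<close>, so that it is evenly covered.\<close>

locale local_solutions =
  fixes S :: "'a::topological_space set" and sol :: "'a set \<Rightarrow> ('a \<Rightarrow> 'b::real_normed_vector) \<Rightarrow> bool"
  assumes local_existence: "\<And>p. p \<in> S \<Longrightarrow> \<exists>U. openin (top_of_set S) U \<and> p \<in> U \<and> path_connected U \<and>
      (\<forall>q\<in>U. \<forall>a. \<exists>F. sol U F \<and> F q = a)"
    and local_uniqueness: "\<And>U V F G q. \<lbrakk>openin (top_of_set S) U; openin (top_of_set S) V; sol U F; sol V G;
      q \<in> U; q \<in> V; F q = G q\<rbrakk> \<Longrightarrow>
      \<exists>W. openin (top_of_set S) W \<and> q \<in> W \<and> W \<subseteq> U \<inter> V \<and> (\<forall>x\<in>W. F x = G x)"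
    and sol_continuous: "\<And>U F. openin (top_of_set S) U \<Longrightarrow> sol U F \<Longrightarrow> continuous_on U F"
begin

text \<open>A lift of \<open>h\<close> to the covering by germs, recorded by its values alone since
  a value determines the germ. The domain \<open>X\<close> is arbitrary so that paths, edges and
  squares are treated alike.\<close>

definition continuation :: "('x::topological_space \<Rightarrow> 'a) \<Rightarrow> 'x set \<Rightarrow> ('x \<Rightarrow> 'b) \<Rightarrow> bool" where
  "continuation h X c \<longleftrightarrow> (\<forall>x\<in>X. \<exists>U F V. openin (top_of_set S) U \<and> sol U F \<and>
     openin (top_of_set X) V \<and> x \<in> V \<and> (\<forall>y\<in>V. h y \<in> U \<and> c y = F (h y)))"

lemma continuation_compose:
  assumes "continuation h X c" "continuous_on Y \<phi>" "\<phi> ` Y \<subseteq> X"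
  shows "continuation (\<lambda>y. h (\<phi> y)) Y (\<lambda>y. c (\<phi> y))"
  unfolding continuation_def
proof
  fix y assume y: "y \<in> Y"
  then have "\<phi> y \<in> X" using assms(3) by blast
  then obtain U F V where *: "openin (top_of_set S) U" "sol U F" "openin (top_of_set X) V" "\<phi> y \<in> V"
    "\<forall>y\<in>V. h y \<in> U \<and> c y = F (h y)"
    using assms(1) unfolding continuation_def by meson
  have "openin (top_of_set Y) (Y \<inter> \<phi> -` V)"
    by (rule continuous_openin_preimage[OF assms(2) _ *(3)]) (use assms(3) in auto)
  then show "\<exists>U F V. openin (top_of_set S) U \<and> sol U F \<and>
     openin (top_of_set Y) V \<and> y \<in> V \<and> (\<forall>y\<in>V. h (\<phi> y) \<in> U \<and> c (\<phi> y) = F (h (\<phi> y)))"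
    using * y by (intro exI[of _ U] exI[of _ F] exI[of _ "Y \<inter> \<phi> -` V"]) auto
qed

lemma continuation_cong:
  assumes "\<And>x. x \<in> X \<Longrightarrow> h x = h' x" "\<And>x. x \<in> X \<Longrightarrow> c x = c' x"
  shows "continuation h X c \<longleftrightarrow> continuation h' X c'"
proof -
  have "continuation h' X c'" if H: "\<And>x. x \<in> X \<Longrightarrow> h x = h' x" "\<And>x. x \<in> X \<Longrightarrow> c x = c' x" "continuation h X c" for h c h' c'
    unfolding continuation_def
  proof
    fix x assume "x \<in> X"
    then obtain U F V where *: "openin (top_of_set S) U" "sol U F" "openin (top_of_set X) V" "x \<in> V"
      "\<forall>y\<in>V. h y \<in> U \<and> c y = F (h y)"
      using H(3) unfolding continuation_def by meson
    then show "\<exists>U F V. openin (top_of_set S) U \<and> sol U F \<and> openin (top_of_set X) V \<and> x \<in> V \<and>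
        (\<forall>y\<in>V. h' y \<in> U \<and> c' y = F (h' y))"
      using openin_imp_subset[OF *(3)] H(1,2)
      by (intro exI[of _ U] exI[of _ F] exI[of _ V]) (metis subsetD)
  qed
  from this[of h h' c c'] this[of h' h c' c] show ?thesis using assms by auto
qed

lemma continuation_solution:
  assumes "openin (top_of_set S) U" "sol U F" "h ` X \<subseteq> U"
  shows "continuation h X (\<lambda>x. F (h x))"
  unfolding continuation_def
  by (intro ballI exI[of _ U] exI[of _ F] exI[of _ X]) (use assms in auto)

lemma continuation_continuous:
  assumes "continuation h X c" "continuous_on X h"
  shows "continuous_on X c"
  unfolding continuous_on_def
proof
  fix x assume "x \<in> X"
  then obtain U F V where *: "openin (top_of_set S) U" "sol U F" "openin (top_of_set X) V" "x \<in> V"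
    and "\<forall>y\<in>V. h y \<in> U \<and> c y = F (h y)"
    using assms(1) unfolding continuation_def by meson
  then have V: "\<And>y. y \<in> V \<Longrightarrow> h y \<in> U" "\<And>y. y \<in> V \<Longrightarrow> c y = F (h y)" by auto
  from *(3) obtain T where T: "open T" "V = X \<inter> T" by (auto simp: openin_open)
  have "continuous_on V (\<lambda>y. F (h y))"
    by (rule continuous_on_compose2[OF sol_continuous[OF *(1,2)]])
      (use V(1) continuous_on_subset[OF assms(2), of V] T in auto)
  then have "continuous_on V c" using V(2) by (simp cong: continuous_on_cong)
  then have "(c \<longlongrightarrow> c x) (at x within V)" using *(4) by (simp add: continuous_on_def)
  moreover have "at x within V = at x within X"
    by (rule at_within_nhd[where S=T]) (use T *(4) in auto)
  ultimately show "(c \<longlongrightarrow> c x) (at x within X)" by simp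
qed

text \<open>Unique lifting: the set of agreement is closed because continuations are continuous, and
  open because solutions with a common value agree nearby.\<close>

lemma continuation_unique:
  assumes "continuation h X c" "continuation h X c'" "continuous_on X h" "h ` X \<subseteq> S"
    and X: "connected X" and x: "x \<in> X" "c x = c' x" and y: "y \<in> X"
  shows "c y = c' y"
proof -
  let ?E = "{x \<in> X. c x = c' x}"
  have "continuous_on X (\<lambda>x. c x - c' x)"
    by (intro continuous_on_diff continuation_continuous[OF assms(1,3)] continuation_continuous[OF assms(2,3)])
  then have "closedin (top_of_set X) (X \<inter> (\<lambda>x. c x - c' x) -` {0})"
    by (rule continuous_closedin_preimage) auto
  also have "X \<inter> (\<lambda>x. c x - c' x) -` {0} = ?E" by auto
  finally have cl: "closedin (top_of_set X) ?E" .
  have op: "openin (top_of_set X) ?E"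
  proof (subst openin_subopen, intro ballI)
    fix x assume x: "x \<in> ?E"
    then obtain U F V where *: "openin (top_of_set S) U" "sol U F" "openin (top_of_set X) V" "x \<in> V"
      "\<forall>y\<in>V. h y \<in> U \<and> c y = F (h y)"
      using assms(1) unfolding continuation_def by blast
    obtain U' F' V' where **: "openin (top_of_set S) U'" "sol U' F'" "openin (top_of_set X) V'" "x \<in> V'"
      "\<forall>y\<in>V'. h y \<in> U' \<and> c' y = F' (h y)"
      using assms(2) x unfolding continuation_def by blast
    have "h x \<in> U" "h x \<in> U'" "F (h x) = F' (h x)" using x * ** by auto
    from local_uniqueness[OF *(1) **(1) *(2) **(2) this] obtain W where W: "openin (top_of_set S) W" "h x \<in> W" "W \<subseteq> U \<inter> U'" "\<forall>x\<in>W. F x = F' x"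
      by blast
    have "openin (top_of_set X) (X \<inter> h -` W)"
      by (rule continuous_openin_preimage[OF assms(3) _ W(1)]) (use assms(4) in auto)
    then have "openin (top_of_set X) (X \<inter> h -` W \<inter> V \<inter> V')" using *(3) **(3) by blast
    moreover have "x \<in> X \<inter> h -` W \<inter> V \<inter> V'" using x W * ** by blast
    moreover have "X \<inter> h -` W \<inter> V \<inter> V' \<subseteq> ?E" using W * ** by auto
    ultimately show "\<exists>T. openin (top_of_set X) T \<and> x \<in> T \<and> T \<subseteq> ?E" by blast
  qed
  have "?E = {} \<or> ?E = X" using X cl op unfolding connected_clopen by blast
  then show ?thesis using x y by blast
qed

text \<open>Asking for every base point and every value, and not for a single start value, is what
  allows pieces to be glued at any common point.\<close>

definition continuable :: "('x::topological_space \<Rightarrow> 'a) \<Rightarrow> 'x set \<Rightarrow> bool" where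
  "continuable h X \<longleftrightarrow> (\<forall>x\<in>X. \<forall>b. \<exists>c. continuation h X c \<and> c x = b)"

lemma continuable_subset: "continuable h X \<Longrightarrow> Y \<subseteq> X \<Longrightarrow> continuable h Y"
  unfolding continuable_def
  using continuation_compose[of h X _ Y "\<lambda>y. y"] by (fastforce simp: continuous_on_id)

lemma continuation_glue:
  assumes c: "continuation h A c" "continuation h B d" "\<And>x. x \<in> A \<inter> B \<Longrightarrow> c x = d x"
    and cl: "closedin (top_of_set (A \<union> B)) A" "closedin (top_of_set (A \<union> B)) B"
    and h: "continuous_on (A \<union> B) h" "h ` (A \<union> B) \<subseteq> S"
  shows "continuation h (A \<union> B) (\<lambda>x. if x \<in> A then c x else d x)"
  unfolding continuation_def
proof
  let ?X = "A \<union> B" let ?e = "\<lambda>x. if x \<in> A then c x else d x"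
  \<comment> \<open>Removing \<open>A - V1\<close> and \<open>B - V2\<close>, which are closed in
    the union, leaves a neighbourhood of \<open>x\<close> on which both pieces are governed by
    \<open>F\<close>. An empty \<open>V1\<close> or \<open>V2\<close> removes a piece that does not
    contain \<open>x\<close>.\<close>
  have main: "\<exists>U F V. openin (top_of_set S) U \<and> sol U F \<and> openin (top_of_set ?X) V \<and> x \<in> V \<and>
      (\<forall>y\<in>V. h y \<in> U \<and> ?e y = F (h y))"
    if "openin (top_of_set S) U" "sol U F" "openin (top_of_set A) V1" "openin (top_of_set B) V2"
      "x \<in> ?X" "x \<in> A \<Longrightarrow> x \<in> V1" "x \<in> B \<Longrightarrow> x \<in> V2" "openin (top_of_set S) W" "h x \<in> W"
      "\<And>y. y \<in> V1 \<Longrightarrow> h y \<in> W \<Longrightarrow> h y \<in> U \<and> c y = F (h y)" "\<And>y. y \<in> V2 \<Longrightarrow> h y \<in> W \<Longrightarrow> h y \<in> U \<and> d y = F (h y)"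
    for x U F V1 V2 W
  proof -
    have "closedin (top_of_set A) (A - V1)" "closedin (top_of_set B) (B - V2)"
      using that(3,4) by (auto simp: closedin_diff)
    then have "closedin (top_of_set ?X) (A - V1)" "closedin (top_of_set ?X) (B - V2)"
      using cl closedin_trans by blast+
    moreover have "openin (top_of_set ?X) (?X \<inter> h -` W)"
      by (rule continuous_openin_preimage[OF h(1) _ that(8)]) (use h(2) in auto)
    ultimately have "openin (top_of_set ?X) (?X \<inter> h -` W - (A - V1) - (B - V2))" by (intro openin_diff)
    then show ?thesis
      using that by (intro exI[of _ U] exI[of _ F] exI[of _ "?X \<inter> h -` W - (A - V1) - (B - V2)"]) auto
  qed
  fix x assume x: "x \<in> ?X"
  then have hx: "h x \<in> S" using h(2) by blast
  consider "x \<in> A" "x \<in> B" | "x \<in> A" "x \<notin> B" | "x \<notin> A" "x \<in> B" using x by blast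
  then show "\<exists>U F V. openin (top_of_set S) U \<and> sol U F \<and> openin (top_of_set ?X) V \<and> x \<in> V \<and>
      (\<forall>y\<in>V. h y \<in> U \<and> ?e y = F (h y))"
  proof cases
    case 1
    obtain U F V where *: "openin (top_of_set S) U" "sol U F" "openin (top_of_set A) V" "x \<in> V"
      "\<forall>y\<in>V. h y \<in> U \<and> c y = F (h y)"
      using c(1) 1 unfolding continuation_def by blast
    obtain U' F' V' where **: "openin (top_of_set S) U'" "sol U' F'" "openin (top_of_set B) V'" "x \<in> V'"
      "\<forall>y\<in>V'. h y \<in> U' \<and> d y = F' (h y)"
      using c(2) 1 unfolding continuation_def by blast
    have "h x \<in> U" "h x \<in> U'" "F (h x) = F' (h x)" using 1 * ** c(3) by auto
    from local_uniqueness[OF *(1) **(1) *(2) **(2) this] obtain W where W: "openin (top_of_set S) W" "h x \<in> W" "W \<subseteq> U \<inter> U'" "\<forall>x\<in>W. F x = F' x"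
      by blast
    show ?thesis by (rule main[OF *(1,2,3) **(3) x _ _ W(1,2)]) (use * ** W in auto)
  next
    case 2
    obtain U F V where *: "openin (top_of_set S) U" "sol U F" "openin (top_of_set A) V" "x \<in> V"
      "\<forall>y\<in>V. h y \<in> U \<and> c y = F (h y)"
      using c(1) 2 unfolding continuation_def by blast
    show ?thesis by (rule main[OF *(1,2,3) openin_empty x _ _ openin_subtopology_self]) (use * 2 hx in auto)
  next
    case 3
    obtain U F V where *: "openin (top_of_set S) U" "sol U F" "openin (top_of_set B) V" "x \<in> V"
      "\<forall>y\<in>V. h y \<in> U \<and> d y = F (h y)"
      using c(2) 3 unfolding continuation_def by blast
    show ?thesis by (rule main[OF *(1,2) openin_empty *(3) x _ _ openin_subtopology_self]) (use * 3 hx in auto)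
  qed
qed

text \<open>The continuations chosen on the two pieces agree at one common point \<open>m\<close>,
  hence on the connected intersection, hence they glue.\<close>

lemma continuable_Un:
  assumes "continuable h A" "continuable h B"
    and cl: "closedin (top_of_set (A \<union> B)) A" "closedin (top_of_set (A \<union> B)) B"
    and h: "continuous_on (A \<union> B) h" "h ` (A \<union> B) \<subseteq> S"
    and conn: "connected (A \<inter> B)" "A \<inter> B \<noteq> {}"
  shows "continuable h (A \<union> B)"
proof -
  obtain m where m: "m \<in> A" "m \<in> B" using conn(2) by blast
  have glue: "continuation h (A \<union> B) (\<lambda>x. if x \<in> A then c x else d x) \<and> (\<forall>x\<in>A \<inter> B. c x = d x)"
    if cd: "continuation h A c" "continuation h B d" "c m = d m" for c d
  proof -
    have id: "continuous_on (A \<inter> B) (\<lambda>x. x)" by (rule continuous_on_id)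
    have c': "continuation h (A \<inter> B) c" "continuation h (A \<inter> B) d"
      using continuation_compose[OF cd(1) id] continuation_compose[OF cd(2) id] by auto
    have hh: "continuous_on (A \<inter> B) h" "h ` (A \<inter> B) \<subseteq> S"
      using h by (auto intro: continuous_on_subset)
    have "c x = d x" if "x \<in> A \<inter> B" for x
      by (rule continuation_unique[OF c' hh conn(1) _ cd(3) that]) (use m in blast)
    then show ?thesis using continuation_glue[OF cd(1,2) _ cl h] by blast
  qed
  show ?thesis
    unfolding continuable_def
  proof (intro ballI allI)
    fix x b assume "x \<in> A \<union> B"
    then consider "x \<in> A" | "x \<in> B" by blast
    then show "\<exists>c. continuation h (A \<union> B) c \<and> c x = b"
    proof cases
      case 1
      then obtain c where c: "continuation h A c" "c x = b" using assms(1) by (auto simp: continuable_def)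
      obtain d where d: "continuation h B d" "d m = c m" using assms(2) m by (auto simp: continuable_def)
      show ?thesis using glue[OF c(1) d(1) d(2)[symmetric]] c(2) 1
        by (intro exI[of _ "\<lambda>x. if x \<in> A then c x else d x"]) auto
    next
      case 2
      then obtain d where d: "continuation h B d" "d x = b" using assms(2) by (auto simp: continuable_def)
      obtain c where c: "continuation h A c" "c m = d m" using assms(1) m by (auto simp: continuable_def)
      show ?thesis using glue[OF c(1) d(1) c(2)] d(2) 2
        by (intro exI[of _ "\<lambda>x. if x \<in> A then c x else d x"]) auto
    qed
  qed
qed

text \<open>Small rectangles are mapped into one evenly covered neighbourhood. Bisection in the
  first coordinate joins them to a thin strip, bisection in the second joins strips to the square;
  the common edges are convex, so the pieces fit.\<close>

lemma continuable_square:
  fixes h :: "real \<times> real \<Rightarrow> 'a"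
  assumes h: "continuous_on ({0..1} \<times> {0..1}) h" "h ` ({0..1} \<times> {0..1}) \<subseteq> S"
  shows "continuable h ({0..1} \<times> {0..1})"
proof -
  let ?I = "{0..1::real}"
  have join: "continuable h (A \<union> B)"
    if "continuable h A" "continuable h B" "A \<union> B \<subseteq> ?I \<times> ?I" "closed A" "closed B" "convex (A \<inter> B)" "A \<inter> B \<noteq> {}"
    for A B
    using that continuous_on_subset[OF h(1) that(3)] h(2)
    by (intro continuable_Un) (auto intro: closed_subset convex_connected)
  define Q where "Q a b \<longleftrightarrow> (0 \<le> a \<and> b \<le> 1 \<longrightarrow> continuable h (?I \<times> {a..b}))" for a b
  have "Q 0 1"
  proof (rule Bolzano[of 0 1 Q])
    fix a b c :: real assume trans: "Q a b" "Q b c" "a \<le> b" "b \<le> c"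
    show "Q a c"
      unfolding Q_def
    proof
      assume ac: "0 \<le> a \<and> c \<le> 1"
      have "?I \<times> {a..c} = ?I \<times> {a..b} \<union> ?I \<times> {b..c}" using trans(3,4) by auto
      moreover have "(?I \<times> {a..b}) \<inter> (?I \<times> {b..c}) = ?I \<times> {b}" using trans(3,4) by auto
      then have "convex ((?I \<times> {a..b}) \<inter> (?I \<times> {b..c}))" "(?I \<times> {a..b}) \<inter> (?I \<times> {b..c}) \<noteq> {}"
        by (auto intro: convex_Times)
      then have "continuable h (?I \<times> {a..b} \<union> ?I \<times> {b..c})"
        using trans ac by (intro join) (auto intro: closed_Times simp: Q_def)
      ultimately show "continuable h (?I \<times> {a..c})" by simp
    qed
  next
    fix t :: real assume t: "0 \<le> t" "t \<le> 1"
    \<comment> \<open>The height \<open>d\<close> is quantified inside \<open>R\<close>, so that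
      joining two rectangles may pass to the smaller of their heights.\<close>
    define R where "R a b \<longleftrightarrow> (0 \<le> a \<and> b \<le> 1 \<longrightarrow> (\<exists>d>0. continuable h ({a..b} \<times> ({t - d..t + d} \<inter> ?I))))" for a b
    have "R 0 1"
    proof (rule Bolzano[of 0 1 R])
      fix a b c :: real assume trans: "R a b" "R b c" "a \<le> b" "b \<le> c"
      show "R a c"
        unfolding R_def
      proof
        assume ac: "0 \<le> a \<and> c \<le> 1"
        then obtain d e where de: "d > 0" "continuable h ({a..b} \<times> ({t - d..t + d} \<inter> ?I))"
          "e > 0" "continuable h ({b..c} \<times> ({t - e..t + e} \<inter> ?I))"
          using trans unfolding R_def by auto
        define J where "J = {t - min d e..t + min d e} \<inter> ?I"
        have J: "continuable h ({a..b} \<times> J)" "continuable h ({b..c} \<times> J)"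
          by (rule continuable_subset[OF de(2)], force simp: J_def,
              rule continuable_subset[OF de(4)], force simp: J_def)
        have "{a..c} = {a..b} \<union> {b..c}" using trans(3,4) by auto
        then have ac_eq: "{a..c} \<times> J = {a..b} \<times> J \<union> {b..c} \<times> J" by blast
        have *: "({a..b} \<times> J) \<inter> ({b..c} \<times> J) = {b} \<times> J"
        proof -
          have "({a..b} \<times> J) \<inter> ({b..c} \<times> J) = ({a..b} \<inter> {b..c}) \<times> J" by blast
          also have "{a..b} \<inter> {b..c} = {b}" using trans(3,4) by auto
          finally show ?thesis .
        qed
        have "t \<in> J" using t de by (simp add: J_def)
        then have "convex (({a..b} \<times> J) \<inter> ({b..c} \<times> J))" "({a..b} \<times> J) \<inter> ({b..c} \<times> J) \<noteq> {}"
          unfolding * by (auto simp: J_def intro!: convex_Times convex_Int)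
        moreover have "{a..b} \<times> J \<union> {b..c} \<times> J \<subseteq> ?I \<times> ?I" using trans(3,4) ac by (auto simp: J_def)
        moreover have "closed ({a..b} \<times> J)" "closed ({b..c} \<times> J)"
          unfolding J_def by (intro closed_Times closed_Int closed_atLeastAtMost)+
        ultimately have "continuable h ({a..b} \<times> J \<union> {b..c} \<times> J)" by (intro join J)
        with ac_eq have "continuable h ({a..c} \<times> J)" by simp
        then show "\<exists>d>0. continuable h ({a..c} \<times> ({t - d..t + d} \<inter> ?I))"
          unfolding J_def using de by (intro exI[of _ "min d e"]) auto
      qed
    next
      fix s :: real assume s: "0 \<le> s" "s \<le> 1"
      have "h (s, t) \<in> S" using s t h(2) by auto
      from local_existence[OF this] obtain U where U: "openin (top_of_set S) U" "h (s, t) \<in> U"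
        "\<And>q b. q \<in> U \<Longrightarrow> \<exists>F. sol U F \<and> F q = b" by blast
      have "openin (top_of_set (?I \<times> ?I)) ((?I \<times> ?I) \<inter> h -` U)"
        by (rule continuous_openin_preimage[OF h(1) _ U(1)]) (use h(2) in auto)
      then obtain T where T: "open T" "(?I \<times> ?I) \<inter> h -` U = (?I \<times> ?I) \<inter> T" by (auto simp: openin_open)
      have "(s, t) \<in> T" using T(2) U(2) s t by auto
      then obtain A B where AB: "open A" "open B" "s \<in> A" "t \<in> B" "A \<times> B \<subseteq> T"
        using T(1) by (auto elim: open_prod_elim)
      obtain d where d: "d > 0" "ball s d \<subseteq> A" using AB openE by blast
      obtain e where e: "e > 0" "cball t e \<subseteq> B" using AB open_contains_cball by blast
      have "continuable h ({a..b} \<times> ({t - e..t + e} \<inter> ?I))" if ab: "a \<le> s" "s \<le> b" "b - a < d" "0 \<le> a" "b \<le> 1" for a b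
      proof -
        let ?R = "{a..b} \<times> ({t - e..t + e} \<inter> ?I)"
        have sub: "?R \<subseteq> (?I \<times> ?I) \<inter> T"
        proof
          fix z assume z: "z \<in> ?R"
          then have "fst z \<in> ball s d" using ab by (auto simp: dist_real_def)
          moreover have "snd z \<in> cball t e" using z by (auto simp: dist_real_def)
          ultimately have "z \<in> A \<times> B" using d(2) e(2) by (simp only: mem_Times_iff) blast
          then have "z \<in> T" using AB(5) by blast
          then show "z \<in> (?I \<times> ?I) \<inter> T" using z ab by auto
        qed
        then have hR: "h ` ?R \<subseteq> U" using T(2) by blast
        show ?thesis
          unfolding continuable_def
        proof (intro ballI allI)
          fix z v assume "z \<in> ?R"
          then obtain F where "sol U F" "F (h z) = v" using U(3)[of "h z" v] hR by blast
          then show "\<exists>c. continuation h ?R c \<and> c z = v"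
            using continuation_solution[OF U(1) _ hR, of F] by blast
        qed
      qed
      then show "\<exists>d>0. \<forall>a b. a \<le> s \<and> s \<le> b \<and> b - a < d \<longrightarrow> R a b"
        unfolding R_def using d e by blast
    qed simp
    then obtain d where d: "d > 0" "continuable h (?I \<times> ({t - d..t + d} \<inter> ?I))" by (auto simp: R_def)
    have "continuable h (?I \<times> {a..b})" if "a \<le> t \<and> t \<le> b \<and> b - a < d" "0 \<le> a \<and> b \<le> 1" for a b
      by (rule continuable_subset[OF d(2)]) (use that in auto)
    then show "\<exists>d>0. \<forall>a b. a \<le> t \<and> t \<le> b \<and> b - a < d \<longrightarrow> Q a b"
      unfolding Q_def using d(1) by blast
  qed simp
  then show ?thesis by (simp add: Q_def)
qed

text \<open>A path is read as a square that does not depend on its second coordinate, then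
  restricted to the bottom edge.\<close>

lemma continuable_path:
  assumes "path \<gamma>" "path_image \<gamma> \<subseteq> S"
  shows "\<exists>c. continuation \<gamma> {0..1} c \<and> c 0 = b"
proof -
  have "continuable (\<lambda>x. \<gamma> (fst x)) ({0..1} \<times> {0..1::real})"
    by (rule continuable_square)
      (use assms in \<open>auto simp: path_def path_image_def intro!: continuous_on_compose2[of "{0..1}" \<gamma>] continuous_intros\<close>)
  then obtain c where c: "continuation (\<lambda>x. \<gamma> (fst x)) ({0..1} \<times> {0..1::real}) c" "c (0, 0) = b"
    unfolding continuable_def by (metis SigmaI atLeastAtMost_iff order_refl zero_le_one)
  have "continuation (\<lambda>t. \<gamma> (fst (t, 0::real))) {0..1} (\<lambda>t. c (t, 0))"
    by (rule continuation_compose[OF c(1)]) (auto intro!: continuous_intros)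
  then show ?thesis using c(2) by auto
qed

lemma continuation_path_unique:
  assumes "continuation \<gamma> {0..1} c" "continuation \<gamma> {0..1} d" "path \<gamma>" "path_image \<gamma> \<subseteq> S"
    and "c 0 = d 0" "t \<in> {0..1}"
  shows "c t = d t"
  by (rule continuation_unique[OF assms(1,2) _ _ _ _ assms(5,6)])
    (use assms(3,4) in \<open>auto simp: path_def path_image_def\<close>)

text \<open>Continue over the square of a free homotopy from \<open>\<gamma>\<close> to a constant
  loop. Along the edge of the constant loop the lift is constant, so its values at the two ends
  agree. The two adjacent edges trace the same curve, because all intermediate loops are closed, so
  the agreement travels back to the ends of \<open>\<gamma>\<close>.\<close>

lemma continuation_loop:
  assumes sc: "simply_connected S" and \<gamma>: "path \<gamma>" "path_image \<gamma> \<subseteq> S" "pathstart \<gamma> = pathfinish \<gamma>"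
    and c: "continuation \<gamma> {0..1} c"
  shows "c 0 = c 1"
proof -
  let ?I = "{0..1::real}"
  define p where "p = pathstart \<gamma>"
  have p: "p \<in> S" using \<gamma> by (auto simp: p_def)
  have hom: "homotopic_loops S \<gamma> (\<lambda>_. p)"
  proof -
    have "path (\<lambda>_. p)" "path_image (\<lambda>_. p) \<subseteq> S" "pathfinish (\<lambda>_. p) = pathstart (\<lambda>_. p)"
      using p by (auto simp: path_def path_image_def pathstart_def pathfinish_def)
    then show ?thesis using sc \<gamma> unfolding simply_connected_def by metis
  qed
  obtain H where H: "continuous_on (?I \<times> ?I) H" "H ` (?I \<times> ?I) \<subseteq> S" "\<And>x. x \<in> ?I \<Longrightarrow> H (0, x) = \<gamma> x"
    "\<And>x. x \<in> ?I \<Longrightarrow> H (1, x) = p" "\<And>t. t \<in> ?I \<Longrightarrow> H (t, 1) = H (t, 0)"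
  proof -
    from hom obtain H where H: "continuous_on (?I \<times> ?I) H" "H \<in> (?I \<times> ?I) \<rightarrow> S"
      "\<forall>x\<in>?I. H (0, x) = \<gamma> x" "\<forall>x\<in>?I. H (1, x) = p"
      "\<forall>t\<in>?I. pathfinish (H \<circ> Pair t) = pathstart (H \<circ> Pair t)"
      unfolding homotopic_loops by blast
    show thesis by (rule that[OF H(1)]) (use H in \<open>auto simp: pathfinish_def pathstart_def\<close>)
  qed
  obtain C where C: "continuation H (?I \<times> ?I) C" "C (0, 0) = c 0"
    using continuable_square[OF H(1,2)] unfolding continuable_def
    by (metis SigmaI atLeastAtMost_iff order_refl zero_le_one)
  have slice: "continuation (\<lambda>t. H (\<phi> t)) ?I (\<lambda>t. C (\<phi> t))" "path (\<lambda>t. H (\<phi> t))" "path_image (\<lambda>t. H (\<phi> t)) \<subseteq> S"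
    if "continuous_on ?I \<phi>" "\<phi> ` ?I \<subseteq> ?I \<times> ?I" for \<phi>
    using continuation_compose[OF C(1) that] continuous_on_compose2[OF H(1) that] H(2) that(2)
    by (auto simp: path_def path_image_def)
  have c0: "continuous_on ?I (\<lambda>t. (a, t))" "a \<in> ?I \<Longrightarrow> (\<lambda>t. (a, t)) ` ?I \<subseteq> ?I \<times> ?I" for a :: real
    by (auto intro!: continuous_intros)
  have left: "C (0, t) = c t" if t: "t \<in> ?I" for t
  proof (rule continuation_path_unique[where c="\<lambda>t. C (0, t)" and d=c and \<gamma>=\<gamma>, OF _ c \<gamma>(1,2) C(2) t])
    show "continuation \<gamma> ?I (\<lambda>t. C (0, t))"
      by (rule iffD1[OF continuation_cong slice(1)[OF c0[of 0]]]) (use H(3) in auto)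
  qed
  have right: "C (1, 0) = C (1, 1)"
  proof -
    obtain U where U: "openin (top_of_set S) U" "p \<in> U" "\<exists>F. sol U F \<and> F p = C (1, 0)"
      using local_existence[OF p] by blast
    then obtain F where F: "sol U F" "F p = C (1, 0)" by blast
    have "continuation (\<lambda>t. H (1, t)) ?I (\<lambda>t. F (H (1, t)))"
      by (rule continuation_solution[OF U(1) F(1)]) (use U(2) H(4) in auto)
    then have "C (1, 1) = F (H (1, 1))"
      using slice[OF c0[of 1]] F(2) H(4)
      by (intro continuation_path_unique[where \<gamma>="\<lambda>t. H (1, t)" and c="\<lambda>t. C (1, t)" and d="\<lambda>t. F (H (1, t))" and t=1]) auto
    then show ?thesis using F H(4) by simp
  qed
  \<comment> \<open>The parameter \<open>1 - t\<close> runs both edges from the constant loop, where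
    the values are known to agree, back to \<open>\<gamma>\<close>.\<close>
  have "C (1 - 1, 0) = C (1 - 1, 1)"
  proof (rule continuation_path_unique[where \<gamma>="\<lambda>t. H (1 - t, 0)" and c="\<lambda>t. C (1 - t, 0)" and d="\<lambda>t. C (1 - t, 1)" and t=1])
    have m: "continuous_on ?I (\<lambda>t. (1 - t, a))" "a \<in> ?I \<Longrightarrow> (\<lambda>t. (1 - t, a)) ` ?I \<subseteq> ?I \<times> ?I" for a :: real
      by (auto intro!: continuous_intros)
    show "continuation (\<lambda>t. H (1 - t, 0)) ?I (\<lambda>t. C (1 - t, 0))" "path (\<lambda>t. H (1 - t, 0))"
      "path_image (\<lambda>t. H (1 - t, 0)) \<subseteq> S"
      using slice[OF m[of 0]] by auto
    show "continuation (\<lambda>t. H (1 - t, 0)) ?I (\<lambda>t. C (1 - t, 1))"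
      by (rule iffD1[OF continuation_cong slice(1)[OF m[of 1]]]) (use H(5) in auto)
  qed (use right in auto)
  then show ?thesis using left by simp
qed

theorem global_solution_exists:
  assumes sc: "simply_connected S" and p0: "p0 \<in> S"
  shows "\<exists>G. G p0 = a0 \<and> (\<forall>p\<in>S. \<exists>U F. openin (top_of_set S) U \<and> p \<in> U \<and> sol U F \<and> (\<forall>q\<in>U. G q = F q))"
proof -
  let ?I = "{0..1::real}"
  define rel where "rel p b \<longleftrightarrow> (\<exists>\<gamma> c. path \<gamma> \<and> path_image \<gamma> \<subseteq> S \<and> pathstart \<gamma> = p0 \<and> pathfinish \<gamma> = p \<and>
      continuation \<gamma> ?I c \<and> c 0 = a0 \<and> c 1 = b)" for p b
  have ex: "\<exists>b. rel p b" if p: "p \<in> S" for p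
  proof -
    obtain \<gamma> where "path \<gamma>" "path_image \<gamma> \<subseteq> S" "pathstart \<gamma> = p0" "pathfinish \<gamma> = p"
      using simply_connected_path_connected[OF sc] p p0 unfolding path_connected_def by blast
    then show ?thesis using continuable_path[of \<gamma> a0] unfolding rel_def by blast
  qed
  \<comment> \<open>The continuation \<open>C\<close> along
    \<open>\<gamma> +++ reversepath \<delta>\<close> starts and ends at \<open>a0\<close>. Its first
    half is a continuation along \<open>\<gamma>\<close>, its second half read backwards one along
    \<open>\<delta>\<close>, and both end at the midpoint value \<open>C (1 / 2)\<close>.\<close>
  have unique: "b = b'" if r: "rel p b" "rel p b'" for p b b'
  proof -
    obtain \<gamma> c where \<gamma>: "path \<gamma>" "path_image \<gamma> \<subseteq> S" "pathstart \<gamma> = p0" "pathfinish \<gamma> = p"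
      "continuation \<gamma> ?I c" "c 0 = a0" "c 1 = b" using r(1) unfolding rel_def by blast
    obtain \<delta> d where \<delta>: "path \<delta>" "path_image \<delta> \<subseteq> S" "pathstart \<delta> = p0" "pathfinish \<delta> = p"
      "continuation \<delta> ?I d" "d 0 = a0" "d 1 = b'" using r(2) unfolding rel_def by blast
    let ?l = "\<gamma> +++ reversepath \<delta>"
    have l: "path ?l" "path_image ?l \<subseteq> S" "pathstart ?l = pathfinish ?l"
      using \<gamma> \<delta> by (auto simp: path_image_join)
    obtain C where C: "continuation ?l ?I C" "C 0 = a0" using continuable_path[OF l(1,2)] by blast
    have C1: "C 1 = a0" using continuation_loop[OF sc l C(1)] C(2) by simp
    have "continuation (\<lambda>t. ?l (t / 2)) ?I (\<lambda>t. C (t / 2))"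
      by (rule continuation_compose[OF C(1)]) (auto intro!: continuous_intros)
    then have "continuation \<gamma> ?I (\<lambda>t. C (t / 2))"
      by (rule iffD1[OF continuation_cong, rotated 2]) (auto simp: joinpaths_def)
    then have "C (1 / 2) = c 1"
      by (rule continuation_path_unique[where c="\<lambda>t. C (t / 2)" and d=c and t=1, OF _ \<gamma>(5,1,2)]) (use C \<gamma> in auto)
    moreover have "continuation (\<lambda>t. ?l (1 - t / 2)) ?I (\<lambda>t. C (1 - t / 2))"
      by (rule continuation_compose[OF C(1)]) (auto intro!: continuous_intros)
    then have "continuation \<delta> ?I (\<lambda>t. C (1 - t / 2))"
    proof (rule iffD1[OF continuation_cong, rotated 2])
      fix t assume "t \<in> ?I"
      show "?l (1 - t / 2) = \<delta> t"
      \<comment> \<open>At the midpoint \<open>+++\<close> still takes its first path, so the end of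
        \<open>\<delta>\<close> is read off from the end of \<open>\<gamma>\<close>.\<close>
      proof (cases "t = 1")
        case True
        then show ?thesis using \<gamma>(4) \<delta>(4) by (auto simp: joinpaths_def pathfinish_def)
      qed (use \<open>t \<in> ?I\<close> in \<open>auto simp: joinpaths_def reversepath_def\<close>)
    qed simp
    then have "C (1 - 1 / 2) = d 1"
      by (rule continuation_path_unique[where c="\<lambda>t. C (1 - t / 2)" and d=d and t=1, OF _ \<delta>(5,1,2)]) (use C1 \<delta> in auto)
    ultimately show ?thesis using \<gamma> \<delta> by simp
  qed
  define G where "G p = (THE b. rel p b)" for p
  have G: "rel p b \<Longrightarrow> G p = b" for p b unfolding G_def using unique by blast
  have "G p0 = a0"
  proof (rule G)
    have "path (\<lambda>_. p0)" "path_image (\<lambda>_. p0) \<subseteq> S" "pathfinish (\<lambda>_. p0) = p0" "pathstart (\<lambda>_. p0) = p0"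
      using p0 by (auto simp: path_def path_image_def pathstart_def pathfinish_def)
    moreover obtain U where U: "openin (top_of_set S) U" "p0 \<in> U" "\<exists>F. sol U F \<and> F p0 = a0"
      using local_existence[OF p0] by blast
    then have "continuation (\<lambda>_. p0) ?I (\<lambda>_. a0)"
      using continuation_solution[OF U(1), of _ "\<lambda>_. p0" ?I] by auto
    ultimately show "rel p0 a0" unfolding rel_def by blast
  qed
  moreover have "\<exists>U F. openin (top_of_set S) U \<and> p \<in> U \<and> sol U F \<and> (\<forall>q\<in>U. G q = F q)" if p: "p \<in> S" for p
  proof -
    obtain b where b: "rel p b" using ex[OF p] by blast
    then obtain \<gamma> c where \<gamma>: "path \<gamma>" "path_image \<gamma> \<subseteq> S" "pathstart \<gamma> = p0" "pathfinish \<gamma> = p"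
      "continuation \<gamma> ?I c" "c 0 = a0" "c 1 = b" unfolding rel_def by blast
    obtain U where U: "openin (top_of_set S) U" "p \<in> U" "path_connected U" "\<exists>F. sol U F \<and> F p = b"
      using local_existence[OF p] by blast
    then obtain F where F: "sol U F" "F p = b" by blast
    \<comment> \<open>A path to \<open>p\<close> prolonged inside \<open>U\<close> continues the
      value along \<open>F\<close>, so \<open>G\<close> equals \<open>F\<close> on all of
      \<open>U\<close> and not only at \<open>p\<close>.\<close>
    have "G q = F q" if q: "q \<in> U" for q
    proof (rule G)
      obtain \<delta> where \<delta>: "path \<delta>" "path_image \<delta> \<subseteq> U" "pathstart \<delta> = p" "pathfinish \<delta> = q"
        using U(2,3) q unfolding path_connected_def by blast
      have \<delta>S: "path_image \<delta> \<subseteq> S" using \<delta>(2) openin_imp_subset[OF U(1)] by blast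
      let ?l = "\<gamma> +++ \<delta>"
      have l: "path ?l" "path_image ?l \<subseteq> S" "pathstart ?l = p0" "pathfinish ?l = q"
        using \<gamma> \<delta> \<delta>S by (auto simp: path_image_join)
      obtain C where C: "continuation ?l ?I C" "C 0 = a0" using continuable_path[OF l(1,2)] by blast
      have "continuation (\<lambda>t. ?l (t / 2)) ?I (\<lambda>t. C (t / 2))"
        by (rule continuation_compose[OF C(1)]) (auto intro!: continuous_intros)
      then have "continuation \<gamma> ?I (\<lambda>t. C (t / 2))"
        by (rule iffD1[OF continuation_cong, rotated 2]) (auto simp: joinpaths_def)
      then have C12: "C (1 / 2) = c 1"
        by (rule continuation_path_unique[where c="\<lambda>t. C (t / 2)" and d=c and t=1, OF _ \<gamma>(5,1,2)]) (use C \<gamma> in auto)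
      have "continuation (\<lambda>t. ?l ((1 + t) / 2)) ?I (\<lambda>t. C ((1 + t) / 2))"
        by (rule continuation_compose[OF C(1)]) (auto intro!: continuous_intros)
      then have "continuation \<delta> ?I (\<lambda>t. C ((1 + t) / 2))"
      proof (rule iffD1[OF continuation_cong, rotated 2])
        fix t assume "t \<in> ?I"
        show "?l ((1 + t) / 2) = \<delta> t"
        proof (cases "t = 0")
          case True
          then show ?thesis using \<gamma>(4) \<delta>(3) by (auto simp: joinpaths_def pathfinish_def pathstart_def)
        next
          case False
          have "2 * ((1 + t) / 2) - 1 = t" by (simp add: field_simps)
          then show ?thesis using False \<open>t \<in> ?I\<close> unfolding joinpaths_def by auto
        qed
      qed simp
      moreover have "continuation \<delta> ?I (\<lambda>t. F (\<delta> t))"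
        by (rule continuation_solution[OF U(1) F(1)]) (use \<delta>(2) in \<open>auto simp: path_image_def\<close>)
      ultimately have "C ((1 + 1) / 2) = F (\<delta> 1)"
        by (rule continuation_path_unique[where c="\<lambda>t. C ((1 + t) / 2)" and d="\<lambda>t. F (\<delta> t)" and t=1, OF _ _ \<delta>(1) \<delta>S])
          (use C12 \<gamma>(7) F(2) \<delta>(3) in \<open>auto simp: pathstart_def\<close>)
      then show "rel q (F q)" unfolding rel_def using l C \<delta>(4) by (auto simp: pathfinish_def)
    qed
    then show ?thesis using U F by blast
  qed
  ultimately show ?thesis by blast
qed

end

section \<open>Symmetry of second derivatives\<close>

text \<open>Two applications of the mean value theorem: in direction \<open>w\<close> to the
  increment of \<open>f\<close> over \<open>h *\<^sub>R v\<close>, then in direction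
  \<open>v\<close> to the derivative of \<open>f\<close> along \<open>w\<close>.\<close>

lemma second_difference_eq:
  fixes f :: "'e::euclidean_space \<Rightarrow> real"
  assumes W: "open W" and f: "Ck_on (Suc (Suc 0)) W f" and ball: "ball x e \<subseteq> W"
    and h: "0 < h" "h * (norm v + norm w) < e"
  shows "\<exists>y\<in>ball x e. f (x + h *\<^sub>R v + h *\<^sub>R w) - f (x + h *\<^sub>R v) - f (x + h *\<^sub>R w) + f x =
     h * h * frechet_derivative (\<lambda>x. frechet_derivative f (at x) w) (at y) v"
proof -
  let ?D = "\<lambda>x. frechet_derivative f (at x)"
  let ?DD = "\<lambda>y. frechet_derivative (\<lambda>x. ?D x w) (at y)"
  have in_ball: "x + s *\<^sub>R v + t *\<^sub>R w \<in> ball x e" if "0 \<le> s" "s \<le> h" "0 \<le> t" "t \<le> h" for s t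
  proof -
    have "norm (s *\<^sub>R v + t *\<^sub>R w) \<le> s * norm v + t * norm w"
      using that by (intro norm_triangle_mono) auto
    also have "\<dots> \<le> h * norm v + h * norm w" using that by (intro add_mono mult_right_mono) auto
    finally have "norm (s *\<^sub>R v + t *\<^sub>R w) < e" using h(2) by (simp add: distrib_left)
    moreover have "dist x (x + s *\<^sub>R v + t *\<^sub>R w) = norm (s *\<^sub>R v + t *\<^sub>R w)"
      unfolding add.assoc dist_norm by (metis add_diff_cancel_left' norm_minus_commute)
    ultimately show ?thesis by simp
  qed
  have D: "(f has_derivative ?D y) (at y)" if "y \<in> ball x e" for y
    using Ck_on_Suc_has_derivative[OF W f] that ball by blast
  have DD: "((\<lambda>x. ?D x w) has_derivative ?DD y) (at y)" if "y \<in> ball x e" for y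
    using Ck_on_Suc_has_derivative[OF W Ck_on_SucD[OF f]] that ball by blast
  have in0: "x + t *\<^sub>R w \<in> ball x e" if "0 \<le> t" "t \<le> h" for t using in_ball[of 0 t] that h(1) by simp
  have "\<exists>t\<in>{0<..<h}. (f (x + h *\<^sub>R v + h *\<^sub>R w) - f (x + h *\<^sub>R w)) - (f (x + h *\<^sub>R v + 0 *\<^sub>R w) - f (x + 0 *\<^sub>R w)) =
      ?D (x + h *\<^sub>R v + t *\<^sub>R w) ((h - 0) *\<^sub>R w) - ?D (x + t *\<^sub>R w) ((h - 0) *\<^sub>R w)"
  proof (rule mvt_simple[where f="\<lambda>t. f (x + h *\<^sub>R v + t *\<^sub>R w) - f (x + t *\<^sub>R w)"
        and f'="\<lambda>t d. ?D (x + h *\<^sub>R v + t *\<^sub>R w) (d *\<^sub>R w) - ?D (x + t *\<^sub>R w) (d *\<^sub>R w)"])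
    fix t assume t: "0 \<le> t" "t \<le> h"
    have "((\<lambda>t. f (a + t *\<^sub>R w)) has_derivative (\<lambda>d. ?D (a + t *\<^sub>R w) (d *\<^sub>R w))) (at t within {0..h})"
      if "a + t *\<^sub>R w \<in> ball x e" for a
      by (rule has_derivative_compose[where f="\<lambda>t. a + t *\<^sub>R w" and f'="\<lambda>d. d *\<^sub>R w" and g=f, OF _ D[OF that]])
        (auto intro!: derivative_eq_intros)
    from has_derivative_diff[OF this this] in_ball[OF _ _ t] in0[OF t] h(1)
    show "((\<lambda>t. f (x + h *\<^sub>R v + t *\<^sub>R w) - f (x + t *\<^sub>R w)) has_derivative
        (\<lambda>d. ?D (x + h *\<^sub>R v + t *\<^sub>R w) (d *\<^sub>R w) - ?D (x + t *\<^sub>R w) (d *\<^sub>R w))) (at t within {0..h})"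
      by simp
  qed (use h in auto)
  then obtain t where t: "0 < t" "t < h"
    "f (x + h *\<^sub>R v + h *\<^sub>R w) - f (x + h *\<^sub>R v) - f (x + h *\<^sub>R w) + f x =
       ?D (x + h *\<^sub>R v + t *\<^sub>R w) (h *\<^sub>R w) - ?D (x + t *\<^sub>R w) (h *\<^sub>R w)"
    by auto
  have lin: "?D y (h *\<^sub>R w) = h * ?D y w" if "y \<in> ball x e" for y
    using linear_cmul[OF has_derivative_linear[OF D[OF that]], of h w] by simp
  have "\<exists>s\<in>{0<..<h}. ?D (x + t *\<^sub>R w + h *\<^sub>R v) w - ?D (x + t *\<^sub>R w + 0 *\<^sub>R v) w = ?DD (x + t *\<^sub>R w + s *\<^sub>R v) ((h - 0) *\<^sub>R v)"
  proof (rule mvt_simple[where f="\<lambda>s. ?D (x + t *\<^sub>R w + s *\<^sub>R v) w" and f'="\<lambda>s d. ?DD (x + t *\<^sub>R w + s *\<^sub>R v) (d *\<^sub>R v)"])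
    fix s assume s: "0 \<le> s" "s \<le> h"
    have m: "x + t *\<^sub>R w + s *\<^sub>R v \<in> ball x e" using in_ball[OF s, of t] t by (simp add: algebra_simps)
    show "((\<lambda>s. ?D (x + t *\<^sub>R w + s *\<^sub>R v) w) has_derivative (\<lambda>d. ?DD (x + t *\<^sub>R w + s *\<^sub>R v) (d *\<^sub>R v))) (at s within {0..h})"
      by (rule has_derivative_compose[where f="\<lambda>s. x + t *\<^sub>R w + s *\<^sub>R v" and f'="\<lambda>d. d *\<^sub>R v" and g="\<lambda>x. ?D x w", OF _ DD[OF m]])
        (auto intro!: derivative_eq_intros)
  qed (use h in auto)
  then obtain s where s: "0 < s" "s < h"
    "?D (x + t *\<^sub>R w + h *\<^sub>R v) w - ?D (x + t *\<^sub>R w) w = ?DD (x + t *\<^sub>R w + s *\<^sub>R v) (h *\<^sub>R v)" by auto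
  have m: "x + t *\<^sub>R w + s *\<^sub>R v \<in> ball x e" using in_ball[of s t] s t by (simp add: algebra_simps)
  have comm: "x + h *\<^sub>R v + t *\<^sub>R w = x + t *\<^sub>R w + h *\<^sub>R v" by (simp add: algebra_simps)
  have hv: "?DD (x + t *\<^sub>R w + s *\<^sub>R v) (h *\<^sub>R v) = h * ?DD (x + t *\<^sub>R w + s *\<^sub>R v) v"
    using linear_cmul[OF has_derivative_linear[OF DD[OF m]], of h v] by simp
  have "f (x + h *\<^sub>R v + h *\<^sub>R w) - f (x + h *\<^sub>R v) - f (x + h *\<^sub>R w) + f x =
      h * (?D (x + t *\<^sub>R w + h *\<^sub>R v) w - ?D (x + t *\<^sub>R w) w)"
    using t(3) lin[OF in0[of t]] lin[OF in_ball[of h t]] t(1,2) h(1)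
    by (simp add: comm right_diff_distrib)
  also have "\<dots> = h * (h * ?DD (x + t *\<^sub>R w + s *\<^sub>R v) v)" unfolding s(3) hv ..
  finally show ?thesis using m by (intro bexI[of _ "x + t *\<^sub>R w + s *\<^sub>R v"]) (simp_all add: mult.assoc)
qed

text \<open>The second difference is symmetric in \<open>v\<close> and \<open>w\<close>, so the two
  mixed derivatives share a value at points arbitrarily near \<open>x\<close>; continuity then
  excludes different values at \<open>x\<close>.\<close>

lemma frechet_derivative_commute_real:
  fixes f :: "'e::euclidean_space \<Rightarrow> real"
  assumes W: "open W" and f: "Ck_on (Suc (Suc 0)) W f" and x: "x \<in> W"
  shows "frechet_derivative (\<lambda>x. frechet_derivative f (at x) v) (at x) w =
    frechet_derivative (\<lambda>x. frechet_derivative f (at x) w) (at x) v"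
proof (rule ccontr)
  define A where "A v w y = frechet_derivative (\<lambda>x. frechet_derivative f (at x) v) (at y) w" for v w y
  assume "\<not> ?thesis"
  then have ne: "A v w x \<noteq> A w v x" by (simp add: A_def)
  have cont: "continuous_on W (A v w)" for v w
    unfolding A_def[abs_def] using Ck_on_SucD[OF Ck_on_SucD[OF f]] by simp
  define \<epsilon> where "\<epsilon> = \<bar>A v w x - A w v x\<bar> / 2"
  have \<epsilon>: "\<epsilon> > 0" using ne by (simp add: \<epsilon>_def)
  have near: "\<exists>d>0. ball x d \<subseteq> W \<and> (\<forall>y\<in>ball x d. \<bar>A v w y - A v w x\<bar> < \<epsilon>)" for v w
  proof -
    obtain r where r: "r > 0" "ball x r \<subseteq> W" using W x openE by blast
    obtain d where d: "d > 0" "\<And>y. y \<in> W \<Longrightarrow> dist y x < d \<Longrightarrow> dist (A v w y) (A v w x) < \<epsilon>"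
      using cont[of v w] x \<epsilon> unfolding continuous_on_iff by blast
    have "ball x (min r d) \<subseteq> W" using r by auto
    moreover have "\<bar>A v w y - A v w x\<bar> < \<epsilon>" if "y \<in> ball x (min r d)" for y
      using d(2)[of y] that r by (auto simp: dist_real_def dist_commute)
    ultimately show ?thesis using r d by (intro exI[of _ "min r d"]) auto
  qed
  obtain d1 where d1: "d1 > 0" "ball x d1 \<subseteq> W" "\<And>y. y \<in> ball x d1 \<Longrightarrow> \<bar>A v w y - A v w x\<bar> < \<epsilon>"
    using near[of v w] by blast
  obtain d2 where d2: "d2 > 0" "ball x d2 \<subseteq> W" "\<And>y. y \<in> ball x d2 \<Longrightarrow> \<bar>A w v y - A w v x\<bar> < \<epsilon>"
    using near[of w v] by blast
  define d where "d = min d1 d2"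
  \<comment> \<open>\<open>+ 1\<close> keeps the denominator positive when both directions vanish;
    the factor 2 makes the bound by \<open>d\<close> strict.\<close>
  define h where "h = d / (2 * (norm v + norm w + 1))"
  have d: "d > 0" using d1 d2 by (simp add: d_def)
  have npos: "norm v + norm w + 1 > 0" using norm_ge_zero[of v] norm_ge_zero[of w] by linarith
  have h: "h > 0" using d npos by (simp add: h_def)
  have "h * (norm v + norm w) \<le> h * (norm v + norm w + 1)" using h by simp
  also have "\<dots> = d / 2" using npos by (simp add: h_def field_simps)
  also have "\<dots> < d" using d by simp
  finally have hd: "h * (norm v + norm w) < d" .
  have bd: "ball x d \<subseteq> W" using d1 by (auto simp: d_def)
  obtain y where y: "y \<in> ball x d" "f (x + h *\<^sub>R v + h *\<^sub>R w) - f (x + h *\<^sub>R v) - f (x + h *\<^sub>R w) + f x = h * h * A w v y"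
    using second_difference_eq[OF W f bd h hd] unfolding A_def by blast
  have hd': "h * (norm w + norm v) < d" using hd by (simp add: add.commute)
  obtain z where z: "z \<in> ball x d" "f (x + h *\<^sub>R w + h *\<^sub>R v) - f (x + h *\<^sub>R w) - f (x + h *\<^sub>R v) + f x = h * h * A v w z"
    using second_difference_eq[OF W f bd h hd'] unfolding A_def by blast
  have "x + h *\<^sub>R w + h *\<^sub>R v = x + h *\<^sub>R v + h *\<^sub>R w" by (simp add: algebra_simps)
  from z(2)[unfolded this] have "h * h * A w v y = h * h * A v w z" using y(2) by linarith
  then have "A w v y = A v w z" using h by simp
  moreover have "\<bar>A w v y - A w v x\<bar> < \<epsilon>" "\<bar>A v w z - A v w x\<bar> < \<epsilon>"
    using d1(3) d2(3) y z by (auto simp: d_def)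
  ultimately show False unfolding \<epsilon>_def by (smt (verit) field_sum_of_halves)
qed

lemma frechet_derivative_commute:
  fixes f :: "'e::euclidean_space \<Rightarrow> 'b::euclidean_space"
  assumes W: "open W" and f: "Ck_on (Suc (Suc 0)) W f" and x: "x \<in> W"
  shows "frechet_derivative (\<lambda>x. frechet_derivative f (at x) v) (at x) w =
    frechet_derivative (\<lambda>x. frechet_derivative f (at x) w) (at x) v"
proof (rule euclidean_eqI)
  fix b :: 'b
  have bl: "bounded_linear (\<lambda>y::'b. y \<bullet> b)" by (rule bounded_linear_inner_left)
  let ?g = "\<lambda>x. f x \<bullet> b"
  have g1: "frechet_derivative ?g (at y) = (\<lambda>w. frechet_derivative f (at y) w \<bullet> b)" if "y \<in> W" for y
    using frechet_derivative_at[OF bounded_linear.has_derivative[OF bl Ck_on_Suc_has_derivative[OF W f that]]] by metis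
  have "frechet_derivative (\<lambda>x. frechet_derivative ?g (at x) v) (at x) w = frechet_derivative (\<lambda>x. frechet_derivative f (at x) v) (at x) w \<bullet> b" for v w
  proof -
    have "((\<lambda>x. frechet_derivative f (at x) v \<bullet> b) has_derivative
        (\<lambda>w. frechet_derivative (\<lambda>x. frechet_derivative f (at x) v) (at x) w \<bullet> b)) (at x)"
      by (rule bounded_linear.has_derivative[OF bl Ck_on_Suc_has_derivative[OF W Ck_on_SucD[OF f] x]])
    then have "((\<lambda>x. frechet_derivative ?g (at x) v) has_derivative
        (\<lambda>w. frechet_derivative (\<lambda>x. frechet_derivative f (at x) v) (at x) w \<bullet> b)) (at x)"
      by (rule has_derivative_transform_within_open[OF _ W x]) (simp add: g1)
    from frechet_derivative_at[OF this] show ?thesis by metis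
  qed
  moreover have "Ck_on (Suc (Suc 0)) W ?g" by (rule Ck_on_bounded_linear[OF W bl f])
  ultimately show "frechet_derivative (\<lambda>x. frechet_derivative f (at x) v) (at x) w \<bullet> b =
      frechet_derivative (\<lambda>x. frechet_derivative f (at x) w) (at x) v \<bullet> b"
    using frechet_derivative_commute_real[OF W _ x, of ?g v w] by metis
qed

section \<open>Calculus on a surface with coordinates\<close>

text \<open>Both sides are the same choice made from equal predicates, so the equation also holds
  where no derivative exists. This matters because \<open>diff_at\<close> is defined without a
  differentiability assumption.\<close>

lemma frechet_derivative_cong_open:
  assumes "open T" "x \<in> T" "\<And>y. y \<in> T \<Longrightarrow> f y = g y"
  shows "frechet_derivative f (at x) = frechet_derivative g (at x)"
proof -
  have "(f has_derivative D) (at x) \<longleftrightarrow> (g has_derivative D) (at x)" for D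
    using has_derivative_transform_within_open[OF _ assms(1,2), of f D UNIV g]
      has_derivative_transform_within_open[OF _ assms(1,2), of g D UNIV f] assms(3) by auto
  then show ?thesis unfolding frechet_derivative_def by simp
qed

section \<open>Charts and local expressions\<close>

lemma chart_subset: "chart_domain S u v U \<Longrightarrow> U \<subseteq> S"
  unfolding chart_domain_def using openin_imp_subset by blast

lemma chart_openin: "chart_domain S u v U \<Longrightarrow> openin (top_of_set S) U"
  unfolding chart_domain_def by blast

lemma chart_open: "chart_domain S u v U \<Longrightarrow> open (coord_map u v ` U)"
  unfolding chart_domain_def by blast

lemma chart_homeomorphism:
  "chart_domain S u v U \<Longrightarrow> homeomorphism U (coord_map u v ` U) (coord_map u v) (inv_into U (coord_map u v))"
  unfolding chart_domain_def by blast

lemma chart_inv [simp]: "chart_domain S u v U \<Longrightarrow> p \<in> U \<Longrightarrow> inv_into U (coord_map u v) (coord_map u v p) = p"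
  using chart_homeomorphism unfolding homeomorphism_def by blast

lemma chart_inv_in: "z \<in> coord_map u v ` U \<Longrightarrow> inv_into U (coord_map u v) z \<in> U"
  by (rule inv_into_into)

lemma chart_coord_inv: "z \<in> coord_map u v ` U \<Longrightarrow> coord_map u v (inv_into U (coord_map u v) z) = z"
  by (rule f_inv_into_f)

lemma chart_continuous_coord: "chart_domain S u v U \<Longrightarrow> continuous_on U (coord_map u v)"
  using chart_homeomorphism unfolding homeomorphism_def by blast

lemma chart_continuous_inv: "chart_domain S u v U \<Longrightarrow> continuous_on (coord_map u v ` U) (inv_into U (coord_map u v))"
  using chart_homeomorphism unfolding homeomorphism_def by blast

lemma chart_open_image:
  assumes "chart_domain S u v U" "openin (top_of_set S) V" "V \<subseteq> U"
  shows "open (coord_map u v ` V)"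
proof -
  have "openin (top_of_set U) V" by (rule openin_subset_trans[OF assms(2,3) chart_subset[OF assms(1)]])
  then have "openin (top_of_set (coord_map u v ` U)) (coord_map u v ` V)"
    by (rule homeomorphism_imp_open_map[OF chart_homeomorphism[OF assms(1)]])
  then show ?thesis using openin_open_trans chart_open[OF assms(1)] by blast
qed

text \<open>On the image of \<open>U \<inter> U' \<inter> V\<close>, an open set around the
  coordinates of \<open>p\<close>, both local inverses return the same point. All chart independence
  rests on this.\<close>

lemma local_expr_cong_near:
  assumes U: "chart_domain S u v U" "chart_domain S u v U'" and p: "p \<in> U" "p \<in> U'"
    and V: "openin (top_of_set S) V" "p \<in> V" "\<forall>q\<in>V. F q = G q"
  shows "\<exists>T. open T \<and> coord_map u v p \<in> T \<and> T \<subseteq> coord_map u v ` U \<and> T \<subseteq> coord_map u v ` U' \<and>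
     (\<forall>z\<in>T. local_expr u v U F z = local_expr u v U' G z)"
proof (intro exI conjI ballI)
  let ?T = "coord_map u v ` (U \<inter> U' \<inter> V)"
  show "open ?T"
    by (rule chart_open_image[OF U(1)]) (use U V chart_openin in blast)+
  show "coord_map u v p \<in> ?T" "?T \<subseteq> coord_map u v ` U" "?T \<subseteq> coord_map u v ` U'" using p V(2) by auto
  show "local_expr u v U F z = local_expr u v U' G z" if "z \<in> ?T" for z
    using that U V(3) by (auto simp: local_expr_def)
qed

text \<open>Relational companion of the definite description \<open>diff_at\<close>, which also
  asserts that the derivative exists. One chart suffices, since the derivative is the same in all
  charts through \<open>p\<close>.\<close>

definition has_diff ::
  "'a::t2_space set \<Rightarrow> ('a \<Rightarrow> real) \<Rightarrow> ('a \<Rightarrow> real) \<Rightarrow> ('a \<Rightarrow> 'b::real_normed_vector) \<Rightarrow>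
     (real^2 \<Rightarrow> 'b) \<Rightarrow> 'a \<Rightarrow> bool" where
  "has_diff S u v F D p \<longleftrightarrow>
     (\<exists>U. p \<in> U \<and> chart_domain S u v U \<and> (local_expr u v U F has_derivative D) (at (coord_map u v p)))"

lemma has_diff_local_expr:
  assumes "has_diff S u v F D p" "chart_domain S u v U" "p \<in> U"
  shows "(local_expr u v U F has_derivative D) (at (coord_map u v p))"
proof -
  obtain U' where U': "p \<in> U'" "chart_domain S u v U'" "(local_expr u v U' F has_derivative D) (at (coord_map u v p))"
    using assms(1) unfolding has_diff_def by blast
  from local_expr_cong_near[OF U'(2) assms(2) U'(1) assms(3) chart_openin[OF assms(2)] assms(3) ballI[OF refl], of F]
  obtain T where T: "open T" "coord_map u v p \<in> T" "\<forall>z\<in>T. local_expr u v U' F z = local_expr u v U F z"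
    by (elim exE conjE)
  show ?thesis
    by (rule has_derivative_transform_within_open[OF U'(3) T(1,2)]) (use T(3) in blast)
qed

lemma has_diff_cong:
  assumes F: "has_diff S u v F D p" and V: "openin (top_of_set S) V" "p \<in> V" "\<forall>q\<in>V. F q = G q"
  shows "has_diff S u v G D p"
proof -
  obtain U where U: "p \<in> U" "chart_domain S u v U" "(local_expr u v U F has_derivative D) (at (coord_map u v p))"
    using assms(1) unfolding has_diff_def by blast
  from local_expr_cong_near[where F=F and G=G, OF U(2,2,1,1) V]
  obtain T where T: "open T" "coord_map u v p \<in> T" "\<forall>z\<in>T. local_expr u v U F z = local_expr u v U G z"
    by (elim exE conjE)
  have "(local_expr u v U G has_derivative D) (at (coord_map u v p))"
    by (rule has_derivative_transform_within_open[OF U(3) T(1,2)]) (use T(3) in blast)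
  then show ?thesis using U unfolding has_diff_def by blast
qed

text \<open>Local expressions in two charts through \<open>p\<close> agree near its coordinates, so
  all candidates in the definite description coincide.\<close>

lemma diff_at_chart:
  assumes "chart_domain S u v U" "p \<in> U"
  shows "diff_at S u v F p X = frechet_derivative (local_expr u v U F) (at (coord_map u v p)) X"
  unfolding diff_at_def
proof (rule the_equality)
  fix d assume "\<exists>U. p \<in> U \<and> chart_domain S u v U \<and> d = frechet_derivative (local_expr u v U F) (at (coord_map u v p)) X"
  then obtain U' where U': "p \<in> U'" "chart_domain S u v U'" "d = frechet_derivative (local_expr u v U' F) (at (coord_map u v p)) X"
    by blast
  from local_expr_cong_near[OF U'(2) assms(1) U'(1) assms(2) chart_openin[OF assms(1)] assms(2) ballI[OF refl], of F]
  obtain T where T: "open T" "coord_map u v p \<in> T" "\<forall>z\<in>T. local_expr u v U' F z = local_expr u v U F z"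
    by (elim exE conjE)
  have "frechet_derivative (local_expr u v U' F) (at (coord_map u v p)) = frechet_derivative (local_expr u v U F) (at (coord_map u v p))"
    by (rule frechet_derivative_cong_open[OF T(1,2)]) (use T(3) in blast)
  then show "d = frechet_derivative (local_expr u v U F) (at (coord_map u v p)) X"
    unfolding U'(3) by simp
qed (use assms in blast)

lemma has_diff_imp_diff_at: "has_diff S u v F D p \<Longrightarrow> diff_at S u v F p = D"
  unfolding has_diff_def by (auto intro!: ext simp: diff_at_chart frechet_derivative_at[symmetric])

lemma diff_at_cong:
  assumes "chart_domain S u v U" "p \<in> U" and V: "openin (top_of_set S) V" "p \<in> V" "\<forall>q\<in>V. F q = G q"
  shows "diff_at S u v F p = diff_at S u v G p"
proof
  fix X
  from local_expr_cong_near[where F=F and G=G, OF assms(1,1,2,2) V]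
  obtain T where T: "open T" "coord_map u v p \<in> T" "\<forall>z\<in>T. local_expr u v U F z = local_expr u v U G z"
    by (elim exE conjE)
  then have "frechet_derivative (local_expr u v U F) (at (coord_map u v p)) = frechet_derivative (local_expr u v U G) (at (coord_map u v p))"
    by (intro frechet_derivative_cong_open[OF T(1,2)]) auto
  then show "diff_at S u v F p X = diff_at S u v G p X" by (simp add: diff_at_chart[OF assms(1,2)])
qed

section \<open>Smooth maps on the surface\<close>

lemma smooth_map_Ck_on:
  "smooth_map S u v F \<Longrightarrow> chart_domain S u v U \<Longrightarrow> Ck_on n (coord_map u v ` U) (local_expr u v U F)"
  unfolding smooth_map_def by blast

lemma smooth_map_cong:
  assumes "\<And>p. p \<in> S \<Longrightarrow> F p = G p" "smooth_map S u v F"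
  shows "smooth_map S u v G"
  unfolding smooth_map_def
proof (intro allI impI)
  fix U n assume U: "chart_domain S u v U"
  have "local_expr u v U F z = local_expr u v U G z" if "z \<in> coord_map u v ` U" for z
    unfolding local_expr_def using assms(1) chart_subset[OF U] chart_inv_in[OF that] by auto
  then show "Ck_on n (coord_map u v ` U) (local_expr u v U G)"
    using Ck_on_cong[OF chart_open[OF U]] smooth_map_Ck_on[OF assms(2) U] by metis
qed

lemma local_expr_lambda:
  "local_expr u v U (\<lambda>p. c) = (\<lambda>z. c)"
  "local_expr u v U (\<lambda>p. f (F p)) = (\<lambda>z. f (local_expr u v U F z))"
  "local_expr u v U (\<lambda>p. h (F p) (G p)) = (\<lambda>z. h (local_expr u v U F z) (local_expr u v U G z))"
  by (auto simp: local_expr_def)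

lemma smooth_map_const: "smooth_map S u v (\<lambda>p. c)"
  unfolding smooth_map_def local_expr_lambda(1) using Ck_on_const chart_open by blast

lemma smooth_map_bounded_linear:
  assumes "bounded_linear L" "smooth_map S u v F"
  shows "smooth_map S u v (\<lambda>p. L (F p))"
  unfolding smooth_map_def local_expr_lambda(2)[where f=L]
  using Ck_on_bounded_linear[OF chart_open assms(1) smooth_map_Ck_on[OF assms(2)]] by blast

lemma smooth_map_bilinear:
  assumes "bounded_bilinear h" "smooth_map S u v F" "smooth_map S u v G"
  shows "smooth_map S u v (\<lambda>p. h (F p) (G p))"
  unfolding smooth_map_def local_expr_lambda(3)[where h=h]
  using Ck_on_bilinear[OF chart_open assms(1) smooth_map_Ck_on[OF assms(2)] smooth_map_Ck_on[OF assms(3)]] by blast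

lemma smooth_map_add:
  assumes "smooth_map S u v F" "smooth_map S u v G"
  shows "smooth_map S u v (\<lambda>p. F p + G p)"
  unfolding smooth_map_def local_expr_lambda(3)[where h="(+)"]
  using Ck_on_add[OF chart_open smooth_map_Ck_on[OF assms(1)] smooth_map_Ck_on[OF assms(2)]] by blast

lemma smooth_map_minus: "smooth_map S u v F \<Longrightarrow> smooth_map S u v (\<lambda>p. - F p)"
  by (rule smooth_map_bounded_linear[OF bounded_linear_minus[OF bounded_linear_ident]])

lemma smooth_map_diff:
  assumes "smooth_map S u v F" "smooth_map S u v G"
  shows "smooth_map S u v (\<lambda>p. F p - G p)"
  using smooth_map_add[OF assms(1) smooth_map_minus[OF assms(2)]] by simp

lemmas smooth_map_mult = smooth_map_bilinear[OF bounded_bilinear_mult]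
lemmas smooth_map_scaleR = smooth_map_bilinear[OF bounded_bilinear_scaleR]
lemmas smooth_map_inner = smooth_map_bilinear[OF bounded_bilinear_inner]

lemma local_expr_range: "chart_domain S u v U \<Longrightarrow> z \<in> coord_map u v ` U \<Longrightarrow> \<exists>p\<in>S. p \<in> U \<and> coord_map u v p = z \<and> local_expr u v U F z = F p"
  unfolding local_expr_def using chart_subset by fastforce

lemma smooth_map_inverse:
  fixes F :: "'a::t2_space \<Rightarrow> real"
  assumes "smooth_map S u v F" "\<And>p. p \<in> S \<Longrightarrow> F p \<noteq> 0"
  shows "smooth_map S u v (\<lambda>p. inverse (F p))"
  unfolding smooth_map_def local_expr_lambda(2)[where f=inverse]
proof (intro allI impI)
  fix U n assume U: "chart_domain S u v U"
  show "Ck_on n (coord_map u v ` U) (\<lambda>z. inverse (local_expr u v U F z))"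
    by (rule Ck_on_inverse[OF chart_open[OF U] _ smooth_map_Ck_on[OF assms(1) U]])
      (use local_expr_range[OF U] assms(2) in metis)
qed

lemma smooth_map_sqrt:
  fixes F :: "'a::t2_space \<Rightarrow> real"
  assumes "smooth_map S u v F" "\<And>p. p \<in> S \<Longrightarrow> F p > 0"
  shows "smooth_map S u v (\<lambda>p. sqrt (F p))"
  unfolding smooth_map_def local_expr_lambda(2)[where f=sqrt]
proof (intro allI impI)
  fix U n assume U: "chart_domain S u v U"
  show "Ck_on n (coord_map u v ` U) (\<lambda>z. sqrt (local_expr u v U F z))"
    by (rule Ck_on_sqrt[OF chart_open[OF U] _ smooth_map_Ck_on[OF assms(1) U]])
      (use local_expr_range[OF U] assms(2) in metis)
qed

lemma smooth_map_exp:
  fixes F :: "'a::t2_space \<Rightarrow> real"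
  assumes "smooth_map S u v F"
  shows "smooth_map S u v (\<lambda>p. exp (F p))"
  unfolding smooth_map_def local_expr_lambda(2)[where f=exp]
  using Ck_on_exp[OF chart_open smooth_map_Ck_on[OF assms]] by blast

section \<open>Rules of differentiation\<close>

lemma has_diff_const: "coordinates_on S u v \<Longrightarrow> p \<in> S \<Longrightarrow> has_diff S u v (\<lambda>p. c) (\<lambda>w. 0) p"
  unfolding has_diff_def coordinates_on_def local_expr_lambda(1) by force

lemma has_diff_bounded_linear:
  assumes "bounded_linear L" "has_diff S u v F D p"
  shows "has_diff S u v (\<lambda>p. L (F p)) (\<lambda>w. L (D w)) p"
  using assms unfolding has_diff_def local_expr_lambda(2)[where f=L]
  using bounded_linear.has_derivative[OF assms(1)] by blast

lemma has_diff_bilinear: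
  assumes "bounded_bilinear h" "has_diff S u v F D p" "has_diff S u v G E p"
  shows "has_diff S u v (\<lambda>p. h (F p) (G p)) (\<lambda>w. h (F p) (E w) + h (D w) (G p)) p"
proof -
  obtain U where U: "p \<in> U" "chart_domain S u v U" using assms(2) unfolding has_diff_def by blast
  then show ?thesis
    using bounded_bilinear.FDERIV[OF assms(1) has_diff_local_expr[OF assms(2) U(2,1)] has_diff_local_expr[OF assms(3) U(2,1)]] U
    unfolding has_diff_def local_expr_lambda(3)[where h=h]
    by (intro exI[of _ U]) (auto simp: local_expr_def)
qed

lemma has_diff_add:
  assumes "has_diff S u v F D p" "has_diff S u v G E p"
  shows "has_diff S u v (\<lambda>p. F p + G p) (\<lambda>w. D w + E w) p"
proof -
  obtain U where U: "p \<in> U" "chart_domain S u v U" using assms(1) unfolding has_diff_def by blast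
  then show ?thesis
    using has_derivative_add[OF has_diff_local_expr[OF assms(1) U(2,1)] has_diff_local_expr[OF assms(2) U(2,1)]]
    unfolding has_diff_def local_expr_lambda(3)[where h="(+)"] by blast
qed

lemma has_diff_minus: "has_diff S u v F D p \<Longrightarrow> has_diff S u v (\<lambda>p. - F p) (\<lambda>w. - D w) p"
  by (rule has_diff_bounded_linear[OF bounded_linear_minus[OF bounded_linear_ident]])

lemma has_diff_real:
  assumes "has_diff S u v F D p" "(\<phi> has_real_derivative c) (at (F p))"
  shows "has_diff S u v (\<lambda>p. \<phi> (F p)) (\<lambda>w. D w * c) p"
proof -
  obtain U where U: "p \<in> U" "chart_domain S u v U" using assms(1) unfolding has_diff_def by blast
  then have "(\<phi> has_real_derivative c) (at (local_expr u v U F (coord_map u v p)))"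
    using assms(2) by (simp add: local_expr_def)
  from DERIV_compose_FDERIV[OF this has_diff_local_expr[OF assms(1) U(2,1)]] U
  show ?thesis unfolding has_diff_def local_expr_lambda(2)[where f=\<phi>] by blast
qed

lemma has_diff_linear: "has_diff S u v F D p \<Longrightarrow> linear D"
  unfolding has_diff_def using has_derivative_linear by blast

lemma smooth_has_diff:
  assumes "coordinates_on S u v" "smooth_map S u v F" "p \<in> S"
  shows "has_diff S u v F (diff_at S u v F p) p"
proof -
  obtain U where U: "p \<in> U" "chart_domain S u v U" using assms(1,3) unfolding coordinates_on_def by blast
  have "(local_expr u v U F has_derivative frechet_derivative (local_expr u v U F) (at (coord_map u v p))) (at (coord_map u v p))"
    by (rule Ck_on_Suc_has_derivative[OF chart_open[OF U(2)] smooth_map_Ck_on[OF assms(2) U(2), of "Suc 0"]]) (use U in blast)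
  moreover have "frechet_derivative (local_expr u v U F) (at (coord_map u v p)) = diff_at S u v F p"
    by (rule ext) (simp add: diff_at_chart[OF U(2,1)])
  ultimately show ?thesis unfolding has_diff_def using U by metis
qed

lemma local_expr_diff_at:
  assumes "chart_domain S u v U" "z \<in> coord_map u v ` U"
  shows "local_expr u v U (\<lambda>p. diff_at S u v F p w) z = frechet_derivative (local_expr u v U F) (at z) w"
  using assms by (auto simp: local_expr_def diff_at_chart)

lemma smooth_map_diff_at:
  assumes "smooth_map S u v F"
  shows "smooth_map S u v (\<lambda>p. diff_at S u v F p w)"
  unfolding smooth_map_def
proof (intro allI impI)
  fix U n assume U: "chart_domain S u v U"
  show "Ck_on n (coord_map u v ` U) (local_expr u v U (\<lambda>p. diff_at S u v F p w))"
    by (rule iffD2[OF Ck_on_cong[OF chart_open[OF U] local_expr_diff_at[OF U]]])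
      (assumption, rule Ck_on_SucD[OF smooth_map_Ck_on[OF assms U]])
qed

lemma diff_at_commute:
  fixes F :: "'a::t2_space \<Rightarrow> 'b::euclidean_space"
  assumes "coordinates_on S u v" "smooth_map S u v F" "p \<in> S"
  shows "diff_at S u v (\<lambda>p. diff_at S u v F p w) p w' = diff_at S u v (\<lambda>p. diff_at S u v F p w') p w"
proof -
  obtain U where U: "p \<in> U" "chart_domain S u v U" using assms(1,3) unfolding coordinates_on_def by blast
  let ?f = "local_expr u v U F"
  have z: "coord_map u v p \<in> coord_map u v ` U" using U by blast
  have "diff_at S u v (\<lambda>p. diff_at S u v F p w) p w' = frechet_derivative (\<lambda>z. frechet_derivative ?f (at z) w) (at (coord_map u v p)) w'" for w w'
    unfolding diff_at_chart[OF U(2,1), of "\<lambda>p. diff_at S u v F p w"]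
    by (rule fun_cong[OF frechet_derivative_cong_open[OF chart_open[OF U(2)] z local_expr_diff_at[OF U(2)]]])
  then show ?thesis
    using frechet_derivative_commute[OF chart_open[OF U(2)] smooth_map_Ck_on[OF assms(2) U(2)] z] by metis
qed

text \<open>Coordinate balls are convex, so a map with zero derivative is constant on each of them;
  connectedness does the rest.\<close>

lemma has_diff_zero_constant:
  assumes "coordinates_on S u v" "connected S" "\<And>p. p \<in> S \<Longrightarrow> has_diff S u v F (\<lambda>w. 0) p" "p \<in> S" "q \<in> S"
  shows "F p = F q"
proof -
  have "F constant_on S"
  proof (rule locally_constant_imp_constant[OF assms(2)])
    fix a assume a: "a \<in> S"
    then obtain U where U: "a \<in> U" "chart_domain S u v U" using assms(1) unfolding coordinates_on_def by blast
    obtain r where r: "r > 0" "ball (coord_map u v a) r \<subseteq> coord_map u v ` U"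
      using openE[OF chart_open[OF U(2)], of "coord_map u v a"] U(1) by blast
    let ?B = "ball (coord_map u v a) r"
    have "\<exists>c. \<forall>z\<in>?B. local_expr u v U F z = c"
    proof (rule has_derivative_zero_constant)
      fix z assume "z \<in> ?B"
      then obtain q where q: "q \<in> U" "z = coord_map u v q" using r by blast
      show "(local_expr u v U F has_derivative (\<lambda>h. 0)) (at z within ?B)"
        unfolding q(2) by (rule has_derivative_at_withinI[OF has_diff_local_expr[OF assms(3) U(2) q(1)]])
          (use q chart_subset[OF U(2)] in blast)
    qed auto
    then obtain c where c: "\<And>z. z \<in> ?B \<Longrightarrow> local_expr u v U F z = c" by blast
    have Fc: "F q = c" if "q \<in> U" "coord_map u v q \<in> ?B" for q
      using c[OF that(2)] U that(1) by (simp add: local_expr_def)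
    have "openin (top_of_set U) (U \<inter> coord_map u v -` ?B)"
      using continuous_openin_preimage_gen[OF chart_continuous_coord[OF U(2)] open_ball] .
    then have "openin (top_of_set S) (U \<inter> coord_map u v -` ?B)" using chart_openin[OF U(2)] openin_trans by blast
    then show "\<exists>T. openin (top_of_set S) T \<and> a \<in> T \<and> (\<forall>x\<in>T. F x = F a)"
      using Fc U(1) r(1) by (intro exI[of _ "U \<inter> coord_map u v -` ?B"]) auto
  qed
  then show ?thesis using assms(4,5) unfolding constant_on_def by auto
qed

section \<open>Flat linear systems on a simply connected surface\<close>

lemma vec2_decomp: "(w::real^2) = w $ 1 *\<^sub>R axis 1 1 + w $ 2 *\<^sub>R axis 2 1"
  by (simp add: vec_eq_iff forall_2 axis_def)

lemma linear_vec2: "linear D \<Longrightarrow> D (w::real^2) = w $ 1 *\<^sub>R D (axis 1 1) + w $ 2 *\<^sub>R D (axis 2 1)"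
  by (subst vec2_decomp) (simp only: linear_add linear_cmul)

text \<open>The system \<open>F\<^sub>u = bl \<alpha> F\<close>,
  \<open>F\<^sub>v = bl \<beta> F\<close>. The assumption \<open>flat\<close> equates its two formal
  second derivatives at an arbitrary value \<open>x\<close>: differentiating
  \<open>bl \<alpha> F\<close> in \<open>v\<close> lets \<open>\<beta>\<close> act before
  \<open>\<alpha>\<close>, which fixes the order of the products.\<close>

locale surface_system =
  fixes S :: "'a::t2_space set" and u v :: "'a \<Rightarrow> real"
    and bl :: "'w::real_normed_vector \<Rightarrow> 'v::euclidean_space \<Rightarrow> 'v" and \<alpha> \<beta> :: "'a \<Rightarrow> 'w"
  assumes coords: "coordinates_on S u v" and bl: "bounded_bilinear bl"
    and smooth: "smooth_map S u v \<alpha>" "smooth_map S u v \<beta>"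
    and flat: "\<And>p x. p \<in> S \<Longrightarrow>
      bl (diff_at S u v \<alpha> p (axis 2 1)) x + bl (\<alpha> p) (bl (\<beta> p) x) =
      bl (diff_at S u v \<beta> p (axis 1 1)) x + bl (\<beta> p) (bl (\<alpha> p) x)"
begin

definition form :: "'a \<Rightarrow> real^2 \<Rightarrow> 'w" where
  "form p w = w $ 1 *\<^sub>R \<alpha> p + w $ 2 *\<^sub>R \<beta> p"

definition sol :: "'a set \<Rightarrow> ('a \<Rightarrow> 'v) \<Rightarrow> bool" where
  "sol U F \<longleftrightarrow> (\<forall>p\<in>U. has_diff S u v F (\<lambda>w. bl (form p w) (F p)) p)"

definition local_form :: "'a set \<Rightarrow> real^2 \<Rightarrow> real^2 \<Rightarrow> 'w" where
  "local_form U z w = w $ 1 *\<^sub>R local_expr u v U \<alpha> z + w $ 2 *\<^sub>R local_expr u v U \<beta> z"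

lemma local_form_coord: "chart_domain S u v U \<Longrightarrow> p \<in> U \<Longrightarrow> local_form U (coord_map u v p) w = form p w"
  by (simp add: local_form_def form_def local_expr_def)

lemma Ck_on_local_form: "chart_domain S u v U \<Longrightarrow> Ck_on n (coord_map u v ` U) (\<lambda>z. local_form U z w)"
  unfolding local_form_def
  by (intro Ck_on_add Ck_on_scaleR chart_open Ck_on_const smooth_map_Ck_on[OF smooth(1)] smooth_map_Ck_on[OF smooth(2)])

text \<open>The difference of the two sides is bilinear and skew in \<open>w\<close> and
  \<open>h\<close>, so flatness in the two coordinate directions gives it in all directions.\<close>

lemma local_flat:
  assumes U: "chart_domain S u v U" and z: "z \<in> coord_map u v ` U"
  shows "bl (frechet_derivative (\<lambda>z. local_form U z w) (at z) h) x + bl (local_form U z w) (bl (local_form U z h) x) =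
    bl (frechet_derivative (\<lambda>z. local_form U z h) (at z) w) x + bl (local_form U z h) (bl (local_form U z w) x)"
proof -
  obtain p where p: "p \<in> U" "z = coord_map u v p" using z by blast
  have pS: "p \<in> S" using p chart_subset[OF U] by blast
  let ?A = "diff_at S u v \<alpha> p" let ?B = "diff_at S u v \<beta> p"
  have A: "has_diff S u v \<alpha> ?A p" and B: "has_diff S u v \<beta> ?B p"
    using smooth_has_diff[OF coords _ pS] smooth by blast+
  have fd: "frechet_derivative (\<lambda>z. local_form U z w) (at z) h = w $ 1 *\<^sub>R ?A h + w $ 2 *\<^sub>R ?B h" for w h
  proof -
    have "((\<lambda>z. local_form U z w) has_derivative (\<lambda>h. w $ 1 *\<^sub>R ?A h + w $ 2 *\<^sub>R ?B h)) (at z)"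
      unfolding local_form_def p(2)
      by (rule has_derivative_add[OF has_derivative_scaleR_right has_derivative_scaleR_right,
            OF has_diff_local_expr[OF A U p(1)] has_diff_local_expr[OF B U p(1)]])
    from frechet_derivative_at[OF this] show ?thesis by metis
  qed
  have lf: "local_form U z w = w $ 1 *\<^sub>R \<alpha> p + w $ 2 *\<^sub>R \<beta> p" for w
    using local_form_coord[OF U p(1), of w] p(2) by (simp add: form_def)
  have Al: "?A h = h $ 1 *\<^sub>R ?A (axis 1 1) + h $ 2 *\<^sub>R ?A (axis 2 1)" for h
    by (rule linear_vec2[OF has_diff_linear[OF A]])
  have Bl: "?B h = h $ 1 *\<^sub>R ?B (axis 1 1) + h $ 2 *\<^sub>R ?B (axis 2 1)" for h
    by (rule linear_vec2[OF has_diff_linear[OF B]])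
  define A1 A2 B1 B2 where d: "A1 = ?A (axis 1 1)" "A2 = ?A (axis 2 1)" "B1 = ?B (axis 1 1)" "B2 = ?B (axis 2 1)"
  have e: "bl A2 x = bl B1 x + bl (\<beta> p) (bl (\<alpha> p) x) - bl (\<alpha> p) (bl (\<beta> p) x)"
    using flat[OF pS, of x] by (simp add: d algebra_simps)
  show ?thesis
    unfolding fd lf Al[of h] Al[of w] Bl[of h] Bl[of w] d[symmetric]
    by (simp add: bounded_bilinear.add_left[OF bl] bounded_bilinear.add_right[OF bl]
        bounded_bilinear.scaleR_left[OF bl] bounded_bilinear.scaleR_right[OF bl] scaleR_add_right scaleR_diff_right e)
      (simp add: algebra_simps)
qed

lemma local_system:
  assumes p: "p \<in> S"
  shows "\<exists>U r M. p \<in> U \<and> chart_domain S u v U \<and> r > 0 \<and> ball (coord_map u v p) r \<subseteq> coord_map u v ` U \<and>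
    linear_system bl (ball (coord_map u v p) r) (local_form U) \<and> 0 \<le> M \<and> M * (2 * r) \<le> 1/8 \<and>
    (\<forall>z\<in>ball (coord_map u v p) r. \<forall>w x. norm (bl (local_form U z w) x) \<le> M * norm w * norm x)"
proof -
  obtain U where U: "p \<in> U" "chart_domain S u v U" using coords p unfolding coordinates_on_def by blast
  let ?X = "coord_map u v" let ?a = "local_expr u v U \<alpha>" let ?b = "local_expr u v U \<beta>"
  obtain r0 where r0: "r0 > 0" "cball (?X p) r0 \<subseteq> ?X ` U"
    using chart_open[OF U(2)] U(1) unfolding open_contains_cball by blast
  have ca: "continuous_on (cball (?X p) r0) ?a" "continuous_on (cball (?X p) r0) ?b"
    using continuous_on_subset[OF Ck_on_imp_continuous_on[OF smooth_map_Ck_on[OF smooth(1) U(2), of 0]] r0(2)]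
      continuous_on_subset[OF Ck_on_imp_continuous_on[OF smooth_map_Ck_on[OF smooth(2) U(2), of 0]] r0(2)] by auto
  have "bounded (?a ` cball (?X p) r0)" "bounded (?b ` cball (?X p) r0)"
    by (rule compact_imp_bounded[OF compact_continuous_image[OF ca(1) compact_cball]]
        compact_imp_bounded[OF compact_continuous_image[OF ca(2) compact_cball]])+
  then obtain c1 c2 where "\<forall>z\<in>cball (?X p) r0. norm (?a z) \<le> c1" "\<forall>z\<in>cball (?X p) r0. norm (?b z) \<le> c2"
    unfolding bounded_iff ball_simps by blast
  then have c: "norm (?a z) \<le> c1" "norm (?b z) \<le> c2" if "z \<in> cball (?X p) r0" for z using that by blast+
  have c0: "0 \<le> c1" "0 \<le> c2"
    using order_trans[OF norm_ge_zero c(1)[of "?X p"]] order_trans[OF norm_ge_zero c(2)[of "?X p"]] r0(1) by auto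
  obtain K where K: "K > 0" "\<And>a x. norm (bl a x) \<le> norm a * norm x * K" using bounded_bilinear.pos_bounded[OF bl] by blast
  define M where "M = (c1 + c2) * K"
  have M: "0 \<le> M" using c0 K by (simp add: M_def)
  \<comment> \<open>\<open>2 * r\<close> bounds the distance between any two points of the ball, so
    that each of them can serve as base point of the Picard iteration. \<open>M + 1\<close> avoids a
    division by zero.\<close>
  define r where "r = min r0 (1 / (16 * (M + 1)))"
  have r: "r > 0" "r \<le> r0" using r0 M by (auto simp: r_def)
  have "M * (2 * r) \<le> (M + 1) * (2 * (1 / (16 * (M + 1))))"
    by (intro mult_mono) (use M r in \<open>auto simp: r_def\<close>)
  also have "\<dots> = 1/8" using M by simp
  finally have Mr: "M * (2 * r) \<le> 1/8" .
  have sub: "ball (?X p) r \<subseteq> ?X ` U" using r r0 by force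
  have bound: "norm (bl (local_form U z w) x) \<le> M * norm w * norm x" if "z \<in> ball (?X p) r" for z w x
  proof -
    have z: "z \<in> cball (?X p) r0" using that r by auto
    have "norm (local_form U z w) \<le> \<bar>w $ 1\<bar> * norm (?a z) + \<bar>w $ 2\<bar> * norm (?b z)"
      unfolding local_form_def by (intro norm_triangle_mono) auto
    also have "\<dots> \<le> norm w * c1 + norm w * c2"
      by (intro add_mono mult_mono c z component_le_norm_cart) auto
    finally have "norm (local_form U z w) \<le> (c1 + c2) * norm w" by (simp add: algebra_simps)
    then have "norm (local_form U z w) * norm x * K \<le> (c1 + c2) * norm w * norm x * K"
      by (intro mult_right_mono) (use K in auto)
    with K(2)[of "local_form U z w" x] show ?thesis by (simp add: M_def algebra_simps)
  qed
  have "linear_system bl (ball (?X p) r) (local_form U)"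
  proof (rule linear_system.intro)
    show "linear (local_form U z)" for z
      by (rule linearI) (simp_all add: local_form_def algebra_simps)
    show "Ck_on n (ball (?X p) r) (\<lambda>z. local_form U z w)" for n w
      by (rule Ck_on_subset[OF chart_open[OF U(2)] open_ball sub Ck_on_local_form[OF U(2)]])
  qed (auto intro: bl)
  then show ?thesis using U r Mr M bound sub by blast
qed

lemma sol_local_expr:
  assumes "sol V F" "chart_domain S u v U" "z \<in> coord_map u v ` (U \<inter> V)"
  shows "(local_expr u v U F has_derivative (\<lambda>w. bl (local_form U z w) (local_expr u v U F z))) (at z)"
proof -
  obtain q where q: "q \<in> U" "q \<in> V" "z = coord_map u v q" using assms(3) by blast
  have "has_diff S u v F (\<lambda>w. bl (form q w) (F q)) q" using assms(1) q(2) unfolding sol_def by blast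
  from has_diff_local_expr[OF this assms(2) q(1)] show ?thesis
    using assms(2) q by (simp add: local_form_coord) (simp add: local_expr_def)
qed

sublocale local_solutions S sol
proof
  fix p assume p: "p \<in> S"
  let ?X = "coord_map u v"
  obtain U r M where U: "p \<in> U" "chart_domain S u v U" and r: "r > 0" "ball (?X p) r \<subseteq> ?X ` U"
    and ls: "linear_system bl (ball (?X p) r) (local_form U)" and M: "0 \<le> M" "M * (2 * r) \<le> 1/8"
    "\<And>z w x. z \<in> ball (?X p) r \<Longrightarrow> norm (bl (local_form U z w) x) \<le> M * norm w * norm x"
    using local_system[OF p] by blast
  interpret linear_system bl "ball (?X p) r" "local_form U" by (rule ls)
  let ?V = "U \<inter> ?X -` ball (?X p) r"
  have "openin (top_of_set U) ?V"
    using continuous_openin_preimage_gen[OF chart_continuous_coord[OF U(2)] open_ball] .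
  then have op: "openin (top_of_set S) ?V" using chart_openin[OF U(2)] openin_trans by blast
  \<comment> \<open>The neighbourhood is the image of a coordinate ball under the local inverse,
    hence path connected.\<close>
  have img: "?V = inv_into U ?X ` ball (?X p) r"
  proof (intro subset_antisym subsetI)
    fix q assume "q \<in> ?V"
    then show "q \<in> inv_into U ?X ` ball (?X p) r"
      by (intro image_eqI[of _ _ "?X q"]) (use U(2) in auto)
  next
    fix q assume "q \<in> inv_into U ?X ` ball (?X p) r"
    then obtain z where z: "z \<in> ball (?X p) r" "q = inv_into U ?X z" by blast
    have zU: "z \<in> ?X ` U" using z(1) r(2) by blast
    show "q \<in> ?V" using z chart_inv_in[OF zU] chart_coord_inv[OF zU] by simp
  qed
  have pc: "path_connected ?V" unfolding img
    by (rule path_connected_continuous_image[OF continuous_on_subset[OF chart_continuous_inv[OF U(2)] r(2)]])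
      (simp add: convex_imp_path_connected)
  have ex: "\<exists>F. sol ?V F \<and> F q = a" if q: "q \<in> ?V" for q a
  proof -
    have "\<exists>\<Phi>. solution \<Phi> \<and> \<Phi> (?X q) = a"
    proof (rule flat_solution_exists[OF _ M(3) M(1) _ M(2)])
      show "norm (z - ?X q) \<le> 2 * r" if "z \<in> ball (?X p) r" for z
      proof -
        have "dist z (?X q) \<le> dist z (?X p) + dist (?X p) (?X q)" by (rule dist_triangle)
        also have "\<dots> \<le> r + r" using that q by (intro add_mono) (auto simp: dist_commute)
        finally show ?thesis by (simp add: dist_norm)
      qed
    qed (use q r local_flat[OF U(2)] in auto)
    then obtain \<Phi> where \<Phi>: "solution \<Phi>" "\<Phi> (?X q) = a" by blast
    have "sol ?V (\<lambda>q. \<Phi> (?X q))"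
      unfolding sol_def
    proof
      fix q assume q: "q \<in> ?V"
      then have "(\<Phi> has_derivative (\<lambda>w. bl (form q w) (\<Phi> (?X q)))) (at (?X q))"
        using \<Phi>(1)[unfolded solution_def, rule_format, of "?X q"] local_form_coord[OF U(2), of q] by simp
      then have "(local_expr u v U (\<lambda>q. \<Phi> (?X q)) has_derivative (\<lambda>w. bl (form q w) (\<Phi> (?X q)))) (at (?X q))"
        by (rule has_derivative_transform_within_open[OF _ chart_open[OF U(2)]])
          (use q in \<open>auto simp: local_expr_def chart_inv[OF U(2)]\<close>)
      then show "has_diff S u v (\<lambda>q. \<Phi> (?X q)) (\<lambda>w. bl (form q w) (\<Phi> (?X q))) q"
        unfolding has_diff_def using q U(2) by blast
    qed
    then show ?thesis using \<Phi>(2) by blast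
  qed
  have "p \<in> ?V" using U(1) r(1) by simp
  then show "\<exists>U. openin (top_of_set S) U \<and> p \<in> U \<and> path_connected U \<and> (\<forall>q\<in>U. \<forall>a. \<exists>F. sol U F \<and> F q = a)"
    using op pc ex by blast
next
  fix V V' F G q
  assume V: "openin (top_of_set S) V" "openin (top_of_set S) V'" and FG: "sol V F" "sol V' G"
    and q: "q \<in> V" "q \<in> V'" "F q = G q"
  let ?X = "coord_map u v"
  have qS: "q \<in> S" using V(1) q(1) openin_imp_subset by blast
  obtain U r M where U: "q \<in> U" "chart_domain S u v U" and r: "r > 0" "ball (?X q) r \<subseteq> ?X ` U"
    and ls: "linear_system bl (ball (?X q) r) (local_form U)" and M: "0 \<le> M" "M * (2 * r) \<le> 1/8"
    "\<And>z w x. z \<in> ball (?X q) r \<Longrightarrow> norm (bl (local_form U z w) x) \<le> M * norm w * norm x"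
    using local_system[OF qS] by blast
  interpret linear_system bl "ball (?X q) r" "local_form U" by (rule ls)
  let ?B = "?X ` (U \<inter> V \<inter> V') \<inter> ball (?X q) r"
  have oB: "open ?B"
    by (intro open_Int chart_open_image[OF U(2)] open_ball openin_Int chart_openin[OF U(2)] V) blast
  have "\<exists>e>0. ball (?X q) e \<subseteq> ?B \<and> (\<forall>z\<in>ball (?X q) e. local_expr u v U F z = local_expr u v U G z)"
  proof (rule solutions_agree_near[OF M(3) _ _ oB])
    show "(local_expr u v U F has_derivative (\<lambda>w. bl (local_form U z w) (local_expr u v U F z))) (at z)" if "z \<in> ?B" for z
      by (rule sol_local_expr[OF FG(1) U(2)]) (use that in blast)
    show "(local_expr u v U G has_derivative (\<lambda>w. bl (local_form U z w) (local_expr u v U G z))) (at z)" if "z \<in> ?B" for z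
      by (rule sol_local_expr[OF FG(2) U(2)]) (use that in blast)
  qed (use q r U in \<open>auto simp: local_expr_def\<close>)
  then obtain e where e: "e > 0" "ball (?X q) e \<subseteq> ?B" "\<And>z. z \<in> ball (?X q) e \<Longrightarrow> local_expr u v U F z = local_expr u v U G z"
    by blast
  let ?W = "U \<inter> V \<inter> V' \<inter> (U \<inter> ?X -` ball (?X q) e)"
  have "openin (top_of_set U) (U \<inter> ?X -` ball (?X q) e)"
    using continuous_openin_preimage_gen[OF chart_continuous_coord[OF U(2)] open_ball] .
  then have "openin (top_of_set S) (U \<inter> ?X -` ball (?X q) e)" using chart_openin[OF U(2)] openin_trans by blast
  then have "openin (top_of_set S) ?W"
    by (rule openin_Int[OF openin_Int[OF openin_Int[OF chart_openin[OF U(2)] V(1)] V(2)]])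
  moreover have "F x = G x" if "x \<in> ?W" for x
    using e(3)[of "?X x"] that U(2) by (simp add: local_expr_def)
  ultimately show "\<exists>W. openin (top_of_set S) W \<and> q \<in> W \<and> W \<subseteq> V \<inter> V' \<and> (\<forall>x\<in>W. F x = G x)"
    using q U(1) e(1) by (intro exI[of _ ?W]) auto
next
  fix V F assume V: "openin (top_of_set S) V" and F: "sol V F"
  show "continuous_on V F"
    unfolding continuous_on_def
  proof
    fix p assume p: "p \<in> V"
    then have "p \<in> S" using V openin_imp_subset by blast
    then obtain U where U: "p \<in> U" "chart_domain S u v U" using coords unfolding coordinates_on_def by blast
    let ?f = "local_expr u v U F"
    have "isCont ?f (coord_map u v p)"
      by (rule has_derivative_continuous[OF sol_local_expr[OF F U(2)]]) (use p U in blast)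
    moreover have "(coord_map u v \<longlongrightarrow> coord_map u v p) (at p within U)"
      using chart_continuous_coord[OF U(2)] U(1) by (simp add: continuous_on_def)
    ultimately have "((\<lambda>q. ?f (coord_map u v q)) \<longlongrightarrow> ?f (coord_map u v p)) (at p within U)"
      by (rule isCont_tendsto_compose)
    moreover have "?f (coord_map u v q) = F q" if "q \<in> U" for q using U(2) that by (simp add: local_expr_def)
    ultimately have "(F \<longlongrightarrow> F p) (at p within U)"
      using U(1) by (auto elim!: Lim_transform_eventually simp: eventually_at_filter)
    moreover have "at p within U = at p within V"
    proof -
      obtain T T' where "open T" "U = S \<inter> T" "open T'" "V = S \<inter> T'"
        using chart_openin[OF U(2)] V by (auto simp: openin_open)
      then show ?thesis using at_within_nhd[of p "T \<inter> T'" U V] p U(1) by auto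
    qed
    ultimately show "(F \<longlongrightarrow> F p) (at p within V)" by simp
  qed
qed

text \<open>Bootstrapping: the derivative of \<open>F\<close> is a smooth form applied to
  \<open>F\<close>, so each order of regularity of \<open>F\<close> yields the next.\<close>

lemma sol_smooth:
  assumes "sol S F"
  shows "smooth_map S u v F"
  unfolding smooth_map_def
proof (intro allI impI)
  fix U n assume U: "chart_domain S u v U"
  show "Ck_on n (coord_map u v ` U) (local_expr u v U F)"
  proof (induction n)
    case 0
    have "U \<inter> S = U" using chart_subset[OF U] by blast
    then have "isCont (local_expr u v U F) z" if "z \<in> coord_map u v ` U" for z
      using has_derivative_continuous[OF sol_local_expr[OF assms U]] that by metis
    then show ?case by (simp add: continuous_at_imp_continuous_on)
  next
    case (Suc n)
    show ?case
    proof (rule Ck_on_SucI[OF chart_open[OF U] sol_local_expr[OF assms U]])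
      show "z \<in> coord_map u v ` (U \<inter> S)" if "z \<in> coord_map u v ` U" for z using that chart_subset[OF U] by blast
      show "Ck_on n (coord_map u v ` U) (\<lambda>z. bl (local_form U z w) (local_expr u v U F z))" for w
        by (rule Ck_on_bilinear[OF chart_open[OF U] bl Ck_on_local_form[OF U] Suc.IH])
    qed
  qed
qed

text \<open>The initial condition is an implication because the empty set counts as simply
  connected. In a nonempty set, an arbitrary point replaces a \<open>p0\<close> that lies
  outside.\<close>

theorem solution_exists:
  assumes "simply_connected S"
  shows "\<exists>F. smooth_map S u v F \<and> (\<forall>p\<in>S. has_diff S u v F (\<lambda>w. bl (form p w) (F p)) p) \<and> (p0 \<in> S \<longrightarrow> F p0 = a0)"
proof (cases "S = {}")
  case True
  have "sol S (\<lambda>_. a0)" unfolding sol_def using True by blast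
  from sol_smooth[OF this] show ?thesis using True by (intro exI[of _ "\<lambda>_. a0"]) simp
next
  case False
  have ex: "\<exists>F. sol S F \<and> F q0 = a0" if q0: "q0 \<in> S" for q0
  proof -
    from global_solution_exists[OF assms q0, of a0]
    obtain G where G: "G q0 = a0" "\<forall>p\<in>S. \<exists>U F. openin (top_of_set S) U \<and> p \<in> U \<and> sol U F \<and> (\<forall>q\<in>U. G q = F q)"
      by (elim exE conjE)
    have "sol S G"
      unfolding sol_def
    proof
      fix p assume "p \<in> S"
      with G(2) obtain U F where U: "openin (top_of_set S) U" "p \<in> U" "sol U F" "\<forall>q\<in>U. G q = F q" by meson
      have F: "has_diff S u v F (\<lambda>w. bl (form p w) (F p)) p" using U(2,3) unfolding sol_def by blast
      have "\<forall>q\<in>U. F q = G q" using U(4) by simp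
      from has_diff_cong[OF F U(1,2) this] show "has_diff S u v G (\<lambda>w. bl (form p w) (G p)) p"
        using U(2,4) by simp
    qed
    then show ?thesis using G(1) by blast
  qed
  obtain q0 where "q0 \<in> S" "p0 \<in> S \<longrightarrow> q0 = p0" using False by blast
  moreover from ex[OF this(1)] obtain F where "sol S F" "F q0 = a0" by blast
  ultimately show ?thesis
    using sol_smooth[OF \<open>sol S F\<close>] unfolding sol_def by (intro exI[of _ F]) auto
qed

end

text \<open>An inhomogeneous equation is made linear by one extra real component:
  \<open>bl a (x, t) = (t *\<^sub>R a, 0)\<close>. That component is constant, and started at 1 it
  stays 1, so the first component has differential \<open>\<alpha> du + \<beta> dv\<close>. Products
  of two coefficients vanish, so flatness is just closedness.\<close>

lemma closed_form_primitive:
  fixes \<alpha> \<beta> :: "'a::t2_space \<Rightarrow> 'v::euclidean_space"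
  assumes coords: "coordinates_on S u v" and sc: "simply_connected S"
    and smooth: "smooth_map S u v \<alpha>" "smooth_map S u v \<beta>"
    and closed: "\<And>p. p \<in> S \<Longrightarrow> diff_at S u v \<alpha> p (axis 2 1) = diff_at S u v \<beta> p (axis 1 1)"
  shows "\<exists>F. smooth_map S u v F \<and> (\<forall>p\<in>S. has_diff S u v F (\<lambda>w. w $ 1 *\<^sub>R \<alpha> p + w $ 2 *\<^sub>R \<beta> p) p)"
proof -
  define bl :: "'v \<Rightarrow> 'v \<times> real \<Rightarrow> 'v \<times> real" where "bl a y = (snd y *\<^sub>R a, 0)" for a y
  have bl: "bounded_bilinear bl"
  proof
    show "\<exists>K. \<forall>a y. norm (bl a y) \<le> norm a * norm y * K"
    proof (intro exI[of _ 1] allI)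
      fix a :: 'v and y :: "'v \<times> real"
      have "norm a * norm (snd y) \<le> norm a * norm y" by (intro mult_left_mono) (metis norm_snd_le prod.collapse, simp)
      then show "norm (bl a y) \<le> norm a * norm y * 1" by (simp add: bl_def norm_Pair mult.commute)
    qed
  qed (simp_all add: bl_def algebra_simps)
  interpret surface_system S u v bl \<alpha> \<beta>
    by (rule surface_system.intro[OF coords bl smooth]) (simp add: closed, simp add: bl_def)
  show ?thesis
  proof (cases "S = {}")
    case True
    have "smooth_map S u v (\<lambda>_. 0 :: 'v)" by (rule smooth_map_const)
    then show ?thesis using True by blast
  next
    case False
    then obtain p0 where p0: "p0 \<in> S" by blast
    obtain F where F: "smooth_map S u v F" "\<And>p. p \<in> S \<Longrightarrow> has_diff S u v F (\<lambda>w. bl (form p w) (F p)) p" "F p0 = (0, 1)"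
      using solution_exists[OF sc, of p0 "(0, 1)"] p0 by blast
    have "has_diff S u v (\<lambda>p. snd (F p)) (\<lambda>w. 0) p" if "p \<in> S" for p
      using has_diff_bounded_linear[OF bounded_linear_snd F(2)[OF that]] by (simp add: bl_def)
    from has_diff_zero_constant[OF coords path_connected_imp_connected[OF simply_connected_path_connected[OF sc]] this _ p0]
    have "snd (F p) = 1" if "p \<in> S" for p using that F(3) by simp
    then have "has_diff S u v (\<lambda>p. fst (F p)) (\<lambda>w. w $ 1 *\<^sub>R \<alpha> p + w $ 2 *\<^sub>R \<beta> p) p" if "p \<in> S" for p
      using has_diff_bounded_linear[OF bounded_linear_fst F(2)[OF that]] that by (simp add: bl_def form_def)
    then show ?thesis using smooth_map_bounded_linear[OF bounded_linear_fst F(1)] by blast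
  qed
qed

section \<open>Adapted frames\<close>

lemma smooth_map_continuous_on:
  assumes "coordinates_on S u v" "smooth_map S u v F"
  shows "continuous_on S F"
  unfolding continuous_on_def
proof
  fix p assume p: "p \<in> S"
  then obtain U where U: "p \<in> U" "chart_domain S u v U" using assms(1) unfolding coordinates_on_def by blast
  have "continuous_on (coord_map u v ` U) (local_expr u v U F)"
    using Ck_on_imp_continuous_on[OF smooth_map_Ck_on[OF assms(2) U(2), of 0]] .
  then have "continuous_on U (\<lambda>q. local_expr u v U F (coord_map u v q))"
    by (rule continuous_on_compose2[OF _ chart_continuous_coord[OF U(2)]]) simp
  moreover have "local_expr u v U F (coord_map u v q) = F q" if "q \<in> U" for q
    using U(2) that by (simp add: local_expr_def)
  ultimately have "continuous_on U F" by (simp cong: continuous_on_cong)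
  then have "(F \<longlongrightarrow> F p) (at p within U)" using U(1) by (simp add: continuous_on_def)
  moreover obtain T where "open T" "U = S \<inter> T" using chart_openin[OF U(2)] by (auto simp: openin_open)
  then have "at p within U = at p within S" using at_within_nhd[of p T U S] U(1) by auto
  ultimately show "(F \<longlongrightarrow> F p) (at p within S)" by simp
qed

section \<open>Vector algebra in a tangent plane\<close>

lemma cross3_perp:
  assumes "norm n = 1" "n \<bullet> a = 0" "n \<bullet> b = 0"
  shows "cross3 a b = (n \<bullet> cross3 a b) *\<^sub>R n"
proof -
  have "cross3 n (cross3 a b) = 0" using assms by (simp add: Lagrange)
  then have "(n \<bullet> cross3 a b) *\<^sub>R n - (n \<bullet> n) *\<^sub>R cross3 a b = 0"
    using Lagrange[of n n "cross3 a b"] by simp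
  then show ?thesis using assms(1) by (simp add: norm_eq_1)
qed

lemma cross3_twice_perp: "norm n = 1 \<Longrightarrow> n \<bullet> a = 0 \<Longrightarrow> cross3 n (cross3 n a) = - a"
  by (simp add: Lagrange norm_eq_1)

text \<open>\<open>cross3 n\<close> turns the plane orthogonal to \<open>n\<close> by a right angle,
  and a rotation preserves oriented area.\<close>

lemma cross3_rotate_perp:
  assumes "norm n = 1" "n \<bullet> a = 0" "n \<bullet> b = 0"
  shows "cross3 (cross3 n a) (cross3 n b) = cross3 a b"
proof -
  have "cross3 (cross3 n a) (cross3 n b) = (cross3 n a \<bullet> b) *\<^sub>R n"
    by (simp add: Lagrange[of "cross3 n a"] dot_cross_self inner_commute)
  also have "cross3 n a \<bullet> b = n \<bullet> cross3 a b"
    by (simp add: cross3_simps)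
  finally show ?thesis using cross3_perp[OF assms] by simp
qed

text \<open>Linear algebra at one point: \<open>\<omega>\<close> is the differential of the
  immersion and \<open>\<tau>\<close> the covariant derivative of the normal, both in frame
  components, and \<open>r\<close> is the root of the negated curvature. The sign of the oriented
  area \<open>D\<close> is left open, so that both orientations are covered.\<close>

locale null_point =
  fixes \<omega> \<tau> :: "real^2 \<Rightarrow> real^3" and n :: "real^3" and r :: real
  assumes lin: "linear \<omega>" "linear \<tau>" and n: "norm n = 1"
    and perp: "\<And>X. n \<bullet> \<omega> X = 0" "\<And>X. n \<bullet> \<tau> X = 0"
    and null: "r *\<^sub>R \<omega> (axis 1 1) = cross3 n (\<tau> (axis 1 1))"
      "r *\<^sub>R \<omega> (axis 2 1) = - cross3 n (\<tau> (axis 2 1))"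
begin

abbreviation "a \<equiv> \<omega> (axis 1 1)"
abbreviation "b \<equiv> \<omega> (axis 2 1)"
abbreviation "D \<equiv> n \<bullet> cross3 a b"

text \<open>Applying \<open>cross3 n\<close> twice to a vector orthogonal to \<open>n\<close>
  changes its sign, which solves \<open>null\<close> for \<open>\<tau>\<close>.\<close>

lemma \<tau>_eq: "\<tau> (axis 1 1) = - (r *\<^sub>R cross3 n a)" "\<tau> (axis 2 1) = r *\<^sub>R cross3 n b"
  using cross3_twice_perp[OF n perp(2), of "axis 1 1"] cross3_twice_perp[OF n perp(2), of "axis 2 1"]
  by (simp_all add: null[symmetric] cross_mult_right flip: minus_equation_iff)
   (metis null cross_mult_right cross_minus_right minus_minus)+

text \<open>\<open>cross3 n a\<close> is orthogonal to \<open>a\<close>, and likewise for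
  \<open>b\<close>, so the squares drop out. The opposite signs in \<open>\<tau>_eq\<close> make the
  two mixed terms add up instead of cancelling.\<close>

lemma second_form: "- \<tau> X \<bullet> \<omega> X = 2 * (r * D) * X $ 1 * X $ 2"
proof -
  have "cross3 n a \<bullet> a = 0" "cross3 n b \<bullet> b = 0" by (simp_all add: dot_cross_self)
  moreover have "cross3 n a \<bullet> b = D" "cross3 n b \<bullet> a = - D" by (simp_all add: cross3_simps)
  ultimately show ?thesis
    unfolding linear_vec2[OF lin(1), of X] linear_vec2[OF lin(2), of X] \<tau>_eq
    by (simp add: inner_add_left inner_add_right inner_diff_left algebra_simps)
qed

text \<open>If \<open>D\<close> vanishes, so does \<open>a \<times> (a \<times> b)\<close>, and its
  expansion is a linear dependence between \<open>a\<close> and \<open>b\<close>.\<close>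

lemma inj_imp: "inj \<omega> \<Longrightarrow> D \<noteq> 0"
proof
  assume inj: "inj \<omega>" and "D = 0"
  then have "cross3 a b = 0" using cross3_perp[OF n perp(1) perp(1), of "axis 1 1" "axis 2 1"] by simp
  then have "cross3 a (cross3 a b) = 0" by simp
  then have "(a \<bullet> b) *\<^sub>R a - (a \<bullet> a) *\<^sub>R b = 0" by (simp add: Lagrange)
  then have "\<omega> ((a \<bullet> b) *\<^sub>R axis 1 1 - (a \<bullet> a) *\<^sub>R axis 2 1) = 0"
    by (simp add: linear_diff[OF lin(1)] linear_cmul[OF lin(1)])
  then have "(a \<bullet> b) *\<^sub>R axis 1 1 - (a \<bullet> a) *\<^sub>R axis 2 1 = (0::real^2)"
    using inj linear_injective_0[OF lin(1)] by blast
  then have "a \<bullet> a = 0" by (simp add: vec_eq_iff forall_2 axis_def)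
  then have "\<omega> (axis 1 1) = 0" by simp
  then have "axis 1 1 = (0::real^2)" using inj linear_injective_0[OF lin(1)] by blast
  then show False by (simp add: axis_eq_0_iff)
qed

text \<open>Cramer's rule: a cross product with \<open>b\<close> or \<open>a\<close> isolates one
  coefficient of a vanishing combination, multiplied by \<open>D\<close>.\<close>

lemma imp_inj:
  assumes "D \<noteq> 0"
  shows "inj \<omega>"
  unfolding linear_injective_0[OF lin(1)]
proof (intro allI impI)
  fix X assume "\<omega> X = 0"
  then have 0: "X $ 1 *\<^sub>R a + X $ 2 *\<^sub>R b = 0" using linear_vec2[OF lin(1), of X] by simp
  have "X $ 1 * D = n \<bullet> cross3 (X $ 1 *\<^sub>R a + X $ 2 *\<^sub>R b) b"
    by (simp add: cross_add_left cross_mult_left inner_add_right)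
  also have "\<dots> = 0" unfolding 0 by simp
  finally have "X $ 1 = 0" using assms by simp
  have "X $ 2 * D = n \<bullet> cross3 a (X $ 1 *\<^sub>R a + X $ 2 *\<^sub>R b)"
    by (simp add: cross_add_right cross_mult_right inner_add_right)
  also have "\<dots> = 0" unfolding 0 by simp
  finally have "X $ 2 = 0" using assms by simp
  with \<open>X $ 1 = 0\<close> show "X = 0" by (simp add: vec_eq_iff forall_2)
qed

text \<open>Rotation by a right angle in the tangent plane, in the basis \<open>a, b\<close>, has determinant \<open>1\<close>; the
  shape operator is \<open>r\<close> times this rotation, followed by a sign change of the image of \<open>b\<close>.\<close>

lemma shape_exists:
  assumes "D \<noteq> 0"
  shows "\<exists>A. (\<forall>X. \<omega> (A X) = - \<tau> X) \<and> det (matrix A) = - r\<^sup>2"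
proof -
  define d where "d = D"
  have d0: "d \<noteq> 0" using assms by (simp add: d_def)
  \<comment> \<open>The coefficients of \<open>- \<tau> X\<close> in the basis \<open>a\<close>,
    \<open>b\<close>. They come from expanding \<open>(a \<times> b) \<times> a\<close> and
    \<open>(a \<times> b) \<times> b\<close>, where \<open>a \<times> b = d n\<close>.\<close>
  define A where "A X = (vector [r * (- (a \<bullet> b) * X $ 1 + (b \<bullet> b) * X $ 2) / d,
      r * ((a \<bullet> a) * X $ 1 - (a \<bullet> b) * X $ 2) / d] :: real^2)" for X :: "real^2"
  have ab: "cross3 a b = d *\<^sub>R n" unfolding d_def by (rule cross3_perp[OF n perp(1) perp(1)])
  have "d *\<^sub>R cross3 n a = cross3 (cross3 a b) a" unfolding ab by (simp add: cross_mult_left)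
  also have "\<dots> = (a \<bullet> a) *\<^sub>R b - (a \<bullet> b) *\<^sub>R a"
    using cross_skew[of "cross3 a b" a] by (simp add: Lagrange)
  finally have na: "d *\<^sub>R cross3 n a = (a \<bullet> a) *\<^sub>R b - (a \<bullet> b) *\<^sub>R a" .
  have "d *\<^sub>R cross3 n b = cross3 (cross3 a b) b" unfolding ab by (simp add: cross_mult_left)
  also have "\<dots> = (a \<bullet> b) *\<^sub>R b - (b \<bullet> b) *\<^sub>R a"
    using cross_skew[of "cross3 a b" b] by (simp add: Lagrange inner_commute)
  finally have nb: "d *\<^sub>R cross3 n b = (a \<bullet> b) *\<^sub>R b - (b \<bullet> b) *\<^sub>R a" .
  have A12: "(A X) $ 1 = r * (- (a \<bullet> b) * X $ 1 + (b \<bullet> b) * X $ 2) / d"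
    "(A X) $ 2 = r * ((a \<bullet> a) * X $ 1 - (a \<bullet> b) * X $ 2) / d" for X
    by (simp_all add: A_def)
  have \<omega>A: "\<omega> (A X) = - \<tau> X" for X
  proof (rule scaleR_left_imp_eq[OF d0])
    have "d *\<^sub>R \<omega> (A X) = (d * (A X) $ 1) *\<^sub>R a + (d * (A X) $ 2) *\<^sub>R b"
      by (subst linear_vec2[OF lin(1)]) (simp add: scaleR_add_right)
    also have "\<dots> = (r * (- (a \<bullet> b) * X $ 1 + (b \<bullet> b) * X $ 2)) *\<^sub>R a + (r * ((a \<bullet> a) * X $ 1 - (a \<bullet> b) * X $ 2)) *\<^sub>R b"
      using d0 by (simp add: A12)
    also have "\<dots> = (r * X $ 1) *\<^sub>R (d *\<^sub>R cross3 n a) - (r * X $ 2) *\<^sub>R (d *\<^sub>R cross3 n b)"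
      unfolding na nb by (simp add: algebra_simps)
    also have "\<dots> = d *\<^sub>R (- \<tau> X)"
      unfolding linear_vec2[OF lin(2), of X] \<tau>_eq by (simp add: algebra_simps)
    finally show "d *\<^sub>R \<omega> (A X) = d *\<^sub>R (- \<tau> X)" .
  qed
  \<comment> \<open>By Lagrange's identity \<open>d\<^sup>2\<close> is the Gram determinant of
    \<open>a\<close> and \<open>b\<close>, which cancels the denominator of the determinant.\<close>
  have "d\<^sup>2 = cross3 a b \<bullet> cross3 a b"
    unfolding ab using n by (simp add: norm_eq_1 power2_eq_square)
  also have "\<dots> = (a \<bullet> a) * (b \<bullet> b) - (a \<bullet> b)\<^sup>2"
    by (simp add: dot_cross power2_eq_square inner_commute)
  finally have D2: "d\<^sup>2 = (a \<bullet> a) * (b \<bullet> b) - (a \<bullet> b)\<^sup>2" .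
  have "det (matrix A) = (A (axis 1 1)) $ 1 * (A (axis 2 1)) $ 2 - (A (axis 2 1)) $ 1 * (A (axis 1 1)) $ 2"
    by (simp add: det_2 matrix_def)
  also have "\<dots> = - r\<^sup>2 * ((a \<bullet> a) * (b \<bullet> b) - (a \<bullet> b)\<^sup>2) / d\<^sup>2"
    using d0 unfolding A12 by (simp add: axis_def field_simps power2_eq_square)
  also have "\<dots> = - r\<^sup>2" using d0 unfolding D2[symmetric] by simp
  finally have "det (matrix A) = - r\<^sup>2" .
  with \<omega>A show ?thesis by blast
qed

end

section \<open>Components in an orthonormal frame\<close>

definition orthonormal_frame :: "('e::euclidean_space \<Rightarrow> 3 \<Rightarrow> 'e) \<Rightarrow> 'e \<Rightarrow> bool" where
  "orthonormal_frame E q \<longleftrightarrow> (\<forall>i j. E q i \<bullet> E q j = (if i = j then 1 else 0))"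

lemma orthonormal_frameD: "orthonormal_frame E q \<Longrightarrow> E q i \<bullet> E q j = (if i = j then 1 else 0)"
  unfolding orthonormal_frame_def by blast

lemma frame_comp_of_comp: "orthonormal_frame E q \<Longrightarrow> frame_comp E q (of_comp E q x) = x"
  by (simp add: orthonormal_frameD frame_comp_def of_comp_def vec_eq_iff inner_sum_left if_distrib cong: if_cong)

lemma linear_of_comp: "linear (of_comp E q)"
  by (rule linearI) (simp_all add: of_comp_def algebra_simps sum.distrib scaleR_sum_right)

lemma linear_frame_comp: "linear (frame_comp E q)"
  by (rule linearI) (simp_all add: frame_comp_def vec_eq_iff inner_add_left)

lemma of_comp_inner: "orthonormal_frame E q \<Longrightarrow> of_comp E q x \<bullet> of_comp E q y = x \<bullet> y"
  by (simp add: orthonormal_frameD of_comp_def inner_sum_left inner_sum_right inner_vec_def if_distrib mult.commute cong: if_cong)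

lemma of_comp_eq_iff: "orthonormal_frame E q \<Longrightarrow> of_comp E q x = of_comp E q y \<longleftrightarrow> x = y"
  using frame_comp_of_comp by metis

lemma of_comp_frame_comp:
  assumes "orthonormal_frame E q" "x \<in> span (range (E q))"
  shows "of_comp E q (frame_comp E q x) = x"
proof -
  have "(\<lambda>x. of_comp E q (frame_comp E q x)) x = (\<lambda>x. x) x"
  proof (rule linear_eq_on_span[OF _ _ _ assms(2)])
    show "linear (\<lambda>x. of_comp E q (frame_comp E q x))"
      using linear_compose[OF linear_frame_comp linear_of_comp] by (simp add: o_def)
    show "of_comp E q (frame_comp E q x) = x" if x: "x \<in> range (E q)" for x
    proof -
      obtain i where i: "x = E q i" using x by blast
      have "of_comp E q (frame_comp E q x) = (\<Sum>j\<in>UNIV. if j = i then E q j else 0)"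
        unfolding i of_comp_def frame_comp_def using assms(1)
        by (intro sum.cong) (auto simp: orthonormal_frame_def)
      also have "\<dots> = x" by (simp add: i)
      finally show ?thesis .
    qed
  qed (rule linear_ident)
  then show ?thesis .
qed

lemma of_comp_in_span: "of_comp E q x \<in> span (range (E q))"
  unfolding of_comp_def by (intro span_sum span_scale span_base) auto

text \<open>Translates an immersion with unit normal into the component data \<open>n\<close>,
  \<open>\<omega>\<close>, \<open>\<tau>\<close>. After this translation the Euclidean and the
  spherical case are handled by the same lemmas.\<close>

definition darboux ::
  "'a::t2_space set \<Rightarrow> ('a \<Rightarrow> real) \<Rightarrow> ('a \<Rightarrow> real) \<Rightarrow> ('e::euclidean_space \<Rightarrow> 3 \<Rightarrow> 'e) \<Rightarrow>
     ('a \<Rightarrow> 'e) \<Rightarrow> ('a \<Rightarrow> 'e) \<Rightarrow> ('a \<Rightarrow> real^3) \<Rightarrow> ('a \<Rightarrow> real^2 \<Rightarrow> real^3) \<Rightarrow> ('a \<Rightarrow> real^2 \<Rightarrow> real^3) \<Rightarrow> bool" where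
  "darboux S u v E \<psi> N n \<omega> \<tau> \<longleftrightarrow> (\<forall>p\<in>S. orthonormal_frame E (\<psi> p) \<and> N p = of_comp E (\<psi> p) (n p) \<and>
     (\<forall>X. diff_at S u v \<psi> p X = of_comp E (\<psi> p) (\<omega> p X)) \<and>
     (\<forall>X. cov_deriv S u v E \<psi> N p X = of_comp E (\<psi> p) (\<tau> p X)) \<and>
     linear (\<omega> p) \<and> linear (\<tau> p) \<and> norm (n p) = 1 \<and> (\<forall>X. n p \<bullet> \<omega> p X = 0) \<and> (\<forall>X. n p \<bullet> \<tau> p X = 0))"

text \<open>The two ordering equations of proper null coordinates, multiplied by \<open>r\<close>.
  They survive reversal of the normal as well as of \<open>u\<close>, so the sign of the second
  fundamental form is kept apart, in \<open>orient\<close>.\<close>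

definition null_frame ::
  "'a set \<Rightarrow> ('a \<Rightarrow> real^3) \<Rightarrow> ('a \<Rightarrow> real^2 \<Rightarrow> real^3) \<Rightarrow> ('a \<Rightarrow> real^2 \<Rightarrow> real^3) \<Rightarrow> ('a \<Rightarrow> real) \<Rightarrow> bool" where
  "null_frame S n \<omega> \<tau> r \<longleftrightarrow> (\<forall>p\<in>S. r p *\<^sub>R \<omega> p (axis 1 1) = cross3 (n p) (\<tau> p (axis 1 1)) \<and>
     r p *\<^sub>R \<omega> p (axis 2 1) = - cross3 (n p) (\<tau> p (axis 2 1)))"

text \<open>The coefficient \<open>f\<close> of \<open>2 du dv\<close> in the second fundamental
  form is \<open>r\<close> times this number, so its sign decides the condition
  \<open>f > 0\<close>.\<close>

definition orient :: "('a \<Rightarrow> real^3) \<Rightarrow> ('a \<Rightarrow> real^2 \<Rightarrow> real^3) \<Rightarrow> 'a \<Rightarrow> real" where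
  "orient n \<omega> p = n p \<bullet> cross3 (\<omega> p (axis 1 1)) (\<omega> p (axis 2 1))"

lemma darboux_null_point:
  assumes "darboux S u v E \<psi> N n \<omega> \<tau>" "null_frame S n \<omega> \<tau> r" "p \<in> S"
  shows "null_point (\<omega> p) (\<tau> p) (n p) (r p)"
  using assms unfolding darboux_def null_frame_def by (intro null_point.intro) blast+

lemma darboux_inj_diff:
  assumes "darboux S u v E \<psi> N n \<omega> \<tau>" "p \<in> S"
  shows "inj (diff_at S u v \<psi> p) \<longleftrightarrow> inj (\<omega> p)"
  using assms of_comp_eq_iff unfolding darboux_def inj_def by metis

text \<open>\<open>N'\<close> and \<open>c\<close> are general so that the lemma also yields the
  shape operator of a normal that is only locally a constant multiple of \<open>N\<close>.\<close>

lemma darboux_shape_operator: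
  assumes d: "darboux S u v E \<psi> N n \<omega> \<tau>" and p: "p \<in> S" and inj: "inj (\<omega> p)"
    and A: "\<And>X. \<omega> p (A X) = c *\<^sub>R \<tau> p X" and N': "\<And>X. - cov_deriv S u v E \<psi> N' p X = c *\<^sub>R cov_deriv S u v E \<psi> N p X"
  shows "shape_operator S u v E \<psi> N' p = A"
proof
  fix X
  have o: "orthonormal_frame E (\<psi> p)" using d p unfolding darboux_def by blast
  have 1: "diff_at S u v \<psi> p Y = of_comp E (\<psi> p) (\<omega> p Y)" for Y using d p unfolding darboux_def by blast
  have 2: "- cov_deriv S u v E \<psi> N' p X = of_comp E (\<psi> p) (c *\<^sub>R \<tau> p X)"
    using d p linear_cmul[OF linear_of_comp] N' unfolding darboux_def by metis
  have "(diff_at S u v \<psi> p Y = - cov_deriv S u v E \<psi> N' p X) \<longleftrightarrow> Y = A X" for Y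
    unfolding 1 2 of_comp_eq_iff[OF o] A[symmetric] using inj by (auto dest: injD)
  then show "shape_operator S u v E \<psi> N' p X = A X" unfolding shape_operator_def by simp
qed

lemma darboux_shape_det:
  assumes d: "darboux S u v E \<psi> N n \<omega> \<tau>" and r: "null_frame S n \<omega> \<tau> r" and p: "p \<in> S" and D: "orient n \<omega> p \<noteq> 0"
  shows "shape_det S u v E \<psi> N p = - (r p)\<^sup>2"
proof -
  interpret null_point "\<omega> p" "\<tau> p" "n p" "r p" by (rule darboux_null_point[OF d r p])
  obtain A where A: "\<And>X. \<omega> p (A X) = - \<tau> p X" "det (matrix A) = - (r p)\<^sup>2"
    using shape_exists D unfolding orient_def by blast
  have "shape_operator S u v E \<psi> N p = A"
    by (rule darboux_shape_operator[OF d p imp_inj, where c="-1"]) (use D A in \<open>auto simp: orient_def\<close>)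
  then show ?thesis unfolding shape_det_def using A(2) by simp
qed

lemma darboux_unit_normal:
  assumes "darboux S u v E \<psi> N n \<omega> \<tau>" "smooth_map S u v N"
  shows "unit_normal S u v E \<psi> N"
  unfolding unit_normal_def
proof (intro conjI ballI allI assms(2))
  fix p X assume "p \<in> S"
  then have d: "orthonormal_frame E (\<psi> p)" "N p = of_comp E (\<psi> p) (n p)" "norm (n p) = 1" "n p \<bullet> \<omega> p X = 0"
    "diff_at S u v \<psi> p X = of_comp E (\<psi> p) (\<omega> p X)"
    using assms(1) unfolding darboux_def by blast+
  show "N p \<in> span (range (E (\<psi> p)))" unfolding d(2) by (rule of_comp_in_span)
  show "norm (N p) = 1" using of_comp_inner[OF d(1), of "n p" "n p"] d(2,3) by (simp add: norm_eq_1)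
  show "N p \<bullet> diff_at S u v \<psi> p X = 0" unfolding d(2,5) of_comp_inner[OF d(1)] by (rule d(4))
qed

lemma darboux_second_ff:
  assumes "darboux S u v E \<psi> N n \<omega> \<tau>" "p \<in> S"
  shows "second_ff S u v E \<psi> N p X X = - \<tau> p X \<bullet> \<omega> p X"
proof -
  have d: "orthonormal_frame E (\<psi> p)" "diff_at S u v \<psi> p X = of_comp E (\<psi> p) (\<omega> p X)"
    "cov_deriv S u v E \<psi> N p X = of_comp E (\<psi> p) (\<tau> p X)"
    using assms unfolding darboux_def by blast+
  show ?thesis unfolding second_ff_def d(2,3) using of_comp_inner[OF d(1)] by simp
qed

lemma darboux_cross_at:
  assumes "darboux S u v E \<psi> N n \<omega> \<tau>" "p \<in> S"
  shows "cross_at E (\<psi> p) (N p) (cov_deriv S u v E \<psi> N p X) = of_comp E (\<psi> p) (cross3 (n p) (\<tau> p X))"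
proof -
  have d: "orthonormal_frame E (\<psi> p)" "N p = of_comp E (\<psi> p) (n p)"
    "cov_deriv S u v E \<psi> N p X = of_comp E (\<psi> p) (\<tau> p X)"
    using assms unfolding darboux_def by blast+
  show ?thesis unfolding cross_at_def d(2,3) frame_comp_of_comp[OF d(1)] ..
qed

lemma darboux_compatible_normal:
  assumes d: "darboux S u v E \<psi> N n \<omega> \<tau>" and N: "smooth_map S u v N" and r: "null_frame S n \<omega> \<tau> r"
    and pos: "\<And>p. p \<in> S \<Longrightarrow> r p > 0" "\<And>p. p \<in> S \<Longrightarrow> orient n \<omega> p > 0"
  shows "compatible_normal S u v E \<psi> N"
  unfolding compatible_normal_def
proof (intro conjI ballI)
  show "unit_normal S u v E \<psi> N" by (rule darboux_unit_normal[OF d N])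
  fix p assume p: "p \<in> S"
  interpret null_point "\<omega> p" "\<tau> p" "n p" "r p" by (rule darboux_null_point[OF d r p])
  have "second_ff S u v E \<psi> N p X X = 2 * (r p * orient n \<omega> p) * X $ 1 * X $ 2" for X
    unfolding darboux_second_ff[OF d p] second_form orient_def ..
  moreover have "r p * orient n \<omega> p > 0" using pos[OF p] by simp
  ultimately show "\<exists>f>0. \<forall>X. second_ff S u v E \<psi> N p X X = 2 * f * X $ 1 * X $ 2" by blast
  have sq: "sqrt (- shape_det S u v E \<psi> N p) = r p"
    using darboux_shape_det[OF d r p] pos[OF p] by simp
  have dd: "diff_at S u v \<psi> p X = of_comp E (\<psi> p) (\<omega> p X)" for X using d p unfolding darboux_def by blast
  have "\<omega> p (axis 1 1) = (1 / r p) *\<^sub>R cross3 (n p) (\<tau> p (axis 1 1))"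
    "\<omega> p (axis 2 1) = - (1 / r p) *\<^sub>R cross3 (n p) (\<tau> p (axis 2 1))"
    using pos(1)[OF p] null[symmetric] by (simp_all flip: scaleR_minus_right)
  then show "partial_u S u v \<psi> p = (1 / sqrt (- shape_det S u v E \<psi> N p)) *\<^sub>R
      cross_at E (\<psi> p) (N p) (cov_deriv S u v E \<psi> N p (axis 1 1))"
    "partial_v S u v \<psi> p = - (1 / sqrt (- shape_det S u v E \<psi> N p)) *\<^sub>R
      cross_at E (\<psi> p) (N p) (cov_deriv S u v E \<psi> N p (axis 2 1))"
    unfolding sq partial_u_def partial_v_def dd darboux_cross_at[OF d p]
    by (simp_all only: linear_cmul[OF linear_of_comp, symmetric])
qed

text \<open>The root \<open>r\<close> is taken of a quantity not yet known to be positive.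
  Injectivity gives \<open>r p \<noteq> 0\<close>, the null equations then identify the determinant
  as \<open>- (r p)\<^sup>2\<close>, and only then is \<open>r\<close> seen to be positive.\<close>

lemma compatible_normal_darboux:
  assumes d: "darboux S u v E \<psi> N n \<omega> \<tau>" and comp: "compatible_normal S u v E \<psi> N"
    and inj: "\<And>p. p \<in> S \<Longrightarrow> inj (diff_at S u v \<psi> p)"
  defines "r \<equiv> \<lambda>p. sqrt (- shape_det S u v E \<psi> N p)"
  shows "null_frame S n \<omega> \<tau> r" "\<And>p. p \<in> S \<Longrightarrow> r p > 0" "\<And>p. p \<in> S \<Longrightarrow> orient n \<omega> p > 0"
proof -
  have dd: "orthonormal_frame E (\<psi> p)" "diff_at S u v \<psi> p X = of_comp E (\<psi> p) (\<omega> p X)" if "p \<in> S" for p X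
    using d that unfolding darboux_def by blast+
  have eqs: "\<omega> p (axis 1 1) = (1 / r p) *\<^sub>R cross3 (n p) (\<tau> p (axis 1 1))"
    "\<omega> p (axis 2 1) = - (1 / r p) *\<^sub>R cross3 (n p) (\<tau> p (axis 2 1))" if p: "p \<in> S" for p
  proof -
    have "partial_u S u v \<psi> p = (1 / r p) *\<^sub>R cross_at E (\<psi> p) (N p) (cov_deriv S u v E \<psi> N p (axis 1 1))"
      "partial_v S u v \<psi> p = - (1 / r p) *\<^sub>R cross_at E (\<psi> p) (N p) (cov_deriv S u v E \<psi> N p (axis 2 1))"
      using comp p unfolding compatible_normal_def r_def by blast+
    then show "\<omega> p (axis 1 1) = (1 / r p) *\<^sub>R cross3 (n p) (\<tau> p (axis 1 1))"
      "\<omega> p (axis 2 1) = - (1 / r p) *\<^sub>R cross3 (n p) (\<tau> p (axis 2 1))"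
      unfolding partial_u_def partial_v_def dd(2)[OF p] darboux_cross_at[OF d p]
      by (simp_all only: linear_cmul[OF linear_of_comp, symmetric] of_comp_eq_iff[OF dd(1)[OF p]])
  qed
  \<comment> \<open>Division by zero yields zero, so \<open>r p = 0\<close> would force the
    derivative in \<open>u\<close> to vanish.\<close>
  have r0: "r p \<noteq> 0" if p: "p \<in> S" for p
  proof
    assume "r p = 0"
    then have "\<omega> p (axis 1 1) = 0" using eqs(1)[OF p] by simp
    moreover have "inj (\<omega> p)" "linear (\<omega> p)"
      using inj[OF p] darboux_inj_diff[OF d p] d p unfolding darboux_def by blast+
    ultimately have "axis 1 1 = (0::real^2)" using linear_injective_0 by blast
    then show False by (simp add: axis_eq_0_iff)
  qed
  show nf: "null_frame S n \<omega> \<tau> r"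
    unfolding null_frame_def
  proof (intro ballI conjI)
    fix p assume p: "p \<in> S"
    show "r p *\<^sub>R \<omega> p (axis 1 1) = cross3 (n p) (\<tau> p (axis 1 1))"
      by (subst eqs(1)[OF p]) (simp add: r0[OF p])
    show "r p *\<^sub>R \<omega> p (axis 2 1) = - cross3 (n p) (\<tau> p (axis 2 1))"
      by (subst eqs(2)[OF p]) (simp add: r0[OF p])
  qed
  fix p assume p: "p \<in> S"
  interpret null_point "\<omega> p" "\<tau> p" "n p" "r p" by (rule darboux_null_point[OF d nf p])
  have D0: "orient n \<omega> p \<noteq> 0"
    using inj_imp inj[OF p] darboux_inj_diff[OF d p] unfolding orient_def by blast
  have "- shape_det S u v E \<psi> N p = (r p)\<^sup>2" using darboux_shape_det[OF d nf p D0] by simp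
  moreover have "r p = sqrt (- shape_det S u v E \<psi> N p)" by (simp only: r_def)
  \<comment> \<open>\<open>sqrt\<close> is extended to negative numbers as an odd function, so a
    negative value has to be excluded.\<close>
  ultimately have "r p = \<bar>r p\<bar>" using real_sqrt_abs by metis
  then show rp: "r p > 0" using r0[OF p] by linarith
  obtain f where f: "f > 0" "\<And>X. second_ff S u v E \<psi> N p X X = 2 * f * X $ 1 * X $ 2"
    using comp p unfolding compatible_normal_def by blast
  \<comment> \<open>The vector \<open>(1, 1)\<close> reads off the coefficient of the quadratic
    form.\<close>
  have "2 * (r p * orient n \<omega> p) = 2 * f"
    using f(2)[of "vector [1, 1]"] unfolding darboux_second_ff[OF d p] second_form orient_def by simp
  then have "r p * orient n \<omega> p > 0" using f(1) by simp
  then show "orient n \<omega> p > 0" using rp zero_less_mult_pos by blast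
qed

section \<open>Independence of the curvature from the unit normal\<close>

lemma cov_deriv_scale:
  assumes "diff_at S u v N' p X = c *\<^sub>R diff_at S u v N p Y"
  shows "cov_deriv S u v E \<psi> N' p X = c *\<^sub>R cov_deriv S u v E \<psi> N p Y"
  unfolding cov_deriv_def assms by (simp add: linear_cmul[OF linear_of_comp] linear_cmul[OF linear_frame_comp])

text \<open>Two unit vectors orthogonal to the tangent plane are both parallel to the nonzero cross
  product of the coordinate tangents.\<close>

lemma unit_normal_pm:
  assumes d: "darboux S u v E \<psi> N n \<omega> \<tau>" and D: "orient n \<omega> q \<noteq> 0" and N0: "unit_normal S u v E \<psi> N0" and q: "q \<in> S"
  shows "N0 q = N q \<or> N0 q = - N q"
proof -
  have dd: "orthonormal_frame E (\<psi> q)" "N q = of_comp E (\<psi> q) (n q)" "norm (n q) = 1" "n q \<bullet> \<omega> q X = 0"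
    "diff_at S u v \<psi> q X = of_comp E (\<psi> q) (\<omega> q X)" for X
    using d q unfolding darboux_def by blast+
  define m where "m = frame_comp E (\<psi> q) (N0 q)"
  have n0: "N0 q \<in> span (range (E (\<psi> q)))" "norm (N0 q) = 1" "N0 q \<bullet> diff_at S u v \<psi> q X = 0" for X
    using N0 q unfolding unit_normal_def by blast+
  have N0m: "N0 q = of_comp E (\<psi> q) m" using of_comp_frame_comp[OF dd(1) n0(1)] by (simp add: m_def)
  have m1: "norm m = 1" using n0(2) of_comp_inner[OF dd(1), of m m] unfolding N0m by (simp add: norm_eq_1)
  have mp: "m \<bullet> \<omega> q X = 0" for X using n0(3)[of X] unfolding N0m dd(5) of_comp_inner[OF dd(1)] .
  let ?c = "cross3 (\<omega> q (axis 1 1)) (\<omega> q (axis 2 1))"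
  have c1: "?c = (n q \<bullet> ?c) *\<^sub>R n q" by (rule cross3_perp[OF dd(3) dd(4) dd(4)])
  have c2: "?c = (m \<bullet> ?c) *\<^sub>R m" by (rule cross3_perp[OF m1 mp mp])
  have D0: "n q \<bullet> ?c \<noteq> 0" using D unfolding orient_def .
  have eq: "(n q \<bullet> ?c) *\<^sub>R n q = (m \<bullet> ?c) *\<^sub>R m" using c1 c2 by metis
  then have "norm ((n q \<bullet> ?c) *\<^sub>R n q) = norm ((m \<bullet> ?c) *\<^sub>R m)" by (rule arg_cong)
  then have "\<bar>m \<bullet> ?c\<bar> = \<bar>n q \<bullet> ?c\<bar>" using m1 dd(3) by simp
  then have "m \<bullet> ?c = n q \<bullet> ?c \<or> m \<bullet> ?c = - (n q \<bullet> ?c)" by linarith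
  then have "m = n q \<or> m = - n q"
  proof
    assume *: "m \<bullet> ?c = n q \<bullet> ?c"
    have "m = n q" by (rule scaleR_left_imp_eq[OF D0]) (rule eq[unfolded *, symmetric])
    then show ?thesis ..
  next
    assume *: "m \<bullet> ?c = - (n q \<bullet> ?c)"
    have "m = - n q"
      by (rule scaleR_left_imp_eq[OF D0]) (simp only: scaleR_minus_right eq[unfolded *] scaleR_minus_left minus_minus)
    then show ?thesis ..
  qed
  then show ?thesis unfolding N0m dd(2) by (auto simp: linear_neg[OF linear_of_comp])
qed

text \<open>The extrinsic curvature is given through some unit normal, which may differ from the
  compatible one. The factor \<open>h\<close> between them is continuous with values 1 and -1, hence
  locally constant, so it passes through differentiation; a determinant of order two does not see
  it.\<close>

lemma unit_normal_shape_det: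
  assumes coords: "coordinates_on S u v" and d: "darboux S u v E \<psi> N n \<omega> \<tau>" and r: "null_frame S n \<omega> \<tau> r"
    and N: "smooth_map S u v N" and D: "\<And>q. q \<in> S \<Longrightarrow> orient n \<omega> q \<noteq> 0"
    and N0: "unit_normal S u v E \<psi> N0" and p: "p \<in> S"
  shows "shape_det S u v E \<psi> N0 p = shape_det S u v E \<psi> N p"
proof -
  define h where "h q = N0 q \<bullet> N q" for q
  have N1: "norm (N q) = 1" if "q \<in> S" for q
    using darboux_unit_normal[OF d N] that unfolding unit_normal_def by blast
  have pm: "(h q = 1 \<or> h q = -1) \<and> N0 q = h q *\<^sub>R N q" if "q \<in> S" for q
    using unit_normal_pm[OF d D[OF that] N0 that] N1[OF that] by (auto simp: h_def norm_eq_1)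
  have "smooth_map S u v N0" using N0 unfolding unit_normal_def by blast
  then have "smooth_map S u v h" unfolding h_def[abs_def] by (rule smooth_map_inner[OF _ N])
  then have "continuous_on S h" by (rule smooth_map_continuous_on[OF coords])
  then have op: "openin (top_of_set S) (S \<inter> h -` ball (h p) 1)"
    by (rule continuous_openin_preimage_gen) simp
  have near: "\<forall>q\<in>S \<inter> h -` ball (h p) 1. N0 q = h p *\<^sub>R N q"
  proof
    fix q assume q: "q \<in> S \<inter> h -` ball (h p) 1"
    then have "\<bar>h p - h q\<bar> < 1" by (simp add: dist_real_def)
    moreover have "h p = 1 \<or> h p = -1" "h q = 1 \<or> h q = -1" using pm[OF p] pm[of q] q by auto
    ultimately have "h q = h p" by auto
    then show "N0 q = h p *\<^sub>R N q" using pm[of q] q by auto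
  qed
  obtain U where U: "p \<in> U" "chart_domain S u v U" using coords p unfolding coordinates_on_def by blast
  have "diff_at S u v N0 p = diff_at S u v (\<lambda>q. h p *\<^sub>R N q) p"
    by (rule diff_at_cong[OF U(2,1) op _ near]) (use p in simp)
  also have "\<dots> = (\<lambda>X. h p *\<^sub>R diff_at S u v N p X)"
    by (rule has_diff_imp_diff_at[OF has_diff_bounded_linear[OF bounded_linear_scaleR_right smooth_has_diff[OF coords N p]]])
  finally have cov: "cov_deriv S u v E \<psi> N0 p X = h p *\<^sub>R cov_deriv S u v E \<psi> N p X" for X
    by (intro cov_deriv_scale) simp
  interpret null_point "\<omega> p" "\<tau> p" "n p" "r p" by (rule darboux_null_point[OF d r p])
  have D0: "n p \<bullet> cross3 (\<omega> p (axis 1 1)) (\<omega> p (axis 2 1)) \<noteq> 0" using D[OF p] unfolding orient_def .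
  obtain A where A: "\<And>X. \<omega> p (A X) = - \<tau> p X" "det (matrix A) = - (r p)\<^sup>2"
    using shape_exists[OF D0] by blast
  have "shape_operator S u v E \<psi> N0 p = (\<lambda>X. h p *\<^sub>R A X)"
    by (rule darboux_shape_operator[OF d p imp_inj[OF D0], where c="- h p"])
      (simp_all add: linear_cmul[OF lin(1)] A(1) cov)
  moreover have "det (matrix (\<lambda>X. h p *\<^sub>R A X)) = (h p)\<^sup>2 * det (matrix A)"
    by (simp add: det_2 matrix_def power2_eq_square algebra_simps)
  moreover have "(h p)\<^sup>2 = 1" using pm[OF p] by auto
  ultimately show ?thesis
    unfolding shape_det_def[of S u v E \<psi> N0] darboux_shape_det[OF d r p D[OF p]] using A(2) by simp
qed

lemma darboux_minus:
  assumes coords: "coordinates_on S u v" and N: "smooth_map S u v N" and d: "darboux S u v E \<psi> N n \<omega> \<tau>"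
  shows "darboux S u v E \<psi> (\<lambda>p. - N p) (\<lambda>p. - n p) \<omega> (\<lambda>p X. - \<tau> p X)"
  unfolding darboux_def
proof
  fix p assume p: "p \<in> S"
  have "diff_at S u v (\<lambda>p. - N p) p = (\<lambda>X. - diff_at S u v N p X)"
    by (rule has_diff_imp_diff_at[OF has_diff_minus[OF smooth_has_diff[OF coords N p]]])
  then have "cov_deriv S u v E \<psi> (\<lambda>p. - N p) p X = (-1) *\<^sub>R cov_deriv S u v E \<psi> N p X" for X
    by (intro cov_deriv_scale) simp
  then show "orthonormal_frame E (\<psi> p) \<and> - N p = of_comp E (\<psi> p) (- n p) \<and>
     (\<forall>X. diff_at S u v \<psi> p X = of_comp E (\<psi> p) (\<omega> p X)) \<and>
     (\<forall>X. cov_deriv S u v E \<psi> (\<lambda>p. - N p) p X = of_comp E (\<psi> p) (- \<tau> p X)) \<and>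
     linear (\<omega> p) \<and> linear (\<lambda>X. - \<tau> p X) \<and> norm (- n p) = 1 \<and> (\<forall>X. - n p \<bullet> \<omega> p X = 0) \<and> (\<forall>X. - n p \<bullet> - \<tau> p X = 0)"
    using d p unfolding darboux_def by (auto simp: linear_neg[OF linear_of_comp] linear_compose_neg)
qed

lemma null_frame_minus: "null_frame S n \<omega> \<tau> r \<Longrightarrow> null_frame S (\<lambda>p. - n p) \<omega> (\<lambda>p X. - \<tau> p X) r"
  unfolding null_frame_def by (simp add: cross_minus_left cross_minus_right)

lemma orient_minus: "orient (\<lambda>p. - n p) \<omega> p = - orient n \<omega> p"
  by (simp add: orient_def)

section \<open>Reversing the first coordinate\<close>

text \<open>The coordinate change from \<open>(u, v)\<close> to \<open>(- u, v)\<close>. It is an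
  involution, so the converse of a transfer result is an instance of the result itself.\<close>

definition flip :: "real^2 \<Rightarrow> real^2" where
  "flip X = vector [- X $ 1, X $ 2]"

lemma flip_nth [simp]: "flip X $ 1 = - X $ 1" "flip X $ 2 = X $ 2"
  by (simp_all add: flip_def)

lemma flip_flip [simp]: "flip (flip X) = X"
  by (simp add: vec_eq_iff forall_2)

lemma linear_flip: "linear flip"
  by (rule linearI) (simp_all add: vec_eq_iff forall_2)

lemma flip_axis: "flip (axis 1 1) = - axis 1 1" "flip (axis 2 1) = axis 2 1"
  by (simp_all add: vec_eq_iff forall_2 axis_def)

lemma continuous_flip: "continuous_on A flip"
  using linear_flip linear_continuous_on linear_conv_bounded_linear by blast

lemma flip_image_iff: "z \<in> flip ` A \<longleftrightarrow> flip z \<in> A"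
  by (metis flip_flip image_iff)

lemma open_flip: "open A \<Longrightarrow> open (flip ` A)"
proof -
  assume "open A"
  then have "open (flip -` A)" using open_vimage continuous_flip by blast
  moreover have "flip ` A = flip -` A" using flip_image_iff by blast
  ultimately show ?thesis by simp
qed

lemma coord_map_flip: "coord_map (\<lambda>p. - u p) v = (\<lambda>p. flip (coord_map u v p))"
  by (rule ext) (simp add: coord_map_def vec_eq_iff forall_2)

lemma inv_into_flip:
  assumes "z \<in> coord_map (\<lambda>p. - u p) v ` U"
  shows "inv_into U (coord_map (\<lambda>p. - u p) v) z = inv_into U (coord_map u v) (flip z)"
proof -
  have "flip x = z \<longleftrightarrow> x = flip z" for x by (metis flip_flip)
  then show ?thesis unfolding coord_map_flip inv_into_def by simp
qed

lemma chart_domain_flip: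
  assumes U: "chart_domain S u v U"
  shows "chart_domain S (\<lambda>p. - u p) v U"
proof -
  let ?X = "coord_map u v" and ?Y = "coord_map (\<lambda>p. - u p) v"
  have img: "?Y ` U = flip ` (?X ` U)" by (simp add: coord_map_flip image_image)
  have inv: "inv_into U ?Y z = inv_into U ?X (flip z)" if "z \<in> ?Y ` U" for z by (rule inv_into_flip[OF that])
  have "homeomorphism U (?Y ` U) ?Y (inv_into U ?Y)"
    unfolding homeomorphism_def
  proof (intro conjI ballI)
    show inv': "inv_into U ?Y (?Y x) = x" if "x \<in> U" for x
      using inv[of "?Y x"] that U by (simp add: coord_map_flip)
    show "continuous_on U ?Y" unfolding coord_map_flip
      by (rule continuous_on_compose2[OF continuous_flip[of UNIV] chart_continuous_coord[OF U]]) simp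
    show "?Y (inv_into U ?Y y) = y" if "y \<in> ?Y ` U" for y using that by (rule f_inv_into_f)
    show "inv_into U ?Y ` (?Y ` U) = U" using inv' by (force simp: image_image)
    have "continuous_on (?Y ` U) (\<lambda>z. inv_into U ?X (flip z))"
      by (rule continuous_on_compose2[OF chart_continuous_inv[OF U] continuous_flip]) (auto simp: img image_image)
    then show "continuous_on (?Y ` U) (inv_into U ?Y)" using inv by (simp cong: continuous_on_cong)
  qed simp
  then show ?thesis using chart_openin[OF U] open_flip[OF chart_open[OF U]] by (simp add: chart_domain_def img)
qed

lemma chart_domain_flip_iff: "chart_domain S (\<lambda>p. - u p) v U \<longleftrightarrow> chart_domain S u v U"
  using chart_domain_flip[of S u v U] chart_domain_flip[of S "\<lambda>p. - u p" v U] by auto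

lemma local_expr_flip:
  "z \<in> coord_map (\<lambda>p. - u p) v ` U \<Longrightarrow> local_expr (\<lambda>p. - u p) v U F z = local_expr u v U F (flip z)"
  unfolding local_expr_def by (simp add: inv_into_flip)

lemma has_derivative_flip: "(flip has_derivative flip) (at x within A)"
  using linear_flip linear_conv_bounded_linear bounded_linear_imp_has_derivative by blast

lemma has_diff_flip:
  assumes "has_diff S u v F D p"
  shows "has_diff S (\<lambda>p. - u p) v F (\<lambda>w. D (flip w)) p"
proof -
  obtain U where U: "p \<in> U" "chart_domain S u v U" "(local_expr u v U F has_derivative D) (at (coord_map u v p))"
    using assms(1) unfolding has_diff_def by blast
  let ?Y = "coord_map (\<lambda>p. - u p) v"
  have "flip (?Y p) = coord_map u v p" by (simp add: coord_map_flip)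
  then have D: "(local_expr u v U F has_derivative D) (at (flip (?Y p)))" using U(3) by simp
  have "((\<lambda>z. local_expr u v U F (flip z)) has_derivative (\<lambda>w. D (flip w))) (at (?Y p))"
    by (rule has_derivative_compose[where f=flip and g="local_expr u v U F" and x="?Y p", OF has_derivative_flip D])
  then have "(local_expr (\<lambda>p. - u p) v U F has_derivative (\<lambda>w. D (flip w))) (at (?Y p))"
    by (rule has_derivative_transform_within_open[OF _ chart_open[OF chart_domain_flip[OF U(2)]]])
      (use U(1) in blast, rule local_expr_flip[symmetric])
  then show ?thesis unfolding has_diff_def using U chart_domain_flip by blast
qed

lemma Ck_on_flip:
  assumes "open W" "open W'" "flip ` W' \<subseteq> W"
  shows "Ck_on n W f \<Longrightarrow> Ck_on n W' (\<lambda>z. f (flip z))"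
proof (induction n arbitrary: f)
  case 0
  then have "continuous_on W f" by simp
  from continuous_on_compose2[OF this continuous_flip assms(3)] show ?case by simp
next
  case (Suc n)
  show ?case
  proof (rule Ck_on_SucI[OF assms(2)])
    fix z assume "z \<in> W'"
    then have "flip z \<in> W" using assms(3) by blast
    then show "((\<lambda>z. f (flip z)) has_derivative (\<lambda>w. frechet_derivative f (at (flip z)) (flip w))) (at z)"
      by (intro has_derivative_compose[where f=flip and g=f and x=z, OF has_derivative_flip]
          Ck_on_Suc_has_derivative[OF assms(1) Suc.prems])
  next
    show "Ck_on n W' (\<lambda>z. frechet_derivative f (at (flip z)) (flip w))" for w
      by (rule Suc.IH[OF Ck_on_SucD[OF Suc.prems]])
  qed
qed

lemma smooth_map_flip:
  assumes "smooth_map S u v F"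
  shows "smooth_map S (\<lambda>p. - u p) v F"
  unfolding smooth_map_def
proof (intro allI impI)
  fix U n assume U': "chart_domain S (\<lambda>p. - u p) v U"
  then have U: "chart_domain S u v U" unfolding chart_domain_flip_iff .
  have "Ck_on n (coord_map (\<lambda>p. - u p) v ` U) (\<lambda>z. local_expr u v U F (flip z))"
    by (rule Ck_on_flip[OF chart_open[OF U] chart_open[OF U'] _ smooth_map_Ck_on[OF assms U]])
      (auto simp: coord_map_flip)
  then show "Ck_on n (coord_map (\<lambda>p. - u p) v ` U) (local_expr (\<lambda>p. - u p) v U F)"
    by (rule iffD2[OF Ck_on_cong[OF chart_open[OF U'] local_expr_flip], rotated])
qed

lemma darboux_flip:
  assumes coords: "coordinates_on S u v" and \<psi>: "smooth_map S u v \<psi>" and N: "smooth_map S u v N"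
    and d: "darboux S u v E \<psi> N n \<omega> \<tau>"
  shows "darboux S (\<lambda>p. - u p) v E \<psi> N n (\<lambda>p X. \<omega> p (flip X)) (\<lambda>p X. \<tau> p (flip X))"
  unfolding darboux_def
proof
  fix p assume p: "p \<in> S"
  have e: "diff_at S (\<lambda>p. - u p) v F p = (\<lambda>w. diff_at S u v F p (flip w))" if "smooth_map S u v F" for F :: "'a \<Rightarrow> 'b"
    by (rule has_diff_imp_diff_at[OF has_diff_flip[OF smooth_has_diff[OF coords that p]]])
  have "linear (\<lambda>X. \<omega> p (flip X))" "linear (\<lambda>X. \<tau> p (flip X))"
    using d p linear_compose[OF linear_flip, unfolded o_def] unfolding darboux_def by blast+
  then show "orthonormal_frame E (\<psi> p) \<and> N p = of_comp E (\<psi> p) (n p) \<and>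
     (\<forall>X. diff_at S (\<lambda>p. - u p) v \<psi> p X = of_comp E (\<psi> p) (\<omega> p (flip X))) \<and>
     (\<forall>X. cov_deriv S (\<lambda>p. - u p) v E \<psi> N p X = of_comp E (\<psi> p) (\<tau> p (flip X))) \<and>
     linear (\<lambda>X. \<omega> p (flip X)) \<and> linear (\<lambda>X. \<tau> p (flip X)) \<and> norm (n p) = 1 \<and>
     (\<forall>X. n p \<bullet> \<omega> p (flip X) = 0) \<and> (\<forall>X. n p \<bullet> \<tau> p (flip X) = 0)"
    using d p unfolding darboux_def cov_deriv_def e[OF \<psi>] e[OF N] by blast
qed

lemma null_frame_flip:
  assumes "darboux S u v E \<psi> N n \<omega> \<tau>" "null_frame S n \<omega> \<tau> r"
  shows "null_frame S n (\<lambda>p X. \<omega> p (flip X)) (\<lambda>p X. \<tau> p (flip X)) r"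
  unfolding null_frame_def flip_axis
proof
  fix p assume p: "p \<in> S"
  then have "linear (\<omega> p)" "linear (\<tau> p)" using assms(1) unfolding darboux_def by blast+
  then show "r p *\<^sub>R \<omega> p (- axis 1 1) = cross3 (n p) (\<tau> p (- axis 1 1)) \<and>
    r p *\<^sub>R \<omega> p (axis 2 1) = - cross3 (n p) (\<tau> p (axis 2 1))"
    using assms(2) p unfolding null_frame_def by (simp add: linear_neg cross_minus_right)
qed

lemma orient_flip:
  assumes "darboux S u v E \<psi> N n \<omega> \<tau>" "p \<in> S"
  shows "orient n (\<lambda>p X. \<omega> p (flip X)) p = - orient n \<omega> p"
proof -
  have "linear (\<omega> p)" using assms unfolding darboux_def by blast
  then show ?thesis unfolding orient_def flip_axis by (simp add: linear_neg cross_minus_left)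
qed

text \<open>The common end of both implications. For negative \<open>orient\<close> there are two
  repairs: the opposite normal, which keeps the coordinates and shows that they are proper null, and
  the coordinate \<open>- u\<close>, which keeps the normal and therefore the Gauss map
  \<open>g\<close>.\<close>

lemma null_immersion:
  assumes coords: "coordinates_on S u v" and \<psi>: "smooth_map S u v \<psi>" "\<psi> ` S \<subseteq> M"
    and N: "smooth_map S u v N" and d: "darboux S u v E \<psi> N n \<omega> \<tau>" and r: "null_frame S n \<omega> \<tau> r"
    and pos: "\<And>p. p \<in> S \<Longrightarrow> r p > 0"
    and sgn: "(\<forall>p\<in>S. orient n \<omega> p > 0) \<or> (\<forall>p\<in>S. orient n \<omega> p < 0)"
    and g: "\<And>p. p \<in> S \<Longrightarrow> g p = stereo (n p)" and K: "\<And>p. p \<in> S \<Longrightarrow> K p = - (r p)\<^sup>2"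
  shows "immersion S u v M \<psi>" "extrinsic_curvature S u v E \<psi> K" "gauss_map S u v E \<psi> g"
    "proper_null_coordinates S u v E \<psi>"
    "(\<forall>p\<in>S. orient n \<omega> p > 0) \<Longrightarrow> compatible_gauss_map S u v E \<psi> g"
    "(\<forall>p\<in>S. orient n \<omega> p < 0) \<Longrightarrow> compatible_gauss_map S (\<lambda>p. - u p) v E \<psi> g"
proof -
  have D: "orient n \<omega> p \<noteq> 0" if "p \<in> S" for p using sgn that by force
  have gN: "g p = stereo (frame_comp E (\<psi> p) (N p))" if "p \<in> S" for p
    using d that g[OF that] frame_comp_of_comp unfolding darboux_def by metis
  have "inj (diff_at S u v \<psi> p)" if p: "p \<in> S" for p
  proof -
    interpret null_point "\<omega> p" "\<tau> p" "n p" "r p" by (rule darboux_null_point[OF d r p])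
    show ?thesis using darboux_inj_diff[OF d p] imp_inj D[OF p] unfolding orient_def by blast
  qed
  then show "immersion S u v M \<psi>" unfolding immersion_def using coords \<psi> by blast
  have "unit_normal S u v E \<psi> N" by (rule darboux_unit_normal[OF d N])
  then show "extrinsic_curvature S u v E \<psi> K" "gauss_map S u v E \<psi> g"
    unfolding extrinsic_curvature_def gauss_map_def using darboux_shape_det[OF d r _ D] K gN by (auto intro!: exI[of _ N])
  have cp: "compatible_normal S u v E \<psi> N" if "\<forall>p\<in>S. orient n \<omega> p > 0"
    using darboux_compatible_normal[OF d N r pos] that by blast
  then show "(\<forall>p\<in>S. orient n \<omega> p > 0) \<Longrightarrow> compatible_gauss_map S u v E \<psi> g"
    unfolding compatible_gauss_map_def using gN by blast
  have "compatible_normal S u v E \<psi> (\<lambda>p. - N p)" if "\<forall>p\<in>S. orient n \<omega> p < 0"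
    by (rule darboux_compatible_normal[OF darboux_minus[OF coords N d] smooth_map_minus[OF N] null_frame_minus[OF r] pos])
      (use that orient_minus in \<open>auto simp: orient_def\<close>)
  then show "proper_null_coordinates S u v E \<psi>"
    unfolding proper_null_coordinates_def using cp sgn coords by blast
  show "compatible_gauss_map S (\<lambda>p. - u p) v E \<psi> g" if neg: "\<forall>p\<in>S. orient n \<omega> p < 0"
  proof -
    have "compatible_normal S (\<lambda>p. - u p) v E \<psi> N"
      by (rule darboux_compatible_normal[OF darboux_flip[OF coords \<psi>(1) N d] smooth_map_flip[OF N] null_frame_flip[OF d r] pos])
        (use neg orient_flip[OF d] in auto)
    then show ?thesis unfolding compatible_gauss_map_def using gN by blast
  qed
qed

section \<open>Immersions into the two Lie groups\<close>

text \<open>Differentiate \<open>F \<bullet> F = 1\<close>. Needed for the normal components as well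
  as for immersions into the sphere.\<close>

lemma unit_perp_diff:
  assumes coords: "coordinates_on S u v" and F: "smooth_map S u v F" "\<And>p. p \<in> S \<Longrightarrow> norm (F p) = 1" and p: "p \<in> S"
  shows "F p \<bullet> diff_at S u v F p X = 0"
proof -
  note d = smooth_has_diff[OF coords F(1) p]
  have "has_diff S u v (\<lambda>p. F p \<bullet> F p) (\<lambda>w. F p \<bullet> diff_at S u v F p w + diff_at S u v F p w \<bullet> F p) p"
    by (rule has_diff_bilinear[OF bounded_bilinear_inner d d])
  moreover have "has_diff S u v (\<lambda>p. F p \<bullet> F p) (\<lambda>w. 0) p"
    by (rule has_diff_cong[OF has_diff_const[OF coords p, of 1] openin_subtopology_self p])
      (use F(2) in \<open>simp add: norm_eq_1\<close>)
  ultimately have "(\<lambda>w. F p \<bullet> diff_at S u v F p w + diff_at S u v F p w \<bullet> F p) = (\<lambda>w. 0)"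
    using has_diff_imp_diff_at by metis
  then have "F p \<bullet> diff_at S u v F p X + diff_at S u v F p X \<bullet> F p = 0" by (rule fun_cong)
  then show ?thesis by (simp add: inner_commute)
qed

section \<open>Euclidean space with its parallel frame\<close>

lemma of_comp_R3: "of_comp frame_R3 q x = x"
  by (simp add: of_comp_def frame_R3_def vec_eq_iff forall_3 sum_3 axis_def)

lemma orthonormal_frame_R3: "orthonormal_frame frame_R3 q"
  by (simp add: orthonormal_frame_def frame_R3_def inner_axis_axis)

lemma frame_comp_R3: "frame_comp frame_R3 q x = x"
  using frame_comp_of_comp[OF orthonormal_frame_R3, of q x] by (simp add: of_comp_R3)

lemma darboux_R3:
  assumes coords: "coordinates_on S u v" and \<psi>: "smooth_map S u v \<psi>"
    and n: "smooth_map S u v n" "\<And>p. p \<in> S \<Longrightarrow> norm (n p) = 1" "\<And>p X. p \<in> S \<Longrightarrow> n p \<bullet> diff_at S u v \<psi> p X = 0"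
  shows "darboux S u v frame_R3 \<psi> n n (\<lambda>p. diff_at S u v \<psi> p) (\<lambda>p. diff_at S u v n p)"
  unfolding darboux_def cov_deriv_def of_comp_R3 frame_comp_R3
  using orthonormal_frame_R3 n(2,3) unit_perp_diff[OF coords n(1,2)]
    has_diff_linear[OF smooth_has_diff[OF coords \<psi>]] has_diff_linear[OF smooth_has_diff[OF coords n(1)]]
  by blast

section \<open>Unit quaternions with the left invariant frame\<close>

lemma qmult_assoc: "qmult (qmult a b) c = qmult a (qmult b c)"
  by (auto simp: qmult_def cross3_simps prod_eq_iff inner_vec_def sum_3 vec_eq_iff forall_3)

lemma bounded_bilinear_qmult: "bounded_bilinear qmult"
  unfolding bilinear_conv_bounded_bilinear[symmetric] bilinear_def
  by (intro conjI allI linearI)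
    (simp_all add: qmult_def prod_eq_iff algebra_simps inner_add_left inner_add_right cross_add_left cross_add_right
      cross_mult_left cross_mult_right)

lemma qmult_inner: "qmult q y \<bullet> qmult q z = (q \<bullet> q) * (y \<bullet> z)"
  by (simp add: qmult_def inner_prod_def inner_vec_def sum_3 cross3_def) algebra

lemma qmult_perp: "q \<bullet> qmult q (0, x) = 0"
  by (simp add: qmult_def inner_prod_def inner_vec_def sum_3 cross3_def) algebra

definition qconj :: "real \<times> (real^3) \<Rightarrow> real \<times> (real^3)" where
  "qconj q = (fst q, - snd q)"

lemma bounded_linear_qconj: "bounded_linear qconj"
  unfolding linear_conv_bounded_linear[symmetric] by (rule linearI) (simp_all add: qconj_def prod_eq_iff)

lemma qmult_qconj: "qmult q (qmult (qconj q) y) = (q \<bullet> q) *\<^sub>R y"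
  by (simp add: qmult_def qconj_def inner_prod_def inner_vec_def sum_3 cross3_def prod_eq_iff vec_eq_iff forall_3) algebra

lemma qconj_qmult: "qmult (qconj q) (qmult q y) = (q \<bullet> q) *\<^sub>R y"
  by (simp add: qmult_def qconj_def inner_prod_def inner_vec_def sum_3 cross3_def prod_eq_iff vec_eq_iff forall_3) algebra

lemma fst_qconj_qmult: "fst (qmult (qconj q) y) = q \<bullet> y"
  by (simp add: qmult_def qconj_def inner_prod_def)

text \<open>Left translation to the identity: multiplication by the conjugate sends \<open>y\<close>
  to a quaternion with real part \<open>q \<bullet> y = 0\<close>.\<close>

lemma tangent_S3:
  assumes "q \<in> S3" "q \<bullet> y = 0"
  shows "y = qmult q (0, snd (qmult (qconj q) y))"
proof -
  have "y = qmult q (qmult (qconj q) y)" using assms(1) by (simp add: qmult_qconj norm_eq_1)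
  also have "qmult (qconj q) y = (0, snd (qmult (qconj q) y))"
    using assms(2) by (simp add: prod_eq_iff fst_qconj_qmult)
  finally show ?thesis .
qed

lemma of_comp_S3: "of_comp frame_S3 q x = qmult q (0, x)"
proof -
  have "of_comp frame_S3 q x = qmult q (\<Sum>i\<in>UNIV. x $ i *\<^sub>R (0, axis i 1))"
    unfolding of_comp_def frame_S3_def
    by (simp add: bounded_bilinear.sum_right[OF bounded_bilinear_qmult] bounded_bilinear.scaleR_right[OF bounded_bilinear_qmult] del: scaleR_Pair)
  also have "(\<Sum>i\<in>UNIV. x $ i *\<^sub>R (0::real, axis i 1 :: real^3)) = (0, x)"
    by (simp add: sum_3 vec_eq_iff forall_3 axis_def)
  finally show ?thesis .
qed

lemma orthonormal_frame_S3: "q \<in> S3 \<Longrightarrow> orthonormal_frame frame_S3 q"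
  unfolding orthonormal_frame_def using frame_S3_orthonormal(1) by blast

lemma frame_comp_S3:
  assumes "q \<in> S3"
  shows "frame_comp frame_S3 q (qmult q (a, x)) = x"
  using assms by (simp add: frame_comp_def frame_S3_def qmult_inner norm_eq_1 vec_eq_iff inner_axis)

text \<open>Differentiating \<open>N = \<psi> n\<close> in direction \<open>X\<close> gives
  \<open>\<psi> (n\<^sub>X + \<omega> n)\<close> with the quaternion product
  \<open>\<omega> n\<close>. Its real part \<open>- \<omega> \<bullet> n\<close> does not enter the
  frame components, and its imaginary part \<open>\<omega> \<times> n\<close> is the term by which
  the sphere differs from Euclidean space.\<close>

lemma darboux_S3:
  assumes coords: "coordinates_on S u v" and \<psi>: "\<psi> ` S \<subseteq> S3"
    and d\<psi>: "\<And>p. p \<in> S \<Longrightarrow> has_diff S u v \<psi> (\<lambda>X. qmult (\<psi> p) (0, \<omega> p X)) p"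
    and lin: "\<And>p. p \<in> S \<Longrightarrow> linear (\<omega> p)"
    and n: "smooth_map S u v n" "\<And>p. p \<in> S \<Longrightarrow> norm (n p) = 1" "\<And>p X. p \<in> S \<Longrightarrow> n p \<bullet> \<omega> p X = 0"
    and N: "\<And>p. p \<in> S \<Longrightarrow> N p = qmult (\<psi> p) (0, n p)"
  shows "darboux S u v frame_S3 \<psi> N n \<omega> (\<lambda>p X. diff_at S u v n p X + cross3 (\<omega> p X) (n p))"
  unfolding darboux_def
proof
  fix p assume p: "p \<in> S"
  have q: "\<psi> p \<in> S3" using \<psi> p by blast
  note dn = smooth_has_diff[OF coords n(1) p]
  have lin_dn: "linear (diff_at S u v n p)" by (rule has_diff_linear[OF dn])
  have "bounded_linear (\<lambda>x::real^3. (0::real, x))"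
    unfolding linear_conv_bounded_linear[symmetric] by (rule linearI) simp_all
  from has_diff_bilinear[OF bounded_bilinear_qmult d\<psi>[OF p] has_diff_bounded_linear[OF this dn]]
  have "has_diff S u v (\<lambda>p. qmult (\<psi> p) (0, n p))
      (\<lambda>X. qmult (\<psi> p) (0, diff_at S u v n p X) + qmult (qmult (\<psi> p) (0, \<omega> p X)) (0, n p)) p" .
  then have "has_diff S u v N (\<lambda>X. qmult (\<psi> p) (0, diff_at S u v n p X) + qmult (qmult (\<psi> p) (0, \<omega> p X)) (0, n p)) p"
    by (rule has_diff_cong[OF _ openin_subtopology_self p]) (simp add: N)
  moreover have "qmult (\<psi> p) (0, diff_at S u v n p X) + qmult (qmult (\<psi> p) (0, \<omega> p X)) (0, n p) =
      qmult (\<psi> p) (- (\<omega> p X \<bullet> n p), diff_at S u v n p X + cross3 (\<omega> p X) (n p))" for X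
    unfolding qmult_assoc bounded_bilinear.add_right[OF bounded_bilinear_qmult, symmetric] by (simp add: qmult_def)
  ultimately have dN: "diff_at S u v N p = (\<lambda>X. qmult (\<psi> p) (- (\<omega> p X \<bullet> n p), diff_at S u v n p X + cross3 (\<omega> p X) (n p)))"
    using has_diff_imp_diff_at by simp
  have "linear (\<lambda>X. diff_at S u v n p X + cross3 (\<omega> p X) (n p))"
    by (rule linearI) (simp_all add: linear_add[OF lin_dn] linear_cmul[OF lin_dn] linear_add[OF lin[OF p]]
        linear_cmul[OF lin[OF p]] cross_add_left cross_mult_left scaleR_add_right)
  moreover have "n p \<bullet> (diff_at S u v n p X + cross3 (\<omega> p X) (n p)) = 0" for X
    using unit_perp_diff[OF coords n(1,2) p] by (simp add: inner_add_right dot_cross_self)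
  moreover have "cov_deriv S u v frame_S3 \<psi> N p X = of_comp frame_S3 (\<psi> p) (diff_at S u v n p X + cross3 (\<omega> p X) (n p))" for X
    unfolding cov_deriv_def dN frame_comp_S3[OF q] ..
  ultimately show "orthonormal_frame frame_S3 (\<psi> p) \<and> N p = of_comp frame_S3 (\<psi> p) (n p) \<and>
     (\<forall>X. diff_at S u v \<psi> p X = of_comp frame_S3 (\<psi> p) (\<omega> p X)) \<and>
     (\<forall>X. cov_deriv S u v frame_S3 \<psi> N p X = of_comp frame_S3 (\<psi> p) (diff_at S u v n p X + cross3 (\<omega> p X) (n p))) \<and>
     linear (\<omega> p) \<and> linear (\<lambda>X. diff_at S u v n p X + cross3 (\<omega> p X) (n p)) \<and> norm (n p) = 1 \<and>
     (\<forall>X. n p \<bullet> \<omega> p X = 0) \<and> (\<forall>X. n p \<bullet> (diff_at S u v n p X + cross3 (\<omega> p X) (n p)) = 0)"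
    using orthonormal_frame_S3[OF q] lin[OF p] n(2,3)[OF p] N[OF p] has_diff_imp_diff_at[OF d\<psi>[OF p]]
    by (auto simp: of_comp_S3)
qed

text \<open>The extra term of the covariant derivative contributes \<open>\<omega>\<close> itself to
  the right-hand side. Moved across, it lowers \<open>s\<close> by one in the first equation and,
  because of the minus sign, raises it by one in the second.\<close>

lemma null_frame_S3_iff:
  assumes "darboux S u v frame_S3 \<psi> N n \<omega> (\<lambda>p X. diff_at S u v n p X + cross3 (\<omega> p X) (n p))"
  shows "null_frame S n \<omega> (\<lambda>p X. diff_at S u v n p X + cross3 (\<omega> p X) (n p)) s \<longleftrightarrow>
    (\<forall>p\<in>S. (s p - 1) *\<^sub>R \<omega> p (axis 1 1) = cross3 (n p) (diff_at S u v n p (axis 1 1)) \<and>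
       (s p + 1) *\<^sub>R \<omega> p (axis 2 1) = - cross3 (n p) (diff_at S u v n p (axis 2 1)))"
proof -
  have *: "cross3 (n p) (diff_at S u v n p X + cross3 (\<omega> p X) (n p)) = cross3 (n p) (diff_at S u v n p X) + \<omega> p X"
    if p: "p \<in> S" for p X
  proof -
    have "norm (n p) = 1" "n p \<bullet> \<omega> p X = 0" using assms p unfolding darboux_def by blast+
    then show ?thesis by (simp add: cross_add_right Lagrange norm_eq_1)
  qed
  show ?thesis
    unfolding null_frame_def
  proof (rule ball_cong[OF refl])
    fix p assume p: "p \<in> S"
    show "(s p *\<^sub>R \<omega> p (axis 1 1) = cross3 (n p) (diff_at S u v n p (axis 1 1) + cross3 (\<omega> p (axis 1 1)) (n p)) \<and>
      s p *\<^sub>R \<omega> p (axis 2 1) = - cross3 (n p) (diff_at S u v n p (axis 2 1) + cross3 (\<omega> p (axis 2 1)) (n p))) \<longleftrightarrow>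
      ((s p - 1) *\<^sub>R \<omega> p (axis 1 1) = cross3 (n p) (diff_at S u v n p (axis 1 1)) \<and>
       (s p + 1) *\<^sub>R \<omega> p (axis 2 1) = - cross3 (n p) (diff_at S u v n p (axis 2 1)))"
    proof -
      have "x = c + y \<longleftrightarrow> x - y = c" "x = - (c + y) \<longleftrightarrow> x + y = - c" for x y c :: "real^3"
        subgoal by auto
        subgoal by (simp only: eq_neg_iff_add_eq_0 ac_simps)
        done
      then show ?thesis unfolding *[OF p] scaleR_diff_left scaleR_add_left scaleR_one by blast
    qed
  qed
qed

section \<open>Structure equations\<close>

context
  fixes S :: "'a::t2_space set" and u v :: "'a \<Rightarrow> real"
  assumes coords: "coordinates_on S u v"
begin

section \<open>Product and chain rules for the differential\<close>

lemma diff_at_bilinear: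
  assumes "bounded_bilinear h" "smooth_map S u v F" "smooth_map S u v G" "p \<in> S"
  shows "diff_at S u v (\<lambda>p. h (F p) (G p)) p X = h (F p) (diff_at S u v G p X) + h (diff_at S u v F p X) (G p)"
  using has_diff_imp_diff_at[OF has_diff_bilinear[OF assms(1) smooth_has_diff[OF coords assms(2,4)] smooth_has_diff[OF coords assms(3,4)]]]
  by simp

lemmas diff_at_scaleR = diff_at_bilinear[OF bounded_bilinear_scaleR]
lemmas diff_at_mult = diff_at_bilinear[OF bounded_bilinear_mult]

lemma diff_at_bounded_linear:
  assumes "bounded_linear L" "smooth_map S u v F" "p \<in> S"
  shows "diff_at S u v (\<lambda>p. L (F p)) p X = L (diff_at S u v F p X)"
  using has_diff_imp_diff_at[OF has_diff_bounded_linear[OF assms(1) smooth_has_diff[OF coords assms(2,3)]]] by simp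

lemma diff_at_real:
  assumes "(\<phi> has_real_derivative c) (at (F p))" "smooth_map S u v F" "p \<in> S"
  shows "diff_at S u v (\<lambda>p. \<phi> (F p)) p X = diff_at S u v F p X * c"
  using has_diff_imp_diff_at[OF has_diff_real[OF smooth_has_diff[OF coords assms(2,3)] assms(1)]] by simp

lemma diff_at_cong_on:
  assumes "\<And>q. q \<in> S \<Longrightarrow> F q = G q" "p \<in> S"
  shows "diff_at S u v F p X = diff_at S u v G p X"
proof -
  obtain U where "p \<in> U" "chart_domain S u v U" using coords assms(2) unfolding coordinates_on_def by blast
  from diff_at_cong[OF this(2,1) openin_subtopology_self assms(2), of F G] assms(1) show ?thesis by simp
qed

text \<open>The roots of the negated curvatures enter the null equations as coefficients, and as
  quotients of inner products they are seen to be smooth.\<close>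

lemma smooth_coefficient:
  fixes F G :: "'a \<Rightarrow> 'b::real_inner"
  assumes "smooth_map S u v F" "smooth_map S u v G" "\<And>p. p \<in> S \<Longrightarrow> F p \<noteq> 0" "\<And>p. p \<in> S \<Longrightarrow> c p *\<^sub>R F p = G p"
  shows "smooth_map S u v c"
proof (rule smooth_map_cong)
  show "(G p \<bullet> F p) * inverse (F p \<bullet> F p) = c p" if "p \<in> S" for p
    using assms(3,4)[OF that] by (simp add: assms(4)[OF that, symmetric])
  show "smooth_map S u v (\<lambda>p. (G p \<bullet> F p) * inverse (F p \<bullet> F p))"
    using assms(3) by (intro smooth_map_mult smooth_map_inverse smooth_map_inner assms(1,2)) simp
qed

lemma bounded_bilinear_cross3: "bounded_bilinear cross3"
  using bilinear_cross bilinear_conv_bounded_bilinear by blast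

text \<open>Differentiate the first equation in \<open>v\<close>, the second in \<open>u\<close>,
  and add: the second derivatives of \<open>n\<close> cancel and two copies of
  \<open>n\<^sub>v \<times> n\<^sub>u = \<alpha> \<beta> a \<times> b\<close> remain. The
  coefficients are \<open>s - 1\<close> and \<open>s + 1\<close> in the sphere, and \<open>r\<close>
  twice in Euclidean space.\<close>

lemma codazzi:
  fixes n a b :: "'a \<Rightarrow> real^3"
  assumes n: "smooth_map S u v n" "\<And>p. p \<in> S \<Longrightarrow> norm (n p) = 1"
    and ab: "smooth_map S u v a" "smooth_map S u v b" and \<alpha>\<beta>: "smooth_map S u v \<alpha>" "smooth_map S u v \<beta>"
    and a: "\<And>p. p \<in> S \<Longrightarrow> \<alpha> p *\<^sub>R a p = cross3 (n p) (diff_at S u v n p (axis 1 1))"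
    and b: "\<And>p. p \<in> S \<Longrightarrow> \<beta> p *\<^sub>R b p = - cross3 (n p) (diff_at S u v n p (axis 2 1))"
    and p: "p \<in> S"
  shows "(diff_at S u v \<alpha> p (axis 2 1) *\<^sub>R a p + \<alpha> p *\<^sub>R diff_at S u v a p (axis 2 1)) +
     (diff_at S u v \<beta> p (axis 1 1) *\<^sub>R b p + \<beta> p *\<^sub>R diff_at S u v b p (axis 1 1)) =
     (2 * \<alpha> p * \<beta> p) *\<^sub>R cross3 (a p) (b p)"
proof -
  let ?d = "\<lambda>F p X. diff_at S u v F p X" and ?e = "axis 1 1 :: real^2" and ?f = "axis 2 1 :: real^2"
  let ?nu = "?d n p ?e" and ?nv = "?d n p ?f"
  have sn: "smooth_map S u v (\<lambda>p. ?d n p X)" for X by (rule smooth_map_diff_at[OF n(1)])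
  have dn: "?d (\<lambda>p. cross3 (n p) (?d n p X)) p Y = cross3 (n p) (?d (\<lambda>p. ?d n p X) p Y) + cross3 (?d n p Y) (?d n p X)" for X Y
    by (rule diff_at_bilinear[OF bounded_bilinear_cross3 n(1) sn p])
  have "?d \<alpha> p ?f *\<^sub>R a p + \<alpha> p *\<^sub>R ?d a p ?f = ?d (\<lambda>p. \<alpha> p *\<^sub>R a p) p ?f"
    using diff_at_scaleR[OF \<alpha>\<beta>(1) ab(1) p] by simp
  also have "\<dots> = ?d (\<lambda>p. cross3 (n p) (?d n p ?e)) p ?f" by (rule diff_at_cong_on[OF a p])
  finally have 1: "?d \<alpha> p ?f *\<^sub>R a p + \<alpha> p *\<^sub>R ?d a p ?f = cross3 (n p) (?d (\<lambda>p. ?d n p ?e) p ?f) + cross3 ?nv ?nu"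
    unfolding dn .
  have "?d \<beta> p ?e *\<^sub>R b p + \<beta> p *\<^sub>R ?d b p ?e = ?d (\<lambda>p. \<beta> p *\<^sub>R b p) p ?e"
    using diff_at_scaleR[OF \<alpha>\<beta>(2) ab(2) p] by simp
  also have "\<dots> = ?d (\<lambda>p. - cross3 (n p) (?d n p ?f)) p ?e" by (rule diff_at_cong_on[OF b p])
  also have "\<dots> = - ?d (\<lambda>p. cross3 (n p) (?d n p ?f)) p ?e"
    by (rule diff_at_bounded_linear[OF bounded_linear_minus[OF bounded_linear_ident] smooth_map_bilinear[OF bounded_bilinear_cross3 n(1) sn] p])
  finally have 2: "?d \<beta> p ?e *\<^sub>R b p + \<beta> p *\<^sub>R ?d b p ?e = - (cross3 (n p) (?d (\<lambda>p. ?d n p ?f) p ?e) + cross3 ?nu ?nv)"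
    unfolding dn .
  have 3: "?d (\<lambda>p. ?d n p ?f) p ?e = ?d (\<lambda>p. ?d n p ?e) p ?f" by (rule diff_at_commute[OF coords n(1) p])
  have "(\<alpha> p * \<beta> p) *\<^sub>R cross3 (a p) (b p) = cross3 (\<alpha> p *\<^sub>R a p) (\<beta> p *\<^sub>R b p)"
    by (simp add: cross_mult_left cross_mult_right)
  also have "\<dots> = - cross3 (cross3 (n p) ?nu) (cross3 (n p) ?nv)" unfolding a[OF p] b[OF p] by (simp add: cross_minus_right)
  also have "\<dots> = - cross3 ?nu ?nv"
    using cross3_rotate_perp[OF n(2)[OF p] unit_perp_diff[OF coords n p] unit_perp_diff[OF coords n p]] by simp
  finally have 4: "(\<alpha> p * \<beta> p) *\<^sub>R cross3 (a p) (b p) = cross3 ?nv ?nu" using cross_skew[of ?nv ?nu] by simp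
  have "(2 * \<alpha> p * \<beta> p) *\<^sub>R cross3 (a p) (b p) = cross3 ?nv ?nu + cross3 ?nv ?nu"
    using 4 by (simp add: mult.assoc flip: scaleR_scaleR) (simp add: scaleR_2)
  then show ?thesis unfolding 1 2 3 using cross_skew[of ?nu ?nv] by simp
qed

text \<open>The Maurer-Cartan equation. Equate the two mixed derivatives of \<open>\<psi>\<close>
  and cancel \<open>\<psi>\<close> on the left: the commutator of the imaginary quaternions
  \<open>a\<close> and \<open>b\<close> remains, which is \<open>2 a \<times> b\<close>, with the 2
  of the bracket relations.\<close>

lemma flat_S3:
  assumes \<psi>: "smooth_map S u v \<psi>" "\<psi> ` S \<subseteq> S3" and ab: "smooth_map S u v a" "smooth_map S u v b"
    and d: "\<And>p. p \<in> S \<Longrightarrow> diff_at S u v \<psi> p (axis 1 1) = qmult (\<psi> p) (0, a p)"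
      "\<And>p. p \<in> S \<Longrightarrow> diff_at S u v \<psi> p (axis 2 1) = qmult (\<psi> p) (0, b p)"
    and p: "p \<in> S"
  shows "diff_at S u v a p (axis 2 1) - diff_at S u v b p (axis 1 1) = 2 *\<^sub>R cross3 (a p) (b p)"
proof -
  let ?d = "\<lambda>F p X. diff_at S u v F p X" and ?e = "axis 1 1 :: real^2" and ?f = "axis 2 1 :: real^2"
  have l: "bounded_linear (\<lambda>x::real^3. (0::real, x))"
    unfolding linear_conv_bounded_linear[symmetric] by (rule linearI) simp_all
  have dq: "?d (\<lambda>p. qmult (\<psi> p) (0, c p)) p X = qmult (\<psi> p) (0, ?d c p X) + qmult (?d \<psi> p X) (0, c p)"
    if "smooth_map S u v c" for c X
    using diff_at_bilinear[OF bounded_bilinear_qmult \<psi>(1) smooth_map_bounded_linear[OF l that] p]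
      diff_at_bounded_linear[OF l that p] by simp
  have "?d (\<lambda>p. ?d \<psi> p ?e) p ?f = ?d (\<lambda>p. qmult (\<psi> p) (0, a p)) p ?f" by (rule diff_at_cong_on[OF d(1) p])
  also have "\<dots> = qmult (\<psi> p) ((0, ?d a p ?f) + qmult (0, b p) (0, a p))"
    unfolding dq[OF ab(1)] d(2)[OF p] qmult_assoc bounded_bilinear.add_right[OF bounded_bilinear_qmult] ..
  finally have 1: "?d (\<lambda>p. ?d \<psi> p ?e) p ?f = \<dots>" .
  have "?d (\<lambda>p. ?d \<psi> p ?f) p ?e = ?d (\<lambda>p. qmult (\<psi> p) (0, b p)) p ?e" by (rule diff_at_cong_on[OF d(2) p])
  also have "\<dots> = qmult (\<psi> p) ((0, ?d b p ?e) + qmult (0, a p) (0, b p))"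
    unfolding dq[OF ab(2)] d(1)[OF p] qmult_assoc bounded_bilinear.add_right[OF bounded_bilinear_qmult] ..
  finally have 2: "?d (\<lambda>p. ?d \<psi> p ?f) p ?e = \<dots>" .
  have "qmult (qconj (\<psi> p)) (?d (\<lambda>p. ?d \<psi> p ?e) p ?f) = qmult (qconj (\<psi> p)) (?d (\<lambda>p. ?d \<psi> p ?f) p ?e)"
    using diff_at_commute[OF coords \<psi>(1) p] by simp
  moreover have "\<psi> p \<bullet> \<psi> p = 1" using \<psi>(2) p by (auto simp: norm_eq_1)
  ultimately have "(0, ?d a p ?f) + qmult (0, b p) (0, a p) = (0, ?d b p ?e) + qmult (0, a p) (0, b p)"
    unfolding 1 2 qconj_qmult by simp
  then have "?d a p ?f + cross3 (b p) (a p) = ?d b p ?e + cross3 (a p) (b p)" by (simp add: qmult_def)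
  then show ?thesis using cross_skew[of "b p" "a p"] by (simp add: scaleR_2 algebra_simps)
qed

text \<open>The system \<open>(*)\<close> in terms of \<open>s = sqrt (-K)\<close> and \<open>r = sqrt (-K*)\<close>.\<close>

definition root_system :: "('a \<Rightarrow> real) \<Rightarrow> ('a \<Rightarrow> real) \<Rightarrow> bool" where
  "root_system s r \<longleftrightarrow> (\<forall>p\<in>S.
     diff_at S u v r p (axis 1 1) * (s p * (s p + 1)) = r p * ((s p - 1) * diff_at S u v s p (axis 1 1)) \<and>
     diff_at S u v r p (axis 2 1) * (s p * (s p - 1)) = r p * ((s p + 1) * diff_at S u v s p (axis 2 1)))"

text \<open>For \<open>c = 1\<close> and \<open>c = -1\<close> the logarithm of
  \<open>(c + s)\<^sup>4 / s\<^sup>2\<close> has derivative \<open>4 / (c + s) - 2 / s\<close> times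
  that of \<open>s\<close>, and \<open>K' = - r\<^sup>2\<close> has twice the logarithmic derivative
  of \<open>r\<close>. Clearing denominators gives a polynomial form fit for ideal membership
  arguments.\<close>

lemma curvature_system_iff:
  assumes s: "smooth_map S u v s" "\<And>p. p \<in> S \<Longrightarrow> s p > 0" "\<And>p. p \<in> S \<Longrightarrow> s p \<noteq> 1"
    and r: "smooth_map S u v r" "\<And>p. p \<in> S \<Longrightarrow> r p > 0"
    and K: "\<And>p. p \<in> S \<Longrightarrow> K p = - (s p)\<^sup>2" "\<And>p. p \<in> S \<Longrightarrow> K' p = - (r p)\<^sup>2"
  shows "curvature_system S u v K K' \<longleftrightarrow> root_system s r"
proof -
  have sq: "sqrt (- K p) = s p" "- K p = (s p)\<^sup>2" if "p \<in> S" for p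
    using K(1)[OF that] s(2)[OF that] by simp_all
  have D: "((\<lambda>x. ln ((c + x) ^ 4 / x\<^sup>2)) has_real_derivative 4 / (c + x) - 2 / x) (at x)"
    if "x > 0" "c + x \<noteq> 0" for c x :: real
  proof -
    \<comment> \<open>The fourth power is even, so \<open>c + x\<close> may be negative, as happens
      for \<open>c = -1\<close> when the curvature exceeds -1.\<close>
    have pos: "(c + x) ^ 4 / x\<^sup>2 > 0" using that by (simp add: zero_less_power_eq_numeral)
    have "((\<lambda>x. (c + x) ^ 4 / x\<^sup>2) has_real_derivative ((4 * (c + x) ^ 3) * x\<^sup>2 - (c + x) ^ 4 * (2 * x)) / (x\<^sup>2 * x\<^sup>2)) (at x)"
      using that by (auto intro!: derivative_eq_intros)
    from DERIV_chain2[OF DERIV_ln[OF pos] this]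
    have "((\<lambda>x. ln ((c + x) ^ 4 / x\<^sup>2)) has_real_derivative
        inverse ((c + x) ^ 4 / x\<^sup>2) * (((4 * (c + x) ^ 3) * x\<^sup>2 - (c + x) ^ 4 * (2 * x)) / (x\<^sup>2 * x\<^sup>2))) (at x)" .
    also have "inverse ((c + x) ^ 4 / x\<^sup>2) * (((4 * (c + x) ^ 3) * x\<^sup>2 - (c + x) ^ 4 * (2 * x)) / (x\<^sup>2 * x\<^sup>2)) = 4 / (c + x) - 2 / x"
      using that by (simp add: divide_simps) (simp add: power2_eq_square power3_eq_cube power4_eq_xxxx algebra_simps)
    finally show ?thesis .
  qed
  have lhs: "diff_at S u v (\<lambda>q. ln ((c + sqrt (- K q)) ^ 4 / (- K q))) p X = diff_at S u v s p X * (4 / (c + s p) - 2 / s p)"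
    if p: "p \<in> S" "c + s p \<noteq> 0" for c p X
  proof -
    have "diff_at S u v (\<lambda>q. ln ((c + sqrt (- K q)) ^ 4 / (- K q))) p X = diff_at S u v (\<lambda>q. ln ((c + s q) ^ 4 / (s q)\<^sup>2)) p X"
      by (rule diff_at_cong_on[OF _ p(1)]) (simp only: sq(1), simp only: sq(2))
    also have "\<dots> = diff_at S u v s p X * (4 / (c + s p) - 2 / s p)"
      by (rule diff_at_real[OF D[OF s(2)[OF p(1)] p(2)] s(1) p(1)])
    finally show ?thesis .
  qed
  have rhs: "diff_at S u v K' p X / K' p = 2 * diff_at S u v r p X / r p" if p: "p \<in> S" for p X
  proof -
    have "diff_at S u v K' p X = diff_at S u v (\<lambda>q. - (r q)\<^sup>2) p X" by (rule diff_at_cong_on[OF K(2) p])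
    also have "\<dots> = diff_at S u v r p X * (- (2 * r p))"
      by (rule diff_at_real[OF _ r(1) p]) (auto intro!: derivative_eq_intros)
    finally show ?thesis using r(2)[OF p] K(2)[OF p] by (simp add: field_simps power2_eq_square)
  qed
  show ?thesis
    unfolding curvature_system_def root_system_def partial_u_def partial_v_def
  proof (intro ball_cong refl arg_cong2[where f="(\<and>)"])
    fix p assume p: "p \<in> S"
    note sp = s(2,3)[OF p] r(2)[OF p]
    have n: "1 + s p \<noteq> 0" "- 1 + s p \<noteq> 0" using sp by auto
    show "(diff_at S u v (\<lambda>q. ln ((1 + sqrt (- K q)) ^ 4 / (- K q))) p (axis 1 1) = diff_at S u v K' p (axis 1 1) / K' p) \<longleftrightarrow>
      (diff_at S u v r p (axis 1 1) * (s p * (s p + 1)) = r p * ((s p - 1) * diff_at S u v s p (axis 1 1)))"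
      unfolding lhs[OF p n(1)] rhs[OF p] using sp n by (auto simp: divide_simps) (auto simp: algebra_simps)
    show "(diff_at S u v (\<lambda>q. ln ((- 1 + sqrt (- K q)) ^ 4 / (- K q))) p (axis 2 1) = diff_at S u v K' p (axis 2 1) / K' p) \<longleftrightarrow>
      (diff_at S u v r p (axis 2 1) * (s p * (s p - 1)) = r p * ((s p + 1) * diff_at S u v s p (axis 2 1)))"
      unfolding lhs[OF p n(2)] rhs[OF p] using sp n by (auto simp: divide_simps) (auto simp: algebra_simps)
  qed
qed

text \<open>The system prescribes \<open>(log r)\<^sub>u = g 1 s s\<^sub>u\<close> and
  \<open>(log r)\<^sub>v = g (-1) s s\<^sub>v\<close>. The mixed derivatives agree exactly when
  \<open>((g 1 s - g (-1) s) s\<^sub>u)\<^sub>v = 0\<close>, and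
  \<open>g 1 s - g (-1) s = 4 / (1 - s\<^sup>2)\<close>, which explains the form of the
  hypothesis.\<close>

lemma root_system_solvable:
  assumes sc: "simply_connected S"
    and s: "smooth_map S u v s" "\<And>p. p \<in> S \<Longrightarrow> s p > 0" "\<And>p. p \<in> S \<Longrightarrow> s p \<noteq> 1"
    and int: "\<And>p. p \<in> S \<Longrightarrow> diff_at S u v (\<lambda>q. diff_at S u v s q (axis 1 1) * inverse (1 - (s q)\<^sup>2)) p (axis 2 1) = 0"
  shows "\<exists>r. smooth_map S u v r \<and> (\<forall>p\<in>S. r p > 0) \<and> root_system s r"
proof -
  let ?d = "\<lambda>F p X. diff_at S u v F p X" and ?e = "axis 1 1 :: real^2" and ?f = "axis 2 1 :: real^2"
  \<comment> \<open>Partial fractions of \<open>(x - c) / (x * (x + c))\<close>, the coefficient in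
    the system for \<open>c = 1\<close> and \<open>c = -1\<close>; \<open>k c\<close> is its
    derivative.\<close>
  define g where "g c x = 2 * inverse (x + c) - inverse x" for c x :: real
  define k where "k c x = (inverse x)\<^sup>2 - 2 * (inverse (x + c))\<^sup>2" for c x :: real
  have gD: "(g c has_real_derivative k c x) (at x)" if "x \<noteq> 0" "x + c \<noteq> 0" for c x
    unfolding g_def[abs_def] k_def
    by (rule derivative_eq_intros refl that | simp add: that power2_eq_square)+
  have nz: "s p \<noteq> 0" "s p + 1 \<noteq> 0" "s p + - 1 \<noteq> 0" "1 - (s p)\<^sup>2 \<noteq> 0" if "p \<in> S" for p
    using s(2,3)[OF that] by (auto simp: power2_eq_1_iff)
  have sd: "smooth_map S u v (\<lambda>p. ?d s p X)" for X by (rule smooth_map_diff_at[OF s(1)])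
  have sg: "smooth_map S u v (\<lambda>p. g c (s p))" if "c = 1 \<or> c = -1" for c
    unfolding g_def using nz that
    by (intro smooth_map_diff smooth_map_mult smooth_map_const smooth_map_inverse smooth_map_add s(1)) auto
  define \<alpha> \<beta> where "\<alpha> p = g 1 (s p) * ?d s p ?e" and "\<beta> p = g (-1) (s p) * ?d s p ?f" for p
  have sm: "smooth_map S u v \<alpha>" "smooth_map S u v \<beta>"
    unfolding \<alpha>_def[abs_def] \<beta>_def[abs_def] by (intro smooth_map_mult sg sd; simp)+
  have dg: "?d (\<lambda>p. g c (s p) * ?d s p X) p Y = g c (s p) * ?d (\<lambda>p. ?d s p X) p Y + (?d s p Y * k c (s p)) * ?d s p X"
    if p: "p \<in> S" and c: "c = 1 \<or> c = -1" for p X Y c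
  proof -
    have nz': "s p \<noteq> 0" "s p + c \<noteq> 0" using nz[OF p] c by auto
    show ?thesis unfolding diff_at_mult[OF sg[OF c] sd p] diff_at_real[OF gD[OF nz'] s(1) p] ..
  qed
  have "?d \<alpha> p ?f = ?d \<beta> p ?e" if p: "p \<in> S" for p
  proof -
    define x y z w where d: "x = s p" "y = ?d s p ?e" "z = ?d s p ?f" "w = ?d (\<lambda>p. ?d s p ?e) p ?f"
    have si: "smooth_map S u v (\<lambda>q. inverse (1 - (s q)\<^sup>2))"
      unfolding power2_eq_square using nz(4)[unfolded power2_eq_square]
      by (intro smooth_map_inverse smooth_map_diff smooth_map_const smooth_map_mult s(1))
    have "((\<lambda>x. inverse (1 - x\<^sup>2)) has_real_derivative 2 * x * (inverse (1 - x\<^sup>2))\<^sup>2) (at (s p))"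
      using nz(4)[OF p] unfolding d(1) by (auto intro!: derivative_eq_intros simp: power2_eq_square)
    from int[OF p, unfolded diff_at_mult[OF sd si p] diff_at_real[OF this s(1) p]]
    have "y * (z * (2 * x * (inverse (1 - x\<^sup>2))\<^sup>2)) + w * inverse (1 - x\<^sup>2) = 0" unfolding d .
    moreover have "inverse (1 - x\<^sup>2) * (1 - x\<^sup>2) = 1" using nz(4)[OF p] by (simp add: d(1))
    ultimately have "2 * x * y * z + w * (1 - x\<^sup>2) = 0" by algebra
    then have key: "w * (1 - x\<^sup>2) = - 2 * x * y * z" by simp
    have n: "x \<noteq> 0" "x + 1 \<noteq> 0" "x - 1 \<noteq> 0" "1 - x\<^sup>2 \<noteq> 0" using nz[OF p] by (auto simp: d(1))
    \<comment> \<open>The second identity is the first one differentiated: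
      \<open>4 / (1 - x\<^sup>2)\<close> has derivative
      \<open>8 x / (1 - x\<^sup>2)\<^sup>2\<close>.\<close>
    have gk: "(g 1 x - g (-1) x) * (1 - x\<^sup>2) = 4" "(k (-1) x - k 1 x) * (1 - x\<^sup>2)\<^sup>2 = - (8 * x)"
    proof -
      define i j where ij: "i = inverse (x + 1)" "j = inverse (x - 1)"
      have "i * (x + 1) = 1" "j * (x - 1) = 1" using n by (simp_all add: ij)
      then show "(g 1 x - g (-1) x) * (1 - x\<^sup>2) = 4" "(k (-1) x - k 1 x) * (1 - x\<^sup>2)\<^sup>2 = - (8 * x)"
        unfolding g_def k_def by (simp_all add: ij[symmetric]) algebra+
    qed
    \<comment> \<open>Sorts the difference of the mixed derivatives by the second derivative
      \<open>w\<close> and the product \<open>y * z\<close>, so that \<open>gk\<close> and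
      \<open>key\<close> can be substituted.\<close>
    have "(G * w + (z * A) * y - (H * w + (y * B) * z)) * q\<^sup>2 = ((G - H) * q) * (w * q) - ((B - A) * q\<^sup>2) * (y * z)"
      for G H A B q :: real by algebra
    from this[of "g 1 x" "k 1 x" "g (-1) x" "k (-1) x" "1 - x\<^sup>2", unfolded gk key]
    have "(g 1 x * w + (z * k 1 x) * y - (g (-1) x * w + (y * k (-1) x) * z)) * (1 - x\<^sup>2)\<^sup>2 = 0" by simp
    then have "g 1 x * w + (z * k 1 x) * y = g (-1) x * w + (y * k (-1) x) * z" using n(4) by simp
    then show ?thesis
      unfolding \<alpha>_def[abs_def] \<beta>_def[abs_def] using p diff_at_commute[OF coords s(1) p, of ?f ?e] by (simp add: dg d)
  qed
  from closed_form_primitive[OF coords sc sm this]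
  obtain L where L: "smooth_map S u v L" "\<And>p. p \<in> S \<Longrightarrow> has_diff S u v L (\<lambda>w. w $ 1 *\<^sub>R \<alpha> p + w $ 2 *\<^sub>R \<beta> p) p" by blast
  have dL: "?d (\<lambda>p. exp (L p)) p w = (w $ 1 *\<^sub>R \<alpha> p + w $ 2 *\<^sub>R \<beta> p) * exp (L p)" if "p \<in> S" for p w
    using diff_at_real[OF DERIV_exp L(1) that] has_diff_imp_diff_at[OF L(2)[OF that]] by simp
  \<comment> \<open>\<open>L\<close> is the logarithm of the root sought; the exponential makes it
    positive.\<close>
  have "root_system s (\<lambda>p. exp (L p))"
    unfolding root_system_def
  proof (intro ballI conjI)
    fix p assume p: "p \<in> S"
    have "\<alpha> p * (s p * (s p + 1)) = (s p - 1) * ?d s p ?e" "\<beta> p * (s p * (s p - 1)) = (s p + 1) * ?d s p ?f"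
    proof -
      have "g c x * y * (x * (x + c)) = (x - c) * y" if "x \<noteq> 0" "x + c \<noteq> 0" for c x y
      proof -
        have "inverse x * x = 1" "inverse (x + c) * (x + c) = 1" using that by simp_all
        then show ?thesis unfolding g_def by algebra
      qed
      from this[of "s p" 1 "?d s p ?e"] this[of "s p" "-1" "?d s p ?f"] nz[OF p]
      show "\<alpha> p * (s p * (s p + 1)) = (s p - 1) * ?d s p ?e" "\<beta> p * (s p * (s p - 1)) = (s p + 1) * ?d s p ?f"
        unfolding \<alpha>_def \<beta>_def by simp_all
    qed
    then show "?d (\<lambda>p. exp (L p)) p ?e * (s p * (s p + 1)) = exp (L p) * ((s p - 1) * ?d s p ?e)"
      "?d (\<lambda>p. exp (L p)) p ?f * (s p * (s p - 1)) = exp (L p) * ((s p + 1) * ?d s p ?f)"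
      unfolding dL[OF p] by (simp_all add: axis_def)
  qed
  then show ?thesis using smooth_map_exp[OF L(1)] by (intro exI[of _ "\<lambda>p. exp (L p)"]) simp
qed

end

section \<open>The correspondence\<close>

lemma connected_sign:
  fixes f :: "'a::topological_space \<Rightarrow> real"
  assumes "connected S" "continuous_on S f" "\<And>p. p \<in> S \<Longrightarrow> f p \<noteq> 0"
  shows "(\<forall>p\<in>S. f p > 0) \<or> (\<forall>p\<in>S. f p < 0)"
proof (rule ccontr)
  assume "\<not> ?thesis"
  then obtain p q where pq: "p \<in> S" "f p \<le> 0" "q \<in> S" "f q \<ge> 0" by (auto simp: not_less)
  have "connected (f ` S)" by (rule connected_continuous_image[OF assms(2,1)])
  then have "0 \<in> f ` S" using connectedD_interval[of "f ` S" "f p" "f q" 0] pq by blast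
  then show False using assms(3) by auto
qed

lemma sqrt_neg_curvature:
  assumes "(K::real) < 0"
  shows "sqrt (- K) > 0" "K = - (sqrt (- K))\<^sup>2" "sqrt (- K) = 1 \<longleftrightarrow> K = -1" "sqrt (- K) > 1 \<longleftrightarrow> K < -1"
  using assms by auto

text \<open>The components arise by left translation to the identity, which is smooth in all its
  arguments, so \<open>n\<close> and \<open>\<omega>\<close> inherit smoothness from
  \<open>N\<close> and \<open>\<psi>\<close>.\<close>

lemma S3_frame_exists:
  assumes coords: "coordinates_on S u v" and \<psi>: "smooth_map S u v \<psi>" "\<psi> ` S \<subseteq> S3" and N: "unit_normal S u v frame_S3 \<psi> N"
  obtains n \<omega> where "smooth_map S u v n" "\<And>X. smooth_map S u v (\<lambda>p. \<omega> p X)"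
    "darboux S u v frame_S3 \<psi> N n \<omega> (\<lambda>p X. diff_at S u v n p X + cross3 (\<omega> p X) (n p))"
    "\<And>p X. p \<in> S \<Longrightarrow> diff_at S u v \<psi> p X = qmult (\<psi> p) (0, \<omega> p X)"
    "\<And>p. p \<in> S \<Longrightarrow> frame_comp frame_S3 (\<psi> p) (N p) = n p"
proof -
  define n where "n p = snd (qmult (qconj (\<psi> p)) (N p))" for p
  define \<omega> where "\<omega> p X = snd (qmult (qconj (\<psi> p)) (diff_at S u v \<psi> p X))" for p X
  have sN: "smooth_map S u v N" using N unfolding unit_normal_def by blast
  have sm: "smooth_map S u v (\<lambda>p. snd (qmult (qconj (\<psi> p)) (F p)))" if "smooth_map S u v F" for F
    by (rule smooth_map_bounded_linear[OF bounded_linear_snd smooth_map_bilinear[OF bounded_bilinear_qmult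
            smooth_map_bounded_linear[OF bounded_linear_qconj \<psi>(1)] that]])
  have S3: "\<psi> p \<in> S3" if "p \<in> S" for p using \<psi>(2) that by blast
  have unit: "norm (\<psi> p) = 1" "\<psi> p \<bullet> \<psi> p = 1" if "p \<in> S" for p using S3[OF that] by (simp_all add: norm_eq_1)
  have Nn: "N p = qmult (\<psi> p) (0, n p)" if p: "p \<in> S" for p
  proof -
    have "N p \<in> span (range (frame_S3 (\<psi> p)))" using N p unfolding unit_normal_def by blast
    then have "N p = qmult (\<psi> p) (0, frame_comp frame_S3 (\<psi> p) (N p))"
      using of_comp_frame_comp[OF orthonormal_frame_S3[OF S3[OF p]]] of_comp_S3 by metis
    then have "\<psi> p \<bullet> N p = 0" using qmult_perp by metis
    then show ?thesis unfolding n_def by (rule tangent_S3[OF S3[OF p]])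
  qed
  have d\<psi>: "diff_at S u v \<psi> p X = qmult (\<psi> p) (0, \<omega> p X)" if p: "p \<in> S" for p X
    unfolding \<omega>_def by (rule tangent_S3[OF S3[OF p] unit_perp_diff[OF coords \<psi>(1) unit(1) p]])
  have sn: "smooth_map S u v n" unfolding n_def[abs_def] by (rule sm[OF sN])
  have "darboux S u v frame_S3 \<psi> N n \<omega> (\<lambda>p X. diff_at S u v n p X + cross3 (\<omega> p X) (n p))"
  proof (rule darboux_S3[OF coords \<psi>(2) _ _ sn _ _ Nn])
    fix p X assume p: "p \<in> S"
    note h = smooth_has_diff[OF coords \<psi>(1) p]
    show "has_diff S u v \<psi> (\<lambda>X. qmult (\<psi> p) (0, \<omega> p X)) p" using h unfolding d\<psi>[OF p, symmetric] .
    show "linear (\<omega> p)"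
      unfolding \<omega>_def[abs_def]
      by (rule linearI) (simp_all add: linear_add[OF has_diff_linear[OF h]] linear_cmul[OF has_diff_linear[OF h]]
          bounded_bilinear.add_right[OF bounded_bilinear_qmult] bounded_bilinear.scaleR_right[OF bounded_bilinear_qmult])
    have "norm (N p) = 1" "N p \<bullet> diff_at S u v \<psi> p X = 0" using N p unfolding unit_normal_def by blast+
    then show "norm (n p) = 1" "n p \<bullet> \<omega> p X = 0"
      unfolding Nn[OF p] d\<psi>[OF p] by (simp_all add: norm_eq_1 qmult_inner unit(2)[OF p])
  qed
  moreover have "frame_comp frame_S3 (\<psi> p) (N p) = n p" if "p \<in> S" for p
    unfolding Nn[OF that] by (rule frame_comp_S3[OF S3[OF that]])
  moreover have "smooth_map S u v (\<lambda>p. \<omega> p X)" for X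
    unfolding \<omega>_def by (rule sm[OF smooth_map_diff_at[OF \<psi>(1)]])
  ultimately show thesis using that sn d\<psi> by blast
qed

lemma S3_to_R3:
  fixes \<psi> :: "'a::t2_space \<Rightarrow> real \<times> (real^3)"
  assumes sc: "simply_connected S" and imm: "immersion S u v S3 \<psi>" and ext: "extrinsic_curvature S u v frame_S3 \<psi> K"
    and K: "\<forall>p\<in>S. K p < 0 \<and> K p \<noteq> -1" and comp: "compatible_gauss_map S u v frame_S3 \<psi> g"
    and int: "\<forall>p\<in>S. partial_v S u v (\<lambda>q. -4 * partial_u S u v K q / (sqrt (- K q) * (1 + K q))) p = 0"
  shows "\<exists>(\<psi>' :: 'a \<Rightarrow> real^3) K'.
    immersion S u v R3 \<psi>' \<and> gauss_map S u v frame_R3 \<psi>' g \<and> proper_null_coordinates S u v frame_R3 \<psi>' \<and>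
    ((\<forall>p\<in>S. K p < -1) \<longrightarrow> compatible_gauss_map S u v frame_R3 \<psi>' g) \<and>
    ((\<forall>p\<in>S. -1 < K p) \<longrightarrow> compatible_gauss_map S (\<lambda>p. - u p) v frame_R3 \<psi>' g) \<and>
    extrinsic_curvature S u v frame_R3 \<psi>' K' \<and> (\<forall>p\<in>S. K' p < 0) \<and> curvature_system S u v K K'"
proof -
  let ?d = "\<lambda>F p X. diff_at S u v F p X" and ?e = "axis 1 1 :: real^2" and ?f = "axis 2 1 :: real^2"
  have coords: "coordinates_on S u v" and \<psi>: "smooth_map S u v \<psi>" "\<psi> ` S \<subseteq> S3"
    and inj: "\<And>p. p \<in> S \<Longrightarrow> inj (diff_at S u v \<psi> p)"
    using imm unfolding immersion_def by blast+
  have conn: "connected S" by (rule path_connected_imp_connected[OF simply_connected_path_connected[OF sc]])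
  obtain N where N: "compatible_normal S u v frame_S3 \<psi> N" "\<And>p. p \<in> S \<Longrightarrow> g p = stereo (frame_comp frame_S3 (\<psi> p) (N p))"
    using comp unfolding compatible_gauss_map_def by blast
  have uN: "unit_normal S u v frame_S3 \<psi> N" using N(1) unfolding compatible_normal_def by blast
  have sN: "smooth_map S u v N" using uN unfolding unit_normal_def by blast
  obtain n \<omega> where sn: "smooth_map S u v n" and s\<omega>: "\<And>X. smooth_map S u v (\<lambda>p. \<omega> p X)"
    and dar: "darboux S u v frame_S3 \<psi> N n \<omega> (\<lambda>p X. diff_at S u v n p X + cross3 (\<omega> p X) (n p))"
    and d\<psi>: "\<And>p X. p \<in> S \<Longrightarrow> diff_at S u v \<psi> p X = qmult (\<psi> p) (0, \<omega> p X)"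
    and Nn: "\<And>p. p \<in> S \<Longrightarrow> frame_comp frame_S3 (\<psi> p) (N p) = n p"
    by (rule S3_frame_exists[OF coords \<psi> uN]) blast
  have nn: "norm (n p) = 1" "n p \<bullet> \<omega> p X = 0" if "p \<in> S" for p X using dar that unfolding darboux_def by blast+
  have cn: "null_frame S n \<omega> (\<lambda>p X. ?d n p X + cross3 (\<omega> p X) (n p)) (\<lambda>p. sqrt (- shape_det S u v frame_S3 \<psi> N p))"
    "\<And>p. p \<in> S \<Longrightarrow> orient n \<omega> p > 0"
    by (rule compatible_normal_darboux[OF dar N(1) inj]; assumption)+
  define s where "s p = sqrt (- K p)" for p
  \<comment> \<open>The curvature \<open>K\<close> belongs to a normal that may differ from the
    compatible \<open>N\<close>; both give the same determinant.\<close>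
  have sdet: "sqrt (- shape_det S u v frame_S3 \<psi> N p) = s p" if p: "p \<in> S" for p
  proof -
    obtain N0 where N0: "unit_normal S u v frame_S3 \<psi> N0" "\<And>p. p \<in> S \<Longrightarrow> K p = shape_det S u v frame_S3 \<psi> N0 p"
      using ext unfolding extrinsic_curvature_def by blast
    have "orient n \<omega> q \<noteq> 0" if "q \<in> S" for q using cn(2)[OF that] by simp
    from unit_normal_shape_det[OF coords dar cn(1) sN this N0(1) p] show ?thesis by (simp add: s_def N0(2)[OF p])
  qed
  have s_pos: "s p > 0" and s1: "s p \<noteq> 1" and Ks: "K p = - (s p)\<^sup>2" and sK: "s p > 1 \<longleftrightarrow> K p < -1" if "p \<in> S" for p
    using sqrt_neg_curvature[of "K p"] K that unfolding s_def by blast+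
  define a b where "a p = \<omega> p ?e" and "b p = \<omega> p ?f" for p
  have sab: "smooth_map S u v a" "smooth_map S u v b" unfolding a_def[abs_def] b_def[abs_def] by (rule s\<omega>)+
  have nf: "(s p - 1) *\<^sub>R a p = cross3 (n p) (?d n p ?e)" "(s p + 1) *\<^sub>R b p = - cross3 (n p) (?d n p ?f)" if "p \<in> S" for p
    using cn(1) that unfolding null_frame_S3_iff[OF dar] a_def b_def by (simp_all add: sdet)
  have D: "n p \<bullet> cross3 (a p) (b p) > 0" if "p \<in> S" for p using cn(2)[OF that] by (simp add: orient_def a_def b_def)
  have a0: "a p \<noteq> 0" if "p \<in> S" for p using D[OF that] by auto
  \<comment> \<open>Smoothness of \<open>s\<close> is read off from
    \<open>(s - 1) a = n \<times> n\<^sub>u\<close>, in which \<open>a\<close> vanishes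
    nowhere.\<close>
  have "smooth_map S u v (\<lambda>p. s p - 1)"
    by (rule smooth_coefficient[OF coords sab(1) smooth_map_bilinear[OF bounded_bilinear_cross3[OF coords] sn smooth_map_diff_at[OF sn]] a0 nf(1)])
  from smooth_map_add[OF this smooth_map_const[of S u v 1]] have ss: "smooth_map S u v s" by simp
  have dK: "?d K p X = ?d s p X * (- (2 * s p))" if p: "p \<in> S" for p X
  proof -
    have "?d K p X = ?d (\<lambda>q. - (s q)\<^sup>2) p X" by (rule diff_at_cong_on[OF coords Ks p])
    also have "\<dots> = ?d s p X * (- (2 * s p))"
      by (rule diff_at_real[OF coords _ ss p]) (auto intro!: derivative_eq_intros)
    finally show ?thesis .
  qed
  have s2: "1 - (s p)\<^sup>2 \<noteq> 0" if "p \<in> S" for p using s_pos[OF that] s1[OF that] by (auto simp: power2_eq_1_iff)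
  have sH: "smooth_map S u v (\<lambda>q. ?d s q ?e * inverse (1 - (s q)\<^sup>2))"
    unfolding power2_eq_square using s2[unfolded power2_eq_square]
    by (intro smooth_map_mult smooth_map_diff_at smooth_map_inverse smooth_map_diff smooth_map_const ss)
  have int': "?d (\<lambda>q. ?d s q ?e * inverse (1 - (s q)\<^sup>2)) p ?f = 0" if p: "p \<in> S" for p
  proof -
    have "?d (\<lambda>q. -4 * partial_u S u v K q / (sqrt (- K q) * (1 + K q))) p ?f = 0"
      using int p unfolding partial_v_def by blast
    \<comment> \<open>With \<open>K = - s\<^sup>2\<close> and
      \<open>K\<^sub>u = - 2 s s\<^sub>u\<close> the differentiated expression is
      \<open>8 s\<^sub>u / (1 - s\<^sup>2)\<close>.\<close>
    also have "?d (\<lambda>q. -4 * partial_u S u v K q / (sqrt (- K q) * (1 + K q))) p ?f =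
        ?d (\<lambda>q. 8 *\<^sub>R (?d s q ?e * inverse (1 - (s q)\<^sup>2))) p ?f"
    proof (rule diff_at_cong_on[OF coords _ p])
      fix q assume q: "q \<in> S"
      show "-4 * partial_u S u v K q / (sqrt (- K q) * (1 + K q)) = 8 *\<^sub>R (?d s q ?e * inverse (1 - (s q)\<^sup>2))"
        unfolding partial_u_def dK[OF q] s_def[symmetric] Ks[OF q] using s_pos[OF q] s2[OF q]
        by (simp add: field_simps)
    qed
    also have "\<dots> = 8 *\<^sub>R ?d (\<lambda>q. ?d s q ?e * inverse (1 - (s q)\<^sup>2)) p ?f"
      by (rule diff_at_bounded_linear[OF coords bounded_linear_scaleR_right sH p])
    finally show ?thesis by simp
  qed
  obtain r where r: "smooth_map S u v r" "\<And>p. p \<in> S \<Longrightarrow> r p > 0" "root_system S u v s r"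
    using root_system_solvable[OF coords sc ss s_pos s1 int'] by blast
  have sir: "smooth_map S u v (\<lambda>p. inverse (r p))" using r(2) by (intro smooth_map_inverse r(1)) force
  have sc1: "smooth_map S u v (\<lambda>p. s p - 1)" "smooth_map S u v (\<lambda>p. s p + 1)"
    by (intro smooth_map_diff smooth_map_add smooth_map_const ss)+
  define \<alpha> \<beta> where "\<alpha> p = ((s p - 1) * inverse (r p)) *\<^sub>R a p" and "\<beta> p = ((s p + 1) * inverse (r p)) *\<^sub>R b p" for p
  have s\<alpha>\<beta>: "smooth_map S u v \<alpha>" "smooth_map S u v \<beta>"
    unfolding \<alpha>_def[abs_def] \<beta>_def[abs_def] by (intro smooth_map_scaleR smooth_map_mult sc1 sir sab)+
  have dinv: "?d (\<lambda>p. inverse (r p)) p X = ?d r p X * (- (inverse (r p))\<^sup>2)" if p: "p \<in> S" for p X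
    by (rule diff_at_real[OF coords _ r(1) p]) (use DERIV_inverse[of "r p"] r(2)[OF p] in \<open>simp add: numeral_2_eq_2\<close>)
  have dsc: "?d (\<lambda>p. s p - 1) p X = ?d s p X" "?d (\<lambda>p. s p + 1) p X = ?d s p X" if p: "p \<in> S" for p X
  proof -
    have "((\<lambda>x. x - 1) has_real_derivative 1) (at (s p))" "((\<lambda>x. x + 1) has_real_derivative 1) (at (s p))"
      by (auto intro!: derivative_eq_intros)
    then show "?d (\<lambda>p. s p - 1) p X = ?d s p X" "?d (\<lambda>p. s p + 1) p X = ?d s p X"
      using diff_at_real[OF coords _ ss p, of "\<lambda>x. x - 1" 1 X] diff_at_real[OF coords _ ss p, of "\<lambda>x. x + 1" 1 X]
      by simp_all
  qed
  have closed: "?d \<alpha> p ?f = ?d \<beta> p ?e" if p: "p \<in> S" for p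
  proof -
    define x i su sv ru rv where d: "x = s p" "i = inverse (r p)" "su = ?d s p ?e" "sv = ?d s p ?f" "ru = ?d r p ?e" "rv = ?d r p ?f"
    have d\<alpha>: "?d \<alpha> p ?f = ((x - 1) * i) *\<^sub>R ?d a p ?f + ((x - 1) * (rv * (- i\<^sup>2)) + sv * i) *\<^sub>R a p"
      unfolding \<alpha>_def[abs_def] diff_at_scaleR[OF coords smooth_map_mult[OF sc1(1) sir] sab(1) p]
        diff_at_mult[OF coords sc1(1) sir p] dinv[OF p] dsc[OF p] d ..
    have d\<beta>: "?d \<beta> p ?e = ((x + 1) * i) *\<^sub>R ?d b p ?e + ((x + 1) * (ru * (- i\<^sup>2)) + su * i) *\<^sub>R b p"
      unfolding \<beta>_def[abs_def] diff_at_scaleR[OF coords smooth_map_mult[OF sc1(2) sir] sab(2) p]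
        diff_at_mult[OF coords sc1(2) sir p] dinv[OF p] dsc[OF p] d ..
    have cod: "(sv *\<^sub>R a p + (x - 1) *\<^sub>R ?d a p ?f) + (su *\<^sub>R b p + (x + 1) *\<^sub>R ?d b p ?e) = (2 * (x - 1) * (x + 1)) *\<^sub>R cross3 (a p) (b p)"
      using codazzi[OF coords sn nn(1) sab sc1 nf p] unfolding dsc[OF p] d .
    have flat: "?d a p ?f - ?d b p ?e = 2 *\<^sub>R cross3 (a p) (b p)"
      by (rule flat_S3[OF coords \<psi> sab _ _ p]) (simp_all add: d\<psi> a_def b_def)
    have sys: "ru * (x * (x + 1)) = r p * ((x - 1) * su)" "rv * (x * (x - 1)) = r p * ((x + 1) * sv)"
      using r(3) p unfolding root_system_def[OF coords] d by blast+
    have i: "i * r p = 1" using r(2)[OF p] by (simp add: d(2))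
    show ?thesis
      unfolding d\<alpha> d\<beta> vec_eq_iff
    proof
      fix k :: 3
      define A B P Q C where k: "A = a p $ k" "B = b p $ k" "P = ?d a p ?f $ k" "Q = ?d b p ?e $ k" "C = cross3 (a p) (b p) $ k"
      have "(sv * A + (x - 1) * P) + (su * B + (x + 1) * Q) = (2 * (x - 1) * (x + 1)) * C"
        using arg_cong[OF cod, of "\<lambda>y. y $ k"] by (simp add: k)
      moreover have "P - Q = 2 * C" using arg_cong[OF flat, of "\<lambda>y. y $ k"] by (simp add: k)
      \<comment> \<open>After multiplication by \<open>x\<close> the root system turns the
        coefficients of \<open>A\<close> and \<open>B\<close> into \<open>- i * sv\<close> and
        \<open>i * su\<close>. What remains is the Codazzi identity with \<open>P - Q\<close>
        substituted for \<open>2 * C\<close>.\<close>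
      ultimately have "x * (((x - 1) * i) * P + ((x - 1) * (rv * (- i\<^sup>2)) + sv * i) * A) =
          x * (((x + 1) * i) * Q + ((x + 1) * (ru * (- i\<^sup>2)) + su * i) * B)"
        using sys i by algebra
      then have "((x - 1) * i) * P + ((x - 1) * (rv * (- i\<^sup>2)) + sv * i) * A =
          ((x + 1) * i) * Q + ((x + 1) * (ru * (- i\<^sup>2)) + su * i) * B"
        using s_pos[OF p] d(1) by simp
      then show "(((x - 1) * i) *\<^sub>R ?d a p ?f + ((x - 1) * (rv * (- i\<^sup>2)) + sv * i) *\<^sub>R a p) $ k =
          (((x + 1) * i) *\<^sub>R ?d b p ?e + ((x + 1) * (ru * (- i\<^sup>2)) + su * i) *\<^sub>R b p) $ k" by (simp add: k)
    qed
  qed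
  obtain \<psi>' where \<psi>': "smooth_map S u v \<psi>'" "\<And>p. p \<in> S \<Longrightarrow> has_diff S u v \<psi>' (\<lambda>w. w $ 1 *\<^sub>R \<alpha> p + w $ 2 *\<^sub>R \<beta> p) p"
    using closed_form_primitive[OF coords sc s\<alpha>\<beta> closed] by blast
  have d\<psi>': "?d \<psi>' p = (\<lambda>w. w $ 1 *\<^sub>R \<alpha> p + w $ 2 *\<^sub>R \<beta> p)" if "p \<in> S" for p by (rule has_diff_imp_diff_at[OF \<psi>'(2)[OF that]])
  have d12: "?d \<psi>' p ?e = \<alpha> p" "?d \<psi>' p ?f = \<beta> p" if "p \<in> S" for p unfolding d\<psi>'[OF that] by (simp_all add: axis_def)
  have dar': "darboux S u v frame_R3 \<psi>' n n (\<lambda>p. ?d \<psi>' p) (\<lambda>p. ?d n p)"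
  proof (rule darboux_R3[OF coords \<psi>'(1) sn nn(1)])
    show "n p \<bullet> ?d \<psi>' p X = 0" if "p \<in> S" for p X
      unfolding d\<psi>'[OF that] \<alpha>_def \<beta>_def a_def b_def using nn(2)[OF that] by (simp add: inner_add_right)
  qed
  have nf': "null_frame S n (\<lambda>p. ?d \<psi>' p) (\<lambda>p. ?d n p) r"
    unfolding null_frame_def
  proof (intro ballI conjI)
    fix p assume p: "p \<in> S"
    show "r p *\<^sub>R ?d \<psi>' p ?e = cross3 (n p) (?d n p ?e)" "r p *\<^sub>R ?d \<psi>' p ?f = - cross3 (n p) (?d n p ?f)"
      unfolding d12[OF p] \<alpha>_def \<beta>_def nf[OF p, symmetric] using r(2)[OF p] by simp_all
  qed
  have ori: "orient n (\<lambda>p. ?d \<psi>' p) p = (s p - 1) * ((s p + 1) * (inverse (r p))\<^sup>2 * (n p \<bullet> cross3 (a p) (b p)))" if p: "p \<in> S" for p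
    unfolding orient_def d12[OF p] \<alpha>_def \<beta>_def
    by (simp add: cross_mult_left cross_mult_right power2_eq_square)
  have pos: "(s p + 1) * (inverse (r p))\<^sup>2 * (n p \<bullet> cross3 (a p) (b p)) > 0" if p: "p \<in> S" for p
    using s_pos[OF p] r(2)[OF p] D[OF p] by simp
  have sgn: "orient n (\<lambda>p. ?d \<psi>' p) p > 0 \<longleftrightarrow> K p < -1" "orient n (\<lambda>p. ?d \<psi>' p) p < 0 \<longleftrightarrow> -1 < K p" if p: "p \<in> S" for p
    using pos[OF p] sK[OF p] s1[OF p] K p unfolding ori[OF p] by (auto simp: zero_less_mult_iff mult_less_0_iff)
  \<comment> \<open>Since \<open>s\<close> never equals 1 on the connected surface, only one
    orientation occurs. Proper null coordinates need one normal for the whole surface.\<close>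
  have "(\<forall>p\<in>S. s p - 1 > 0) \<or> (\<forall>p\<in>S. s p - 1 < 0)"
    by (rule connected_sign[OF conn smooth_map_continuous_on[OF coords sc1(1)]]) (use s1 in force)
  then have sgn_const: "(\<forall>p\<in>S. orient n (\<lambda>p. ?d \<psi>' p) p > 0) \<or> (\<forall>p\<in>S. orient n (\<lambda>p. ?d \<psi>' p) p < 0)"
    using ori pos by (auto simp: zero_less_mult_iff mult_less_0_iff)
  have gn: "g p = stereo (n p)" if "p \<in> S" for p using N(2)[OF that] Nn[OF that] by simp
  define K' where "K' p = - (r p)\<^sup>2" for p
  note A = coords \<psi>'(1) subset_UNIV sn dar' nf' r(2) sgn_const gn K'_def
  have concl: "immersion S u v R3 \<psi>'" "extrinsic_curvature S u v frame_R3 \<psi>' K'" "gauss_map S u v frame_R3 \<psi>' g"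
    "proper_null_coordinates S u v frame_R3 \<psi>'"
    by (rule null_immersion[OF A]; assumption)+
  have concl_pos: "compatible_gauss_map S u v frame_R3 \<psi>' g" if "\<forall>p\<in>S. K p < -1"
    by (rule null_immersion(5)[OF A]) (use that sgn in auto)
  have concl_neg: "compatible_gauss_map S (\<lambda>p. - u p) v frame_R3 \<psi>' g" if "\<forall>p\<in>S. -1 < K p"
    by (rule null_immersion(6)[OF A]) (use that sgn in auto)
  have "curvature_system S u v K K'"
    using curvature_system_iff[OF coords ss s_pos s1 r(1,2) Ks K'_def] r(3) by blast
  moreover have "\<forall>p\<in>S. K' p < 0" using r(2) by (force simp: K'_def)
  ultimately show ?thesis
    using concl concl_pos concl_neg by (intro exI[of _ \<psi>'] exI[of _ K'] conjI impI)
qed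

lemma R3_to_S3:
  fixes \<psi>' :: "'a::t2_space \<Rightarrow> real^3"
  assumes sc: "simply_connected S" and imm: "immersion S u v R3 \<psi>'" and ext: "extrinsic_curvature S u v frame_R3 \<psi>' K'"
    and K': "\<forall>p\<in>S. K' p < 0" and comp: "compatible_gauss_map S u v frame_R3 \<psi>' g"
    and smK: "smooth_map S u v K" and K: "\<forall>p\<in>S. K p < 0 \<and> K p \<noteq> -1" and sys: "curvature_system S u v K K'"
  shows "\<exists>\<psi> :: 'a \<Rightarrow> real \<times> (real^3).
    immersion S u v S3 \<psi> \<and> extrinsic_curvature S u v frame_S3 \<psi> K \<and> gauss_map S u v frame_S3 \<psi> g \<and>
    proper_null_coordinates S u v frame_S3 \<psi> \<and>
    ((\<forall>p\<in>S. K p < -1) \<longrightarrow> compatible_gauss_map S u v frame_S3 \<psi> g) \<and>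
    ((\<forall>p\<in>S. -1 < K p) \<longrightarrow> compatible_gauss_map S (\<lambda>p. - u p) v frame_S3 \<psi> g)"
proof -
  let ?d = "\<lambda>F p X. diff_at S u v F p X" and ?e = "axis 1 1 :: real^2" and ?f = "axis 2 1 :: real^2"
  have coords: "coordinates_on S u v" and \<psi>': "smooth_map S u v \<psi>'"
    and inj: "\<And>p. p \<in> S \<Longrightarrow> inj (diff_at S u v \<psi>' p)"
    using imm unfolding immersion_def by blast+
  have conn: "connected S" by (rule path_connected_imp_connected[OF simply_connected_path_connected[OF sc]])
  obtain n where N: "compatible_normal S u v frame_R3 \<psi>' n" "\<And>p. p \<in> S \<Longrightarrow> g p = stereo (frame_comp frame_R3 (\<psi>' p) (n p))"
    using comp unfolding compatible_gauss_map_def by blast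
  then have sn: "smooth_map S u v n" and nn: "\<And>p. p \<in> S \<Longrightarrow> norm (n p) = 1" "\<And>p X. p \<in> S \<Longrightarrow> n p \<bullet> ?d \<psi>' p X = 0"
    unfolding compatible_normal_def unit_normal_def by blast+
  have gn: "g p = stereo (n p)" if "p \<in> S" for p using N(2)[OF that] by (simp add: frame_comp_R3)
  have dar': "darboux S u v frame_R3 \<psi>' n n (\<lambda>p. ?d \<psi>' p) (\<lambda>p. ?d n p)" by (rule darboux_R3[OF coords \<psi>' sn nn])
  have cn: "null_frame S n (\<lambda>p. ?d \<psi>' p) (\<lambda>p. ?d n p) (\<lambda>p. sqrt (- shape_det S u v frame_R3 \<psi>' n p))"
    "\<And>p. p \<in> S \<Longrightarrow> orient n (\<lambda>p. ?d \<psi>' p) p > 0"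
    by (rule compatible_normal_darboux[OF dar' N(1) inj]; assumption)+
  define r where "r p = sqrt (- K' p)" for p
  have rdet: "sqrt (- shape_det S u v frame_R3 \<psi>' n p) = r p" if p: "p \<in> S" for p
  proof -
    obtain N0 where N0: "unit_normal S u v frame_R3 \<psi>' N0" "\<And>p. p \<in> S \<Longrightarrow> K' p = shape_det S u v frame_R3 \<psi>' N0 p"
      using ext unfolding extrinsic_curvature_def by blast
    have "orient n (\<lambda>p. ?d \<psi>' p) q \<noteq> 0" if "q \<in> S" for q using cn(2)[OF that] by simp
    from unit_normal_shape_det[OF coords dar' cn(1) sn this N0(1) p] show ?thesis by (simp add: r_def N0(2)[OF p])
  qed
  have r_pos: "r p > 0" and Kr: "K' p = - (r p)\<^sup>2" if "p \<in> S" for p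
    using sqrt_neg_curvature[of "K' p"] K' that unfolding r_def by blast+
  define s where "s p = sqrt (- K p)" for p
  have s_pos: "s p > 0" and s1: "s p \<noteq> 1" and Ks: "K p = - (s p)\<^sup>2" and sK: "s p > 1 \<longleftrightarrow> K p < -1" if "p \<in> S" for p
    using sqrt_neg_curvature[of "K p"] K that unfolding s_def by blast+
  have ss: "smooth_map S u v s"
    unfolding s_def[abs_def] by (rule smooth_map_sqrt[OF smooth_map_minus[OF smK]]) (use K in force)
  define a b where "a p = ?d \<psi>' p ?e" and "b p = ?d \<psi>' p ?f" for p
  have sab: "smooth_map S u v a" "smooth_map S u v b"
    unfolding a_def[abs_def] b_def[abs_def] by (rule smooth_map_diff_at[OF \<psi>'])+
  have nf: "r p *\<^sub>R a p = cross3 (n p) (?d n p ?e)" "r p *\<^sub>R b p = - cross3 (n p) (?d n p ?f)" if "p \<in> S" for p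
    using cn(1) that unfolding null_frame_def a_def b_def by (simp_all add: rdet)
  have D: "n p \<bullet> cross3 (a p) (b p) > 0" if "p \<in> S" for p using cn(2)[OF that] by (simp add: orient_def a_def b_def)
  have a0: "a p \<noteq> 0" if "p \<in> S" for p using D[OF that] by auto
  have sr: "smooth_map S u v r"
    by (rule smooth_coefficient[OF coords sab(1) smooth_map_bilinear[OF bounded_bilinear_cross3[OF coords] sn smooth_map_diff_at[OF sn]] a0 nf(1)])
  have root: "root_system S u v s r"
    using curvature_system_iff[OF coords ss s_pos s1 sr r_pos Ks Kr] sys by blast
  have sc1: "smooth_map S u v (\<lambda>p. s p - 1)" "smooth_map S u v (\<lambda>p. s p + 1)"
    by (intro smooth_map_diff smooth_map_add smooth_map_const ss)+
  have nz: "s p - 1 \<noteq> 0" "s p + 1 \<noteq> 0" if "p \<in> S" for p using s_pos[OF that] s1[OF that] by auto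
  have si: "smooth_map S u v (\<lambda>p. inverse (s p - 1))" "smooth_map S u v (\<lambda>p. inverse (s p + 1))"
    using nz by (intro smooth_map_inverse sc1; blast)+
  have dinv: "?d (\<lambda>p. inverse (s p - 1)) p X = ?d s p X * (- (inverse (s p - 1))\<^sup>2)"
    "?d (\<lambda>p. inverse (s p + 1)) p X = ?d s p X * (- (inverse (s p + 1))\<^sup>2)" if p: "p \<in> S" for p X
    by (rule diff_at_real[OF coords _ ss p]; use nz[OF p] in \<open>auto intro!: derivative_eq_intros simp: power2_eq_square\<close>)+
  define \<alpha> \<beta> where "\<alpha> p = (r p * inverse (s p - 1)) *\<^sub>R a p" and "\<beta> p = (r p * inverse (s p + 1)) *\<^sub>R b p" for p
  have s\<alpha>\<beta>: "smooth_map S u v \<alpha>" "smooth_map S u v \<beta>"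
    unfolding \<alpha>_def[abs_def] \<beta>_def[abs_def] by (intro smooth_map_scaleR smooth_map_mult si sr sab)+
  have flat: "?d \<alpha> p ?f - ?d \<beta> p ?e = 2 *\<^sub>R cross3 (\<alpha> p) (\<beta> p)" if p: "p \<in> S" for p
  proof -
    define x i j su sv ru rv where d: "x = s p" "i = inverse (s p - 1)" "j = inverse (s p + 1)"
      "su = ?d s p ?e" "sv = ?d s p ?f" "ru = ?d r p ?e" "rv = ?d r p ?f"
    define y where y: "y = r p"
    have d\<alpha>: "?d \<alpha> p ?f = (y * i) *\<^sub>R ?d a p ?f + (y * (sv * (- i\<^sup>2)) + rv * i) *\<^sub>R a p"
      unfolding \<alpha>_def[abs_def] diff_at_scaleR[OF coords smooth_map_mult[OF sr si(1)] sab(1) p]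
        diff_at_mult[OF coords sr si(1) p] dinv[OF p] d y ..
    have d\<beta>: "?d \<beta> p ?e = (y * j) *\<^sub>R ?d b p ?e + (y * (su * (- j\<^sup>2)) + ru * j) *\<^sub>R b p"
      unfolding \<beta>_def[abs_def] diff_at_scaleR[OF coords smooth_map_mult[OF sr si(2)] sab(2) p]
        diff_at_mult[OF coords sr si(2) p] dinv[OF p] d y ..
    have cod: "(rv *\<^sub>R a p + y *\<^sub>R ?d a p ?f) + (ru *\<^sub>R b p + y *\<^sub>R ?d b p ?e) = (2 * y * y) *\<^sub>R cross3 (a p) (b p)"
      using codazzi[OF coords sn nn(1) sab sr sr nf p] unfolding d y .
    have sym: "?d b p ?e = ?d a p ?f"
      unfolding a_def[abs_def] b_def[abs_def] by (rule diff_at_commute[OF coords \<psi>' p])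
    have sys': "ru * (x * (x + 1)) = y * ((x - 1) * su)" "rv * (x * (x - 1)) = y * ((x + 1) * sv)"
      using root p unfolding root_system_def[OF coords] d y by blast+
    have ij: "i * (x - 1) = 1" "j * (x + 1) = 1" using nz[OF p] by (simp_all add: d)
    have cr: "cross3 (\<alpha> p) (\<beta> p) = ((y * i) * (y * j)) *\<^sub>R cross3 (a p) (b p)"
      unfolding \<alpha>_def \<beta>_def d y by (simp add: cross_mult_left cross_mult_right)
    show ?thesis
      unfolding d\<alpha> d\<beta> sym cr vec_eq_iff
    proof
      fix k :: 3
      define A B P C where k: "A = a p $ k" "B = b p $ k" "P = ?d a p ?f $ k" "C = cross3 (a p) (b p) $ k"
      have "(rv * A + y * P) + (ru * B + y * P) = (2 * y * y) * C"
        using arg_cong[OF cod, of "\<lambda>y. y $ k"] by (simp add: k sym)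
      \<comment> \<open>After multiplication by \<open>x\<close> the root system turns the
        coefficients of \<open>A\<close> and \<open>B\<close> in the difference into
        \<open>y * sv * i\<^sup>2\<close> and \<open>y * su * j\<^sup>2\<close>. With
        \<open>i - j = 2 * i * j\<close> both sides become a multiple of the Codazzi
        identity.\<close>
      then have "x * (((y * i) * P + (y * (sv * (- i\<^sup>2)) + rv * i) * A) - ((y * j) * P + (y * (su * (- j\<^sup>2)) + ru * j) * B)) =
          x * (2 * (((y * i) * (y * j)) * C))"
        using sys' ij by algebra
      then have "((y * i) * P + (y * (sv * (- i\<^sup>2)) + rv * i) * A) - ((y * j) * P + (y * (su * (- j\<^sup>2)) + ru * j) * B) =
          2 * (((y * i) * (y * j)) * C)"
        using s_pos[OF p] d(1) by simp
      then show "((y * i) *\<^sub>R ?d a p ?f + (y * (sv * (- i\<^sup>2)) + rv * i) *\<^sub>R a p -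
          ((y * j) *\<^sub>R ?d a p ?f + (y * (su * (- j\<^sup>2)) + ru * j) *\<^sub>R b p)) $ k =
          (2 *\<^sub>R (((y * i) * (y * j)) *\<^sub>R cross3 (a p) (b p))) $ k" by (simp add: k)
    qed
  qed
  \<comment> \<open>The equation is \<open>d\<psi> = \<psi> (\<alpha> du + \<beta> dv)\<close>; the
    form multiplies from the right because the frame is left invariant. So
    \<open>bl \<alpha> (bl \<beta> q)\<close> is \<open>q \<beta> \<alpha>\<close>, and flatness
    reads \<open>\<alpha>\<^sub>v - \<beta>\<^sub>u = \<alpha> \<beta> - \<beta> \<alpha> = 2
    \<alpha> \<times> \<beta>\<close>.\<close>
  define bl where "bl w q = qmult q (0, w)" for w :: "real^3" and q
  have l: "bounded_linear (\<lambda>x::real^3. (0::real, x))"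
    unfolding linear_conv_bounded_linear[symmetric] by (rule linearI) simp_all
  have bl: "bounded_bilinear bl"
    using bounded_bilinear.comp1[OF bounded_bilinear.flip[OF bounded_bilinear_qmult] l] by (simp add: bl_def[abs_def])
  interpret surface_system S u v bl \<alpha> \<beta>
  proof (rule surface_system.intro[OF coords bl s\<alpha>\<beta>])
    fix p q assume p: "p \<in> S"
    have "(0, ?d \<alpha> p ?f) + qmult (0, \<beta> p) (0, \<alpha> p) = (0, ?d \<beta> p ?e) + qmult (0, \<alpha> p) (0, \<beta> p)"
      using flat[OF p] cross_skew[of "\<beta> p" "\<alpha> p"] by (simp add: qmult_def scaleR_2 inner_commute algebra_simps)
    then have "qmult q ((0, ?d \<alpha> p ?f) + qmult (0, \<beta> p) (0, \<alpha> p)) = qmult q ((0, ?d \<beta> p ?e) + qmult (0, \<alpha> p) (0, \<beta> p))"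
      by (rule arg_cong)
    then show "bl (?d \<alpha> p ?f) q + bl (\<alpha> p) (bl (\<beta> p) q) = bl (?d \<beta> p ?e) q + bl (\<beta> p) (bl (\<alpha> p) q)"
      unfolding bl_def qmult_assoc bounded_bilinear.add_right[OF bounded_bilinear_qmult] .
  qed
  define p0 where "p0 = (SOME p. p \<in> S)"
  obtain \<psi> where \<psi>: "smooth_map S u v \<psi>" "\<And>p. p \<in> S \<Longrightarrow> has_diff S u v \<psi> (\<lambda>w. bl (form p w) (\<psi> p)) p"
    "p0 \<in> S \<Longrightarrow> \<psi> p0 = (1, 0)"
    using solution_exists[OF sc, of p0 "(1, 0)"] by blast
  \<comment> \<open>\<open>\<psi>\<close> is orthogonal to its product with an imaginary quaternion,
    so the norm is constant and a solution that starts at the identity stays in the sphere.\<close>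
  have "has_diff S u v (\<lambda>p. \<psi> p \<bullet> \<psi> p) (\<lambda>w. 0) p" if "p \<in> S" for p
    using has_diff_bilinear[OF bounded_bilinear_inner \<psi>(2)[OF that] \<psi>(2)[OF that]]
    by (simp add: bl_def qmult_perp inner_commute[of "qmult _ _"])
  then have const: "\<psi> p \<bullet> \<psi> p = \<psi> q \<bullet> \<psi> q" if "p \<in> S" "q \<in> S" for p q
    using has_diff_zero_constant[OF coords conn _ that, of "\<lambda>p. \<psi> p \<bullet> \<psi> p"] by blast
  have im: "\<psi> ` S \<subseteq> S3"
  proof
    fix y assume "y \<in> \<psi> ` S"
    then obtain p where p: "p \<in> S" "y = \<psi> p" by blast
    have "p0 \<in> S" unfolding p0_def using p(1) by (rule someI)
    from const[OF p(1) this] \<psi>(3)[OF this] have "\<psi> p \<bullet> \<psi> p = 1" by (simp add: inner_prod_def)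
    then show "y \<in> S3" by (simp add: p(2) norm_eq_1)
  qed
  let ?\<tau> = "\<lambda>p X. ?d n p X + cross3 (form p X) (n p)"
  define N where "N p = qmult (\<psi> p) (0, n p)" for p
  have sN: "smooth_map S u v N"
    unfolding N_def[abs_def] by (rule smooth_map_bilinear[OF bounded_bilinear_qmult \<psi>(1) smooth_map_bounded_linear[OF l sn]])
  have f12: "form p ?e = \<alpha> p" "form p ?f = \<beta> p" for p by (simp_all add: form_def axis_def)
  have dar: "darboux S u v frame_S3 \<psi> N n form ?\<tau>"
  proof (rule darboux_S3[OF coords im _ _ sn nn(1) _ N_def])
    show "has_diff S u v \<psi> (\<lambda>X. qmult (\<psi> p) (0, form p X)) p" if "p \<in> S" for p
      using \<psi>(2)[OF that] unfolding bl_def .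
    show "linear (form p)" for p by (rule linearI) (simp_all add: form_def algebra_simps)
    show "n p \<bullet> form p X = 0" if "p \<in> S" for p X
      using nn(2)[OF that] by (simp add: form_def \<alpha>_def \<beta>_def a_def b_def inner_add_right)
  qed
  have nf': "null_frame S n form ?\<tau> s"
    unfolding null_frame_S3_iff[OF dar] f12
  proof (intro ballI conjI)
    fix p assume p: "p \<in> S"
    show "(s p - 1) *\<^sub>R \<alpha> p = cross3 (n p) (?d n p ?e)" "(s p + 1) *\<^sub>R \<beta> p = - cross3 (n p) (?d n p ?f)"
      unfolding \<alpha>_def \<beta>_def nf[OF p, symmetric] using nz[OF p] by simp_all
  qed
  have ori: "orient n form p = inverse (s p - 1) * (inverse (s p + 1) * (r p)\<^sup>2 * (n p \<bullet> cross3 (a p) (b p)))" for p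
    unfolding orient_def f12 \<alpha>_def \<beta>_def
    by (simp add: cross_mult_left cross_mult_right power2_eq_square)
  have pos: "inverse (s p + 1) * (r p)\<^sup>2 * (n p \<bullet> cross3 (a p) (b p)) > 0" if p: "p \<in> S" for p
    using s_pos[OF p] r_pos[OF p] D[OF p] by simp
  have sgn: "orient n form p > 0 \<longleftrightarrow> K p < -1" "orient n form p < 0 \<longleftrightarrow> -1 < K p" if p: "p \<in> S" for p
    using pos[OF p] sK[OF p] s1[OF p] K p unfolding ori by (auto simp: zero_less_mult_iff mult_less_0_iff)
  have "(\<forall>p\<in>S. s p - 1 > 0) \<or> (\<forall>p\<in>S. s p - 1 < 0)"
    by (rule connected_sign[OF conn smooth_map_continuous_on[OF coords sc1(1)]]) (use s1 in force)
  then have sgn_const: "(\<forall>p\<in>S. orient n form p > 0) \<or> (\<forall>p\<in>S. orient n form p < 0)"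
    using ori pos by (auto simp: zero_less_mult_iff mult_less_0_iff)
  note A = coords \<psi>(1) im sN dar nf' s_pos sgn_const gn Ks
  have "immersion S u v S3 \<psi>" "extrinsic_curvature S u v frame_S3 \<psi> K" "gauss_map S u v frame_S3 \<psi> g"
    "proper_null_coordinates S u v frame_S3 \<psi>"
    by (rule null_immersion[OF A]; assumption)+
  moreover have "compatible_gauss_map S u v frame_S3 \<psi> g" if "\<forall>p\<in>S. K p < -1"
    by (rule null_immersion(5)[OF A]) (use that sgn in auto)
  moreover have "compatible_gauss_map S (\<lambda>p. - u p) v frame_S3 \<psi> g" if "\<forall>p\<in>S. -1 < K p"
    by (rule null_immersion(6)[OF A]) (use that sgn in auto)
  ultimately show ?thesis by (intro exI[of _ \<psi>] conjI impI)
qed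

theorem proposition4p8:
  fixes S :: "'a::t2_space set" and u v :: "'a \<Rightarrow> real"
  assumes "simply_connected S"
  shows
    "(\<forall>(\<psi> :: 'a \<Rightarrow> real \<times> (real^3)) K g.
        immersion S u v S3 \<psi> \<and>
        extrinsic_curvature S u v frame_S3 \<psi> K \<and>
        (\<forall>p\<in>S. K p < 0 \<and> K p \<noteq> -1) \<and>
        proper_null_coordinates S u v frame_S3 \<psi> \<and>
        compatible_gauss_map S u v frame_S3 \<psi> g \<and>
        (\<forall>p\<in>S. partial_v S u v
            (\<lambda>q. -4 * partial_u S u v K q / (sqrt (- K q) * (1 + K q))) p = 0)
      \<longrightarrow>
        (\<exists>(\<psi>' :: 'a \<Rightarrow> real^3) K'.
           immersion S u v R3 \<psi>' \<and>
           gauss_map S u v frame_R3 \<psi>' g \<and>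
           proper_null_coordinates S u v frame_R3 \<psi>' \<and>
           ((\<forall>p\<in>S. K p < -1) \<longrightarrow> compatible_gauss_map S u v frame_R3 \<psi>' g) \<and>
           ((\<forall>p\<in>S. -1 < K p) \<longrightarrow> compatible_gauss_map S (\<lambda>p. - u p) v frame_R3 \<psi>' g) \<and>
           extrinsic_curvature S u v frame_R3 \<psi>' K' \<and>
           (\<forall>p\<in>S. K' p < 0) \<and>
           curvature_system S u v K K'))
     \<and>
     (\<forall>(\<psi>' :: 'a \<Rightarrow> real^3) K' g K.
        immersion S u v R3 \<psi>' \<and>
        extrinsic_curvature S u v frame_R3 \<psi>' K' \<and>
        (\<forall>p\<in>S. K' p < 0) \<and>
        proper_null_coordinates S u v frame_R3 \<psi>' \<and>
        compatible_gauss_map S u v frame_R3 \<psi>' g \<and>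
        smooth_map S u v K \<and>
        (\<forall>p\<in>S. K p < 0 \<and> K p \<noteq> -1) \<and>
        curvature_system S u v K K'
      \<longrightarrow>
        (\<exists>\<psi> :: 'a \<Rightarrow> real \<times> (real^3).
           immersion S u v S3 \<psi> \<and>
           extrinsic_curvature S u v frame_S3 \<psi> K \<and>
           gauss_map S u v frame_S3 \<psi> g \<and>
           proper_null_coordinates S u v frame_S3 \<psi> \<and>
           ((\<forall>p\<in>S. K p < -1) \<longrightarrow> compatible_gauss_map S u v frame_S3 \<psi> g) \<and>
           ((\<forall>p\<in>S. -1 < K p) \<longrightarrow> compatible_gauss_map S (\<lambda>p. - u p) v frame_S3 \<psi> g)))"
  by (intro conjI allI impI; elim conjE; rule S3_to_R3[OF assms] R3_to_S3[OF assms]; assumption)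

end
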